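(* Let $p\equiv 1\pmod 4$ be a prime power, let $\lambda$ be any positive divisor of $(p-1)/4$, and put $d=(p-1)/(4\lambda)$. (1) If $p\equiv 1$ or $5 \pmod{12}$, then there exists an $(\mathbb{F}_{p}\times \mathbb{F}_{q},\mathbb{F}_{p}\times \{0\},p,\lambda)$-DF for every prime power $q$ with $\lambda(q-1)\equiv 0\pmod{p-1}$ and $q>Q(d,p-4)$. (2) Suppose $p$ is a power of $9$. Let $q$ be a prime power with $\lambda(q-1)\equiv 0\pmod{p-1}$ and $q>Q(d,p-4)$, and let $\xi$ be a primitive $4$th root of unity in $\mathbb{F}_{q}$. If $\lambda>1$ or $1-\xi\notin C_{0}^{d,q}$, then there exists an $(\mathbb{F}_{p}\times \mathbb{F}_{q},\mathbb{F}_{p}\times \{0\},p,\lambda)$-DF.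
   Context: For an additive group $G$ of order $g$ with a subgroup $N$ of order $n$, a $(G,N,k,\lambda)$ relative difference family (DF) is a multiset $[B_1,\dots,B_r]$ of $k$-subsets of $G$ such that the multiset $\bigcup_{i}[x-y: x,y\in B_i, x\neq y]$ contains every element of $G\setminus N$ exactly $\lambda$ times and no element of $N$. For a prime power $q$ and $d\mid q-1$, $C_0^{d,q}$ denotes the multiplicative subgroup of nonzero $d$th powers in $\mathbb{F}_q^*$. For positive integers $d,m$, $Q(d,m)=\frac{1}{4}\left(U+\sqrt{U^2+4d^{m-1}m}\right)^2$ where $U=\sum_{h=1}^m \binom{m}{h}(d-1)^h(h-1)$. *)

theory Defs
  imports
    "HOL-Number_Theory.Number_Theory"
    "HOL-Library.Multiset"
    "HOL-Library.Product_Plus"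
    "HOL-Library.Cardinality"
begin

definition add_subgroup :: "'a::group_add set \<Rightarrow> bool" where
  "add_subgroup H \<longleftrightarrow> 0 \<in> H \<and> (\<forall>x\<in>H. \<forall>y\<in>H. x - y \<in> H)"

definition differences :: "'a::group_add set \<Rightarrow> 'a multiset" where
  "differences B =
     image_mset (\<lambda>(x, y). x - y) (mset_set {(x, y). x \<in> B \<and> y \<in> B \<and> x \<noteq> y})"

text \<open>
  A family is a multiset of blocks, so repeated blocks are allowed and each copy
  contributes its differences. Finiteness of \<open>G\<close> makes every block finite, which
  \<^const>\<open>mset_set\<close> in \<^const>\<open>differences\<close> relies on.
\<close>

definition relative_difference_family ::
  "'a::group_add set \<Rightarrow> 'a set \<Rightarrow> nat \<Rightarrow> nat \<Rightarrow> 'a set multiset \<Rightarrow> bool" where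
  "relative_difference_family G N k lam Bs \<longleftrightarrow>
     finite G \<and> add_subgroup G \<and> add_subgroup N \<and> N \<subseteq> G \<and>
     (\<forall>B\<in>#Bs. B \<subseteq> G \<and> card B = k) \<and>
     (\<forall>g\<in>G - N. count (\<Sum>B\<in>#Bs. differences B) g = lam) \<and>
     (\<forall>g\<in>N. count (\<Sum>B\<in>#Bs. differences B) g = 0)"

text \<open>
  The group $C_0^{d,q}$ of nonzero $d$-th powers; the field order $q$ is carried by
  the type.
\<close>

definition nonzero_powers :: "nat \<Rightarrow> 'a::field set" where
  "nonzero_powers d = {x ^ d | x. x \<noteq> 0}"

definition primitive_root_of_unity :: "nat \<Rightarrow> 'a::field \<Rightarrow> bool" where
  "primitive_root_of_unity n z \<longleftrightarrow>
     n > 0 \<and> z ^ n = 1 \<and> (\<forall>m. 0 < m \<and> m < n \<longrightarrow> z ^ m \<noteq> 1)"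

definition U_sum :: "nat \<Rightarrow> nat \<Rightarrow> real" where
  "U_sum d m = (\<Sum>h = 1..m. real (m choose h) * (real d - 1) ^ h * (real h - 1))"

definition Q_bound :: "nat \<Rightarrow> nat \<Rightarrow> real" where
  "Q_bound d m =
     1 / 4 * (U_sum d m + sqrt ((U_sum d m)\<^sup>2 + 4 * real d ^ (m - 1) * real m))\<^sup>2"

end

theory Submission
  imports Defs "HOL-Algebra.Algebraic_Closure_Type"
begin

text \<open>
  Write $p = 4n + 1$ with $n = d \lambda$, and let $\iota$ and $\xi$ be primitive fourth roots of
  unity in $F_p$ and $F_q$.  The base blocks are $\{(t^2, s\,\Phi(t)) : t \in F_p\}$, where
  $\Phi(\iota t) = \xi\,\Phi(t)$ and $s$ runs through representatives of $C_0^{d,q}$ modulo $\xi$.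
  The differences with a given first coordinate come from pairs $(t,u)$ with $t^2 - u^2$ fixed, and
  they cover $F_q^*$ evenly as soon as the values $\Phi(t) - \Phi(u)$ on these pairs are equally
  distributed over the cosets of $C_0^{d,q}$.  So one first prescribes a coset for every pair
  $\{t,u\}$, consistently with the rotation by $\iota$; the only obstruction is that the cosets on the
  pairs $(t,0)$, $(t,-t)$ and $(t,\pm\iota t)$ determine one another, which is where the condition
  on $1 - \xi$ comes from.  The values $\Phi(t)$ are then chosen one orbit of $\iota$ at a time; each
  choice asks for an element of $F_q$ in prescribed cosets after translation by at most $p - 4$
  elements, and it exists for $q > Q(d, p-4)$ by Weil's bound for sums of products of
  multiplicative characters at linear arguments.

  Weil's bound for these sums is obtained from the $L$-function of the character product, which is a
  polynomial of degree less than the number of factors.  By Newton's identities the sums over the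
  extensions of degree $k$ are the power sums of its reciprocal roots, and a bound
  $O(q^{k/2})$ for even $k$, given by Stepanov's method in Bombieri's form, forces each
  of these roots to have absolute value at most $\sqrt q$.
\<close>

hide_const (open) Divisibility.prime Divisibility.irreducible

section \<open>Stepanov's method\<close>

text \<open>The squares in the first coordinate come from a symmetry: (t,u) -> (\<iota> u, \<iota>
  t) keeps t^2 - u^2 and multiplies \<Phi>(t) - \<Phi>(u) by -\<xi>. The p - 1 pairs with a given c
  = t^2 - u^2 thus fall into orbits of length four, each of the d cosets has to receive 4 \<lambda>
  of them, and the factor 4 disappears because s runs modulo \<xi> only. For nonzero c the forced
  pairs form at most two orbits, so they can overload a coset only if \<lambda> = 1. Then the cosets
  of the \<Phi>(g^i) are given by a bijection C modulo n = d that must avoid C(i + s) = C(i) +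
  \<kappa>, where s is the logarithm of a square root of 2 and \<kappa> that of 1 - \<xi>. In the
  cases that arise such a C exists unless s = \<kappa> = 0 modulo n, and s = 0 means 2 = -1, which
  is characteristic 3. The number p - 4 = 4 (n - 1) + 1 counts 0 and the four rotations of at most n
  - 1 earlier values of \<Phi>. Extension fields are sets of fixed points of Frobenius powers inside
  one algebraic closure, so that their degree is an ordinary variable.\<close>

lemma map_poly_mult_hom:
  assumes "h 0 = 0" "\<And>x y. h (x + y) = h x + h y" "\<And>x y. h (x * y) = h x * h y"
  shows "map_poly h (p * q) = map_poly h p * map_poly h q"
proof -
  have h_sum: "h (sum g A) = (\<Sum>x\<in>A. h (g x))" for g and A :: "nat set"
    by (induction A rule: infinite_finite_induct) (auto simp: assms)
  show ?thesis
    by (rule poly_eqI) (simp add: coeff_map_poly assms coeff_mult h_sum)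
qed

lemma map_poly_prod_hom:
  assumes "h 0 = 0" "h 1 = 1" "\<And>x y. h (x + y) = h x + h y" "\<And>x y. h (x * y) = h x * h y"
  shows "map_poly h (prod g A) = (\<Prod>i\<in>A. map_poly h (g i))"
  by (induction A rule: infinite_finite_induct) (auto simp: map_poly_mult_hom assms)

lemma poly_map_poly_altdef:
  fixes h :: "'a::zero \<Rightarrow> 'b::comm_semiring_1"
  assumes "h 0 = 0" "degree p < n"
  shows "poly (map_poly h p) y = (\<Sum>i<n. h (coeff p i) * y ^ i)"
proof -
  have deg: "degree (map_poly h p) \<le> degree p" by (rule map_poly_degree_leq)
  have "poly (map_poly h p) y = (\<Sum>i\<le>degree (map_poly h p). coeff (map_poly h p) i * y ^ i)"
    by (rule poly_altdef)
  also have "\<dots> = (\<Sum>i<n. coeff (map_poly h p) i * y ^ i)"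
    using deg assms(2)
    by (intro sum.mono_neutral_left) (auto simp: coeff_eq_0)
  finally show ?thesis by (simp add: coeff_map_poly assms)
qed

lemma poly_altdef_lessThan:
  fixes p :: "'a::comm_semiring_1 poly"
  assumes "degree p < n"
  shows "poly p y = (\<Sum>i<n. coeff p i * y ^ i)"
  using poly_map_poly_altdef[of id p n y] assms by simp

text \<open>
  The constant coefficient of a factor of $Y^d - c$ of degree $\delta$ is, up to a sign and a
  $d$-th root of unity, the $\delta$-th power of a root.
\<close>
lemma kummer_degree:
  fixes c :: "'k::field" and y :: "'k alg_closure"
  assumes y: "y ^ d = to_ac c" and "d > 0"
    and A: "A \<noteq> 0" "poly (map_poly to_ac A) y = 0" "degree A < d"
  shows "\<exists>\<delta> u. 0 < \<delta> \<and> \<delta> < d \<and> u ^ d = ((-1) ^ d * c) ^ \<delta>"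
proof -
  define P where "P = (\<lambda>A::'k poly. A \<noteq> 0 \<and> poly (map_poly to_ac A) y = 0)"
  \<comment> \<open>\<open>B\<close> is a minimal polynomial of \<open>y\<close> over the ground
    field. Its monic multiple \<open>B'\<close> divides Y^d - c, because the remainder would be a
    smaller relation; so all roots of \<open>B'\<close> are d-th roots of c.\<close>
  obtain B where B: "P B" "\<And>C. P C \<Longrightarrow> degree B \<le> degree C"
    using ex_has_least_nat[of P A degree] A unfolding P_def by blast
  define B' where "B' = smult (inverse (lead_coeff B)) B"
  have B0: "B \<noteq> 0" and By: "poly (map_poly to_ac B) y = 0" using B(1) by (auto simp: P_def)
  have lc: "lead_coeff B' = 1" and deg: "degree B' = degree B" and B'0: "B' \<noteq> 0"
    using B0 by (auto simp: B'_def)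
  have B'y: "poly (map_poly to_ac B') y = 0"
    using By by (simp add: B'_def map_poly_smult)
  have min: "degree B' \<le> degree C" if "C \<noteq> 0" "poly (map_poly to_ac C) y = 0" for C
    using B(2)[of C] that deg by (auto simp: P_def)
  define E where "E = monom 1 d - [:c:]"
  have mX: "map_poly to_ac E = monom 1 d - [:to_ac c:]"
    by (rule poly_eqI) (auto simp: E_def coeff_map_poly coeff_pCons split: nat.splits)
  have Xy: "poly (map_poly to_ac E) y = 0"
    by (simp add: mX poly_monom y)
  define R where "R = E mod B'"
  have XR: "E = B' * (E div B') + R" by (simp add: R_def)
  have "map_poly to_ac E = map_poly to_ac B' * map_poly to_ac (E div B') + map_poly to_ac R"
  proof (rule poly_eqI)
    fix i
    have "coeff E i = coeff (B' * (E div B')) i + coeff R i"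
      using XR coeff_add by metis
    hence "to_ac (coeff E i) = to_ac (coeff (B' * (E div B')) i) + to_ac (coeff R i)" by simp
    thus "coeff (map_poly to_ac E) i =
        coeff (map_poly to_ac B' * map_poly to_ac (E div B') + map_poly to_ac R) i"
      by (simp add: coeff_map_poly flip: map_poly_mult_hom)
  qed
  hence "poly (map_poly to_ac R) y = 0" using Xy B'y by simp
  hence R0: "R = 0"
    using min[of R] degree_mod_less'[of B' E] B'0 unfolding R_def by force
  have dvd: "map_poly to_ac E = map_poly to_ac B' * map_poly to_ac (E div B')"
    unfolding map_poly_mult_hom[OF to_ac_0 to_ac_add to_ac_mult, symmetric] using XR R0 by simp
  define Bh where "Bh = map_poly to_ac B'"
  have lcBh: "lead_coeff Bh = 1" and degBh: "degree Bh = degree B'"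
    using lc by (auto simp: Bh_def degree_map_poly coeff_map_poly lead_coeff_map_poly_nz)
  have "Bh \<noteq> 0" using lcBh by force
  then obtain M where M: "size M = degree Bh" "Bh = (\<Prod>x\<in>#M. [:-x, 1:])"
    using alg_closed_imp_factorization[of Bh] lcBh by auto
  have root: "x ^ d = to_ac c" if "x \<in># M" for x
  proof -
    from that have "poly Bh x = 0"
      by (subst M) (auto simp: poly_prod_mset prod_mset_zero_iff)
    hence "poly (map_poly to_ac E) x = 0" using dvd by (simp add: Bh_def)
    thus ?thesis by (simp add: mX poly_monom)
  qed
  have "to_ac (coeff B' 0) = coeff Bh 0" by (simp add: Bh_def coeff_map_poly)
  also have "\<dots> = (\<Prod>x\<in>#M. -x)"
    by (subst M) (simp add: poly_prod_mset image_mset.compositionality o_def flip: poly_0_coeff_0)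
  finally have "to_ac (coeff B' 0 ^ d) = (\<Prod>x\<in>#M. -x) ^ d" by simp
  also have "\<dots> = (\<Prod>x\<in>#M. (-x) ^ d)"
  proof -
    have "(\<Prod>x\<in>#M. g x) ^ d = (\<Prod>x\<in>#M. g x ^ d)" for g :: "'k alg_closure \<Rightarrow> 'k alg_closure"
      by (induction M) (auto simp: power_mult_distrib)
    thus ?thesis .
  qed
  \<comment> \<open>Each factor becomes (-1)^d c, whichever d-th root of c it comes from, so the
    number of roots alone determines the product.\<close>
  also have "image_mset (\<lambda>x. (-x) ^ d) M = image_mset (\<lambda>x. to_ac ((-1) ^ d * c)) M"
    by (intro image_mset_cong, subst power_minus) (simp add: root)
  also have "\<Prod>\<^sub># \<dots> = to_ac (((-1) ^ d * c) ^ degree B')"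
    using M(1) degBh by simp
  finally have u: "coeff B' 0 ^ d = ((-1) ^ d * c) ^ degree B'" by (simp only: to_ac_eq_iff)
  have "degree B' < d" using min[OF A(1,2)] A(3) by linarith
  moreover have "degree B' > 0"
  proof (rule ccontr)
    assume "\<not> degree B' > 0"
    then obtain a where "B' = [:a:]" by (meson degree_eq_zeroE neq0_conv)
    thus False using B'y B'0 by (auto simp: map_poly_pCons)
  qed
  ultimately show ?thesis using u by blast
qed

text \<open>Degrees in the inner variable add up under multiplication, whatever the outer degree is.
  This bounds the coefficients of the norm in the next argument.\<close>

lemma degree_coeff_prod_le:
  fixes P :: "'i \<Rightarrow> 'a::comm_ring_1 poly poly"
  assumes "finite I" "\<And>i j. i \<in> I \<Longrightarrow> degree (coeff (P i) j) \<le> D"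
  shows "degree (coeff (prod P I) j) \<le> card I * D"
  using assms
proof (induction I arbitrary: j rule: finite_induct)
  case empty
  then show ?case by (simp add: coeff_pCons split: nat.splits)
next
  case (insert i I)
  have "degree (coeff (P i) k * coeff (prod P I) (j - k)) \<le> D + card I * D" for k
    using insert.IH[of "j - k"] insert.prems[of i k] insert.prems
    by (meson add_mono degree_mult_le insertCI order_trans)
  hence "degree (\<Sum>k\<le>j. coeff (P i) k * coeff (prod P I) (j - k)) \<le> D + card I * D"
    by (intro degree_sum_le) auto
  thus ?case using insert by (simp add: coeff_mult)
qed

text \<open>
  A norm argument: the product over all $d$-th roots of unity $\zeta$ of the conjugate relations
  is a polynomial in $\varphi^d$, which is known modulo $x^R$.  For degree reasons this turns the
  congruence into an honest algebraic relation for a root of $Y^d = c_0/f$ over the rational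
  function field.
\<close>
lemma kummer_independence:
  fixes f \<phi> :: "'a::alg_closed_field poly" and s :: "nat \<Rightarrow> 'a poly"
  assumes d: "d > 0" and roots: "card {z::'a. z ^ d = 1} = d"
    and f0: "f \<noteq> 0" and c0: "c0 \<noteq> 0"
    and irr: "\<And>\<delta> u v c. \<lbrakk>0 < \<delta>; \<delta> < d; u \<noteq> 0; v \<noteq> 0; c \<noteq> 0\<rbrakk> \<Longrightarrow> u ^ d * f ^ \<delta> \<noteq> smult c (v ^ d)"
    and cong: "monom 1 R dvd f * \<phi> ^ d - [:c0:]"
    and degs: "\<And>b. b < d \<Longrightarrow> degree (s b) \<le> M"
    and R: "d * M + (d - 1) * degree f < R"
    and dvd: "monom 1 R dvd (\<Sum>b<d. \<phi> ^ b * s b)"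
    and b: "b < d"
  shows "s b = 0"
proof (rule ccontr)
  assume sb: "s b \<noteq> 0"
  define Z where "Z = {z::'a. z ^ d = 1}"
  have Z: "card Z = d" "finite Z" using roots d by (auto simp: Z_def card_ge_0_finite)
  \<comment> \<open>\<open>P z\<close> is the relation with \<phi> replaced by z times an outer
    variable Y; for z = 1 and Y = \<phi> it is the given sum. The product \<open>N\<close> is
    invariant under Y -> \<eta> Y for every d-th root of unity \<eta>, hence a polynomial in
    Y^d.\<close>
  define P where "P = (\<lambda>z. \<Sum>b<d. monom (smult (z ^ b) (s b)) b)"
  define N where "N = prod P Z"
  have coeffP: "coeff (P z) j = (if j < d then smult (z ^ j) (s j) else 0)" for z j
    by (simp add: P_def coeff_sum coeff_monom)
  have degP: "degree (P z) \<le> d - 1" for z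
    by (rule degree_le) (auto simp: coeffP)
  \<comment> \<open>The strict bound d (d - 1) < d^2 leaves only the exponents d i with i < d, so
    multiplying by f^(d-1) clears all denominators when Y^d becomes c0 / f.\<close>
  have degN: "degree N < d * d"
  proof -
    have "degree N \<le> (\<Sum>z\<in>Z. degree (P z))"
      unfolding N_def using degree_prod_sum_le[OF Z(2), of P] by (simp add: o_def)
    also have "\<dots> \<le> (\<Sum>z\<in>Z. d - 1)" by (intro sum_mono degP)
    also have "\<dots> < d * d" using d Z(1) by simp
    finally show ?thesis .
  qed
  have degcN: "degree (coeff N j) \<le> d * M" for j
    unfolding N_def using degree_coeff_prod_le[OF Z(2), of P M j] Z(1) degs
    by (auto simp: coeffP intro: order_trans[OF degree_smult_le])
  have scaleP: "pcompose (P z) [:0, [:\<eta>:]:] = P (z * \<eta>)" for z \<eta>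
    by (rule poly_eqI) (auto simp: coeff_pcompose_linear coeffP power_mult_distrib poly_const_pow mult_ac)
  have scaleN: "pcompose N [:0, [:\<eta>:]:] = N" if "\<eta> \<in> Z" for \<eta>
  proof -
    have "\<eta> \<noteq> 0" using that d by (auto simp: Z_def power_0_left)
    have "pcompose N [:0, [:\<eta>:]:] = (\<Prod>z\<in>Z. P (z * \<eta>))"
      by (simp add: N_def pcompose_prod scaleP)
    also have "\<dots> = (\<Prod>z\<in>Z. P z)"
      by (rule prod.reindex_bij_witness[of _ "\<lambda>z. z / \<eta>" "\<lambda>z. z * \<eta>"])
        (use that \<open>\<eta> \<noteq> 0\<close> in \<open>auto simp: Z_def power_mult_distrib power_divide\<close>)
    finally show ?thesis by (simp add: N_def)
  qed
  have coeffN: "coeff N j = 0" if "\<not> d dvd j" for j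
  proof (rule ccontr)
    assume nz: "coeff N j \<noteq> 0"
    define r where "r = j mod d"
    have r: "0 < r" "r < d" using that d by (auto simp: r_def dvd_eq_mod_eq_0)
    have "\<eta> ^ r = 1" if "\<eta> \<in> Z" for \<eta>
    proof -
      have "coeff N j = coeff (pcompose N [:0, [:\<eta>:]:]) j" using scaleN[OF that] by simp
      also have "\<dots> = smult (\<eta> ^ j) (coeff N j)"
        by (simp add: coeff_pcompose_linear poly_const_pow)
      finally have "smult (\<eta> ^ j - 1) (coeff N j) = 0" by (simp add: smult_diff_left)
      hence "\<eta> ^ j = 1" using nz by simp
      moreover have "\<eta> ^ j = (\<eta> ^ d) ^ (j div d) * \<eta> ^ r"
        by (simp add: r_def flip: power_mult power_add)
      ultimately show ?thesis using that by (simp add: Z_def)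
    qed
    hence "Z \<subseteq> {x. poly (monom 1 r - 1) x = 0}" by (auto simp: poly_monom)
    moreover have "monom 1 r - (1::'a poly) \<noteq> 0"
      using r by (metis degree_0 degree_1 degree_monom_eq eq_iff_diff_eq_0 less_irrefl one_neq_zero)
    moreover have "degree (monom 1 r - (1::'a poly)) \<le> r"
      by (intro degree_diff_le) (auto simp: degree_monom_le)
    ultimately have "card Z \<le> r"
      using card_poly_roots_bound[of "monom 1 r - (1::'a poly)"]
        card_mono[of "{x. poly (monom 1 r - 1) x = (0::'a)}" Z] poly_roots_finite
      by (metis order_trans)
    thus False using r Z by simp
  qed
  have sum_multiples: "(\<Sum>j<d * d. g j) = (\<Sum>i<d. g (d * i))"
    if "\<And>j. \<not> d dvd j \<Longrightarrow> g j = 0" for g :: "nat \<Rightarrow> 'z::comm_monoid_add"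
  proof -
    have "(\<Sum>j<d * d. g j) = (\<Sum>j\<in>(\<lambda>i. d * i) ` {..<d}. g j)"
    proof (rule sum.mono_neutral_right)
      show "\<forall>j\<in>{..<d * d} - (\<lambda>i. d * i) ` {..<d}. g j = 0"
      proof
        fix j assume j: "j \<in> {..<d * d} - (\<lambda>i. d * i) ` {..<d}"
        have "\<not> d dvd j"
        proof
          assume "d dvd j"
          then obtain i where "j = d * i" by blast
          thus False using j d by auto
        qed
        thus "g j = 0" by (rule that)
      qed
    qed (use d in auto)
    also have "\<dots> = (\<Sum>i<d. g (d * i))"
      by (subst sum.reindex) (use d in \<open>auto simp: inj_on_def\<close>)
    finally show ?thesis .
  qed
  \<comment> \<open>This is f^(d-1) N(\<phi>) with f \<phi>^d replaced by c0: congruent to it modulo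
    x^R, but free of \<phi>.\<close>
  define \<rho> where "\<rho> = (\<Sum>i<d. coeff N (d * i) * f ^ (d - 1 - i) * [:c0 ^ i:])"
  have dvd1: "monom 1 R dvd poly N \<phi>"
  proof -
    have "poly (P 1) \<phi> = (\<Sum>b<d. \<phi> ^ b * s b)"
      by (subst poly_altdef_lessThan[of _ d]) (use degP[of 1] d in \<open>auto simp: coeffP mult_ac intro!: sum.cong\<close>)
    moreover have "poly (P 1) \<phi> dvd poly N \<phi>"
      unfolding N_def poly_prod using Z by (intro dvd_prodI) (auto simp: Z_def)
    ultimately show ?thesis using dvd dvd_trans by auto
  qed
  have fN: "f ^ (d - 1) * poly N \<phi> = (\<Sum>i<d. coeff N (d * i) * f ^ (d - 1 - i) * (f * \<phi> ^ d) ^ i)"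
  proof -
    have "poly N \<phi> = (\<Sum>j<d * d. coeff N j * \<phi> ^ j)" by (rule poly_altdef_lessThan[OF degN])
    also have "\<dots> = (\<Sum>i<d. coeff N (d * i) * \<phi> ^ (d * i))"
      by (rule sum_multiples) (simp add: coeffN)
    finally have "f ^ (d - 1) * poly N \<phi> = (\<Sum>i<d. f ^ (d - 1) * (coeff N (d * i) * \<phi> ^ (d * i)))"
      by (simp add: sum_distrib_left)
    also have "\<dots> = (\<Sum>i<d. coeff N (d * i) * f ^ (d - 1 - i) * (f * \<phi> ^ d) ^ i)"
    proof (intro sum.cong refl)
      fix i assume "i \<in> {..<d}"
      hence "f ^ (d - 1) = f ^ (d - 1 - i) * f ^ i" by (simp flip: power_add)
      thus "f ^ (d - 1) * (coeff N (d * i) * \<phi> ^ (d * i)) =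
        coeff N (d * i) * f ^ (d - 1 - i) * (f * \<phi> ^ d) ^ i"
        by (simp add: power_mult_distrib power_mult mult_ac)
    qed
    finally show ?thesis .
  qed
  have dvd2: "monom 1 R dvd (\<Sum>i<d. coeff N (d * i) * f ^ (d - 1 - i) * (f * \<phi> ^ d) ^ i) - \<rho>"
    unfolding \<rho>_def sum_subtractf[symmetric]
  proof (intro dvd_sum)
    fix i
    have "f * \<phi> ^ d - [:c0:] dvd (f * \<phi> ^ d) ^ i - [:c0:] ^ i"
      by (cases "i = 0") (auto simp: power_diff_sumr2)
    hence "monom 1 R dvd (f * \<phi> ^ d) ^ i - [:c0 ^ i:]"
      unfolding poly_const_pow by (rule dvd_trans[OF cong])
    thus "monom 1 R dvd coeff N (d * i) * f ^ (d - 1 - i) * (f * \<phi> ^ d) ^ i -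
           coeff N (d * i) * f ^ (d - 1 - i) * [:c0 ^ i:]"
      unfolding right_diff_distrib[symmetric] by (rule dvd_mult)
  qed
  have dvd\<rho>: "monom 1 R dvd \<rho>"
    using dvd_diff[OF dvd_mult[OF dvd1, of "f ^ (d - 1)", unfolded fN] dvd2] by simp
  \<comment> \<open>Since \<phi>, whose degree is not controlled here, has disappeared, the degree
    of \<rho> stays below R, and divisibility by x^R forces \<rho> = 0.\<close>
  have "degree \<rho> \<le> d * M + (d - 1) * degree f"
    unfolding \<rho>_def
  proof (rule degree_sum_le)
    fix i assume "i \<in> {..<d}"
    have "degree (coeff N (d * i) * f ^ (d - 1 - i) * [:c0 ^ i:]) \<le> d * M + (d - 1 - i) * degree f + 0"
      by (intro order_trans[OF degree_mult_le] add_mono degcN order_trans[OF degree_power_le])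
        (auto simp: mult.commute)
    also have "\<dots> \<le> d * M + (d - 1) * degree f"
      using mult_le_mono1[of "d - 1 - i" "d - 1" "degree f"] by linarith
    finally show "degree (coeff N (d * i) * f ^ (d - 1 - i) * [:c0 ^ i:]) \<le> d * M + (d - 1) * degree f" .
  qed auto
  hence \<rho>0: "\<rho> = 0"
    using dvd_imp_degree_le[OF dvd\<rho>] R by (auto simp: degree_monom_eq)

  define h where "h = (\<lambda>p::'a poly. to_ac (to_fract p))"
  have h: "h 0 = 0" "h 1 = 1" "h (p + q) = h p + h q" "h (p * q) = h p * h q" "h p = 0 \<longleftrightarrow> p = 0"
    for p q by (auto simp: h_def)
  have h_pow: "h (p ^ n) = h p ^ n" for p n by (induction n) (auto simp: h)
  have h_sum: "h (sum g A) = (\<Sum>x\<in>A. h (g x))" for g and A :: "nat set"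
    by (induction A rule: infinite_finite_induct) (auto simp: h)
  define c where "c = to_fract [:c0:] / to_fract f"
  have "c \<noteq> 0" using c0 f0 by (simp add: c_def)
  \<comment> \<open>As \<rho> = 0, a d-th root \<open>y\<close> of c0 / f in the closure of the
    rational function field is a zero of \<open>N\<close>, hence of some conjugate
    \<open>P z\<close>. That polynomial has degree below d and is nonzero because of
    \<open>s b\<close>, so \<open>kummer_degree\<close> makes a power of f with exponent strictly
    between 0 and d a d-th power up to a constant.\<close>
  obtain y where y: "y ^ d = to_ac c" using nth_root_exists[OF d] by blast
  have y': "y ^ d = h [:c0:] / h f" by (simp add: y c_def h_def)
  have "poly (map_poly h N) y = (\<Sum>j<d * d. h (coeff N j) * y ^ j)"
    by (rule poly_map_poly_altdef) (use h degN in auto)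
  also have "\<dots> = (\<Sum>i<d. h (coeff N (d * i)) * y ^ (d * i))"
    by (rule sum_multiples) (simp add: coeffN h)
  finally have "h f ^ (d - 1) * poly (map_poly h N) y =
      (\<Sum>i<d. h f ^ (d - 1) * (h (coeff N (d * i)) * y ^ (d * i)))"
    by (simp add: sum_distrib_left)
  also have "\<dots> = (\<Sum>i<d. h (coeff N (d * i) * f ^ (d - 1 - i) * [:c0 ^ i:]))"
  proof (intro sum.cong refl)
    fix i assume "i \<in> {..<d}"
    hence 1: "h f ^ (d - 1) = h f ^ (d - 1 - i) * h f ^ i" by (simp flip: power_add)
    have 2: "y ^ (d * i) = h [:c0:] ^ i / h f ^ i" by (simp add: power_mult y' power_divide)
    have 3: "h [:c0 ^ i:] = h [:c0:] ^ i" using h_pow[of "[:c0:]" i] by (simp add: poly_const_pow)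
    show "h f ^ (d - 1) * (h (coeff N (d * i)) * y ^ (d * i)) =
        h (coeff N (d * i) * f ^ (d - 1 - i) * [:c0 ^ i:])"
      unfolding 1 2 3 h(4) h_pow using f0 by (simp add: h(5))
  qed
  also have "\<dots> = h \<rho>" by (simp add: \<rho>_def h_sum)
  finally have "poly (map_poly h N) y = 0" using \<rho>0 f0 by (simp add: h)
  hence "(\<Prod>z\<in>Z. poly (map_poly h (P z)) y) = 0"
    by (simp add: N_def map_poly_prod_hom h poly_prod)
  then obtain z where z: "z \<in> Z" "poly (map_poly h (P z)) y = 0" using Z by auto
  define A where "A = map_poly to_fract (P z)"
  have mA: "map_poly to_ac A = map_poly h (P z)"
    by (simp add: A_def map_poly_map_poly h_def o_def)
  have "z \<noteq> 0" using z(1) d by (auto simp: Z_def power_0_left)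
  hence "coeff A b \<noteq> 0" using sb b by (simp add: A_def coeff_map_poly coeffP)
  moreover have "degree A < d"
    using degP[of z] d order_le_less_trans[OF map_poly_degree_leq[of to_fract "P z"]]
    by (fastforce simp: A_def)
  ultimately obtain \<delta> u where u: "0 < \<delta>" "\<delta> < d" "u ^ d = ((-1) ^ d * c) ^ \<delta>"
    using kummer_degree[OF y d, of A] z(2) mA by (metis coeff_0)
  obtain u1 u2 where u12: "u = Fract u1 u2" "u2 \<noteq> 0" by (rule Fract_cases)
  have "u \<noteq> 0" using u \<open>c \<noteq> 0\<close> d by (auto simp: power_0_left)
  hence u1: "u1 \<noteq> 0" using u12 by (auto simp: fract_collapse)
  have uf: "u = to_fract u1 / to_fract u2" using u12 by (simp add: Fract_conv_to_fract)
  have tf_pow: "to_fract (p ^ n) = to_fract p ^ n" for p :: "'a poly" and n by (induction n) auto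
  have "to_fract (u1 ^ d * f ^ \<delta>) = u ^ d * to_fract u2 ^ d * to_fract f ^ \<delta>"
    using u12(2) by (simp add: uf tf_pow power_divide)
  also have "u ^ d = (-1) ^ (d * \<delta>) * (to_fract [:c0:] ^ \<delta> / to_fract f ^ \<delta>)"
    by (simp add: u(3) c_def power_mult_distrib power_mult power_divide)
  also have "\<dots> * to_fract u2 ^ d * to_fract f ^ \<delta> = (-1) ^ (d * \<delta>) * to_fract [:c0:] ^ \<delta> * to_fract u2 ^ d"
    using f0 by simp
  also have "\<dots> = to_fract ([:(-1) ^ (d * \<delta>) * c0 ^ \<delta>:] * u2 ^ d)"
  proof -
    have "[:(-1) ^ (d * \<delta>) * c0 ^ \<delta>:] = [:-1:] ^ (d * \<delta>) * [:c0:] ^ \<delta>"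
      by (simp add: poly_const_pow)
    moreover have "to_fract [:- 1::'a:] = -1" by (metis minus_pCons minus_zero pCons_one to_fract_1 to_fract_uminus)
    ultimately show ?thesis by (simp add: tf_pow)
  qed
  finally have "u1 ^ d * f ^ \<delta> = smult ((-1) ^ (d * \<delta>) * c0 ^ \<delta>) (u2 ^ d)"
    by (simp only: to_fract_eq_iff) simp
  thus False using irr[OF u(1,2) u1 u12(2)] c0 by simp
qed

section \<open>Separable polynomials and the fixed fields of Frobenius powers\<close>

lemma card_roots_separable:
  fixes p :: "'a::alg_closed_field poly"
  assumes "p \<noteq> 0" "\<And>x. poly p x = 0 \<Longrightarrow> poly (pderiv p) x \<noteq> 0"
  shows "card {x. poly p x = 0} = degree p"
proof -
  obtain M where M: "size M = degree p" "p = smult (lead_coeff p) (\<Prod>x\<in>#M. [:-x, 1:])"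
    using alg_closed_imp_factorization[OF assms(1)] by blast
  have root: "poly p x = 0 \<longleftrightarrow> x \<in># M" for x
    by (subst M) (use assms(1) in \<open>auto simp: poly_prod_mset prod_mset_zero_iff\<close>)
  have "count M x \<le> 1" for x
  proof (rule ccontr)
    assume "\<not> count M x \<le> 1"
    hence "x \<in># M" "x \<in># M - {#x#}" by (auto simp: in_diff_count simp flip: count_greater_zero_iff)
    then obtain M' where M': "M = add_mset x (add_mset x M')"
      by (metis insert_DiffM)
    define r where "r = (\<Prod>x\<in>#M'. [:-x, 1:])"
    define l where "l = [:-x, 1:]"
    have "p = smult (lead_coeff p) (l * (l * r))"
      by (subst M(2)) (simp only: M' r_def l_def image_mset_add_mset prod_mset.add_mset)
    hence "pderiv p = smult (lead_coeff p) (pderiv (l * (l * r)))"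
      by (metis pderiv_smult)
    moreover have "poly l x = 0" by (simp add: l_def)
    ultimately have "poly (pderiv p) x = 0" by (simp add: pderiv_mult)
    moreover have "poly p x = 0" using root \<open>x \<in># M\<close> by blast
    ultimately show False using assms(2) by blast
  qed
  hence "M = mset_set (set_mset M)"
  proof (intro multiset_eqI)
    fix x assume le: "\<And>x. count M x \<le> 1"
    show "count M x = count (mset_set (set_mset M)) x"
      using le[of x] by (cases "x \<in># M") (auto simp: count_eq_zero_iff le_Suc_eq)
  qed
  hence "card (set_mset M) = size M" by (metis size_mset_set)
  thus ?thesis using root M(1) by (simp add: Collect_mem_eq)
qed

text \<open>For n > 1 a power of the characteristic of an algebraically closed field, this is the
  subfield with n elements.\<close>

definition fixed_by :: "nat \<Rightarrow> 'a::field set" where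
  "fixed_by n = {x. x ^ n = x}"

locale frobenius_power =
  fixes ty :: "'a::alg_closed_field itself" and q :: nat
  assumes prime_char: "prime CHAR('a)" and q_char: "\<exists>r>0. q = CHAR('a) ^ r"
begin

lemma q_pow: "\<exists>r. q ^ n = CHAR('a) ^ r"
  using q_char by (metis power_mult)

lemma q_gt_1: "q > 1"
  using q_char prime_char prime_gt_1_nat one_less_power by metis

lemma frob_add: "(x + y :: 'a) ^ q ^ n = x ^ q ^ n + y ^ q ^ n"
  using q_pow[of n] freshmans_dream'[OF prime_char] by metis

lemma frob_sum: "(sum g A :: 'a) ^ q ^ n = (\<Sum>x\<in>A. g x ^ q ^ n)"
  using q_pow[of n] freshmans_dream_sum'[OF prime_char] by metis

lemma frob_minus: "(- x :: 'a) ^ q ^ n = - (x ^ q ^ n)"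
proof -
  have "(- x) ^ q ^ n + x ^ q ^ n = 0"
    using frob_add[of "-x" x n] q_gt_1 by (simp add: power_0_left)
  thus ?thesis by (simp add: eq_neg_iff_add_eq_0)
qed

lemma frob_diff: "(x - y :: 'a) ^ q ^ n = x ^ q ^ n - y ^ q ^ n"
  using frob_add[of x "-y"] by (simp add: frob_minus)

lemma frob_poly_diff: "(f - g :: 'a poly) ^ q ^ n = f ^ q ^ n - g ^ q ^ n"
proof -
  have add: "(f + g) ^ q ^ n = f ^ q ^ n + g ^ q ^ n" for f g :: "'a poly"
    using q_pow[of n] freshmans_dream'[where ?'a = "'a poly"] prime_char by (metis semiring_char_poly)
  have "(f - g) ^ q ^ n + g ^ q ^ n = f ^ q ^ n" using add[of "f - g" g] by simp
  thus ?thesis by (simp add: eq_diff_eq)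
qed

lemma frob_inj: "(x :: 'a) ^ q ^ n = y ^ q ^ n \<Longrightarrow> x = y"
  using frob_diff[of x y n] by simp

lemma fixed_by_closed:
  assumes "x \<in> fixed_by (q ^ n)" "y \<in> fixed_by (q ^ n)"
  shows "(x + y :: 'a) \<in> fixed_by (q ^ n)" "x - y \<in> fixed_by (q ^ n)" "x * y \<in> fixed_by (q ^ n)"
    "x / y \<in> fixed_by (q ^ n)" "- x \<in> fixed_by (q ^ n)" "x ^ k \<in> fixed_by (q ^ n)"
  using assms q_gt_1
  by (auto simp: fixed_by_def frob_add frob_diff frob_minus power_mult_distrib power_divide
      simp flip: power_mult) (metis mult.commute power_mult)

lemma fixed_by_01: "(0::'a) \<in> fixed_by (q ^ n)" "(1::'a) \<in> fixed_by (q ^ n)"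
  using q_gt_1 by (auto simp: fixed_by_def)

lemma fixed_by_sum: "(\<And>i. i \<in> I \<Longrightarrow> g i \<in> fixed_by (q ^ n)) \<Longrightarrow> (sum g I :: 'a) \<in> fixed_by (q ^ n)"
  by (simp add: fixed_by_def frob_sum)

lemma fixed_by_mono: "x \<in> fixed_by q \<Longrightarrow> x \<in> fixed_by (q ^ n)"
  by (induction n) (auto simp: fixed_by_def power_mult)

lemma of_nat_q: "of_nat q = (0::'a)"
  using q_char by (metis dvd_power of_nat_eq_0_iff_char_dvd)

text \<open>The polynomial X^(q^n) - X has derivative -1, so its q^n roots are distinct.\<close>

lemma card_fixed_by:
  assumes "n > 0"
  shows "card (fixed_by (q ^ n) :: 'a set) = q ^ n"
proof -
  define p where "p = monom 1 (q ^ n) - monom (1::'a) 1"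
  have gt: "q ^ n > 1" using assms q_gt_1 one_less_power by blast
  have deg: "degree p = q ^ n"
    unfolding p_def diff_conv_add_uminus using gt
    by (subst degree_add_eq_left) (auto simp: degree_monom_eq)
  have "(of_nat (q ^ n) :: 'a) = 0" using assms of_nat_q by (simp add: of_nat_power power_0_left)
  hence "pderiv p = - 1"
    by (simp add: p_def pderiv_diff pderiv_monom)
  moreover have "p \<noteq> 0" using deg gt by (metis degree_0 not_one_less_zero)
  ultimately have "card {x. poly p x = 0} = q ^ n"
    using card_roots_separable[of p] deg by simp
  thus ?thesis by (simp add: p_def poly_monom fixed_by_def)
qed

lemma finite_fixed_by: "n > 0 \<Longrightarrow> finite (fixed_by (q ^ n) :: 'a set)"
  using card_fixed_by[of n] q_gt_1 by (metis card.infinite not_one_less_zero zero_less_power one_less_power less_irrefl)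

text \<open>Since q vanishes in the field and d divides q - 1, d is nonzero there, so X^d - 1 shares
  no root with its derivative.\<close>

lemma card_roots_of_unity:
  assumes "d dvd q - 1" "d > 0"
  shows "card {x::'a. x ^ d = 1} = d"
proof -
  define p where "p = monom 1 d - (1::'a poly)"
  have deg: "degree p = d"
    unfolding p_def diff_conv_add_uminus using assms
    by (subst degree_add_eq_left) (auto simp: degree_monom_eq)
  obtain m where m: "q - 1 = d * m" using assms by blast
  have nz: "of_nat d \<noteq> (0::'a)"
  proof
    assume "of_nat d = (0::'a)"
    hence "of_nat (q - 1) = (0::'a)" by (simp only: m of_nat_mult) simp
    hence "of_nat q = (1::'a)" using q_gt_1 by (simp add: of_nat_diff)
    thus False using of_nat_q by simp
  qed
  have "poly (pderiv p) x \<noteq> 0" if "poly p x = 0" for x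
  proof -
    have "x ^ d = 1" using that by (simp add: p_def poly_monom)
    hence "x \<noteq> 0" using assms by (auto simp: power_0_left)
    thus ?thesis using nz by (simp add: p_def pderiv_diff pderiv_monom poly_monom)
  qed
  moreover have "p \<noteq> 0" using deg assms by auto
  ultimately have "card {x. poly p x = 0} = d"
    using card_roots_separable[of p] deg by simp
  thus ?thesis by (simp add: p_def poly_monom)
qed

lemma root_of_unity_fixed:
  assumes "d dvd q - 1" "(x::'a) ^ d = 1"
  shows "x \<in> fixed_by q"
proof -
  obtain m where m: "q - 1 = d * m" using assms by blast
  have "x ^ q = x ^ (q - 1) * x" using q_gt_1 by (metis power_minus_mult less_trans zero_less_one)
  also have "x ^ (q - 1) = 1" by (simp only: m power_mult assms(2)) simp
  finally have "x ^ q = x" by simp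
  thus ?thesis by (simp add: fixed_by_def)
qed

end

text \<open>By the pigeonhole principle two of the arguments with values in \<open>F\<close> have the same image.\<close>
lemma finite_linear_kernel:
  fixes T :: "('u \<Rightarrow> 'a::field) \<Rightarrow> 'a poly"
  assumes F: "finite F" "2 \<le> card F" "\<And>x y. x \<in> F \<Longrightarrow> y \<in> F \<Longrightarrow> x - y \<in> F"
    and U: "finite U" "n < card U"
    and T: "\<And>s t. T (\<lambda>i. s i - t i) = T s - T t"
    and coeffs: "\<And>s j. s \<in> U \<rightarrow> F \<Longrightarrow> coeff (T s) j \<in> F"
    and deg: "\<And>s j. s \<in> U \<rightarrow> F \<Longrightarrow> j \<ge> n \<Longrightarrow> coeff (T s) j = 0"
  shows "\<exists>s. s \<in> U \<rightarrow> F \<and> (\<exists>i\<in>U. s i \<noteq> 0) \<and> T s = 0"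
proof -
  define S where "S = (U \<rightarrow>\<^sub>E F)"
  have SU: "s \<in> U \<rightarrow> F" if "s \<in> S" for s using that by (auto simp: S_def)
  define r where "r = (\<lambda>s. restrict (coeff (T s)) {..<n})"
  have "r ` S \<subseteq> {..<n} \<rightarrow>\<^sub>E F" using SU coeffs by (auto simp: r_def split: if_splits)
  hence "card (r ` S) \<le> card ({..<n} \<rightarrow>\<^sub>E F)"
    by (intro card_mono finite_PiE) (use F in auto)
  also have "\<dots> = card F ^ n" by (simp add: card_funcsetE)
  also have "\<dots> < card F ^ card U" using U F by (intro power_strict_increasing) auto
  also have "\<dots> = card S" using U by (simp add: S_def card_funcsetE)
  finally have "\<not> inj_on r S" by (rule pigeonhole)
  then obtain s t where st: "s \<in> S" "t \<in> S" "r s = r t" "s \<noteq> t" by (auto simp: inj_on_def)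
  have "coeff (T s) j = coeff (T t) j" for j
    using st deg[OF SU[OF st(1)], of j] deg[OF SU[OF st(2)], of j]
    by (cases "j < n") (auto simp: r_def restrict_def fun_eq_iff split: if_splits)
  hence "T s = T t" by (rule poly_eqI)
  hence "T (\<lambda>i. s i - t i) = 0" using T by simp
  moreover have "(\<lambda>i. s i - t i) \<in> U \<rightarrow> F" using SU[OF st(1)] SU[OF st(2)] F(3) by auto
  moreover have "\<exists>i\<in>U. s i - t i \<noteq> 0"
  proof (rule ccontr)
    assume "\<not> ?thesis"
    hence "\<forall>i\<in>U. s i = t i" by simp
    hence "s = t" using st unfolding S_def by (metis PiE_ext)
    thus False using st by simp
  qed
  ultimately show ?thesis by blast
qed

section \<open>Stepanov's auxiliary polynomial\<close>

context frobenius_power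
begin

text \<open>
  Stepanov's method in Bombieri's form.  With $R = q^k$, $Q = R^2$ and $\varphi = f^{(R-1)/d}$, any
  solution of $\sum x^a s_{ab}(x^R) \varphi^{d-1-b} = 0$ over the field with $q$ elements yields
  $h = \sum w^{-b} x^{aR} \varphi^b s_{ab}$, whose $R$-th power vanishes wherever
  $x^Q = x$ and $f(x)^{(Q-1)/d} = w$.  No derivatives are needed.
\<close>
lemma stepanov_at:
  fixes f :: "'a poly"
  assumes d: "d > 0" "d dvd q - 1"
    and f: "\<And>i. coeff f i \<in> fixed_by q" "poly f 0 \<noteq> 0"
    and irr: "\<And>\<delta> u v c. \<lbrakk>0 < \<delta>; \<delta> < d; u \<noteq> 0; v \<noteq> 0; c \<noteq> 0\<rbrakk> \<Longrightarrow> u ^ d * f ^ \<delta> \<noteq> smult c (v ^ d)"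
    and w: "w ^ d = 1"
    and R: "R = q ^ k" "R = d * m + 1" and e: "e = degree f" and m: "m \<ge> e\<^sup>2 + 4 * e + 3"
  shows "d * card {x. x ^ R\<^sup>2 = x \<and> poly f x ^ ((R\<^sup>2 - 1) div d) = w} \<le> R\<^sup>2 + (d * (2 * e + 3) + 1) * R"
proof -
  \<comment> \<open>Two demands fix the parameters. With M = m - e the degree condition d (M - 1) +
    (d - 1) e < R of \<open>kummer_independence\<close> holds. With A = m + e + 4 the d A M unknowns
    outnumber the n coefficients once m \<ge> e^2 + 4 e + 3, while A stays close to m, so that the
    degree of h, roughly A R, is close to R^2 / d.\<close>
  define A where "A = m + e + 4"
  define M where "M = m - e"
  define U where "U = {..<A} \<times> {..<d} \<times> {..<M}"
  define \<phi> where "\<phi> = f ^ m"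
  define n where "n = A + (M - 1) * R + (d - 1) * (e * m)"
  define S where "S = (\<lambda>(u::nat \<times> nat \<times> nat \<Rightarrow> 'a) a b. \<Sum>j<M. monom (u (a, b, j)) j)"
  define SR where "SR = (\<lambda>(u::nat \<times> nat \<times> nat \<Rightarrow> 'a) a b. \<Sum>j<M. monom (u (a, b, j)) (j * R))"
  define T where "T = (\<lambda>u. \<Sum>a<A. \<Sum>b<d. monom 1 a * SR u a b * \<phi> ^ (d - 1 - b))"
  have eM: "e < m" "M > 0" using m by (auto simp: M_def power2_eq_square)
  have R1: "R > 1" using R(2) d eM by (cases m) auto
  have degphi: "degree \<phi> \<le> e * m"
    unfolding \<phi>_def e using degree_power_le[of f m] by (simp add: mult.commute)
  have coeff_prod_closed: "coeff (g * h) j \<in> fixed_by q"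
    if "\<And>j. coeff g j \<in> fixed_by q" "\<And>j. coeff h j \<in> fixed_by q" for g h :: "'a poly" and j
    unfolding coeff_mult
    by (intro fixed_by_sum[of _ _ 1, simplified] fixed_by_closed(3)[of _ 1, simplified] that)
  have coeff_pow_closed: "coeff (g ^ i) j \<in> fixed_by q"
    if "\<And>j. coeff g j \<in> fixed_by q" for g :: "'a poly" and i j
    using that fixed_by_01[of 1]
    by (induction i arbitrary: j) (auto simp: coeff_pCons coeff_prod_closed split: nat.splits)
  have coeff_sum_closed: "coeff (\<Sum>i\<in>I. g i) j \<in> fixed_by q"
    if "\<And>i j. i \<in> I \<Longrightarrow> coeff (g i) j \<in> fixed_by q" for g :: "nat \<Rightarrow> 'a poly" and I j
    unfolding coeff_sum by (intro fixed_by_sum[of _ _ 1, simplified] that)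
  have coeff_monom_closed: "coeff (monom c i) j \<in> fixed_by q"
    if "c \<in> fixed_by q" for c :: 'a and i j
    using that fixed_by_01[of 1] by (simp add: coeff_monom)
  have "\<exists>u. u \<in> U \<rightarrow> fixed_by q \<and> (\<exists>i\<in>U. u i \<noteq> 0) \<and> T u = 0"
  proof (rule finite_linear_kernel)
    show "finite (fixed_by q :: 'a set)" "2 \<le> card (fixed_by q :: 'a set)"
      using finite_fixed_by[of 1] card_fixed_by[of 1] q_gt_1 by auto
    show "x - y \<in> fixed_by q" if "x \<in> fixed_by q" "y \<in> fixed_by q" for x y :: 'a
      using fixed_by_closed(2)[of x 1 y] that by simp
    show "finite U" by (simp add: U_def)
    show "n < card U"
    proof -
      obtain t where t: "m = e + 1 + t" using eM by (metis Suc_eq_plus1 add.commute add_Suc_right less_iff_Suc_add)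
      obtain d' where d': "d = d' + 1" using d by (metis Suc_eq_plus1 gr0_implies_Suc)
      have "t \<ge> e\<^sup>2 + 3 * e + 2" using m t by simp
      then obtain z where z: "t = e\<^sup>2 + 3 * e + 2 + z" using le_Suc_ex by blast
      have MM: "M = t + 1" by (simp add: M_def t)
      show ?thesis
        unfolding n_def U_def A_def MM R(2) t d' z
        by (simp add: card_cartesian_product algebra_simps power2_eq_square)
    qed
    show "T (\<lambda>i. u i - v i) = T u - T v" for u v
      by (simp add: T_def SR_def diff_monom[symmetric] sum_subtractf algebra_simps)
    show "coeff (T u) j \<in> fixed_by q" if "u \<in> U \<rightarrow> fixed_by q" for u j
      unfolding T_def SR_def \<phi>_def using that f(1) fixed_by_01[of 1]
      by (intro coeff_sum_closed coeff_prod_closed coeff_pow_closed coeff_monom_closed)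
        (auto simp: U_def)
    show "coeff (T u) j = 0" if "u \<in> U \<rightarrow> fixed_by q" "j \<ge> n" for u j
    proof -
      have "degree (T u) < n"
        unfolding T_def
      proof (intro degree_sum_less)
        fix a b assume ab: "a \<in> {..<A}" "b \<in> {..<d}"
        have "degree (SR u a b) \<le> (M - 1) * R"
          unfolding SR_def
          by (intro degree_sum_le order_trans[OF degree_monom_le] mult_le_mono) auto
        moreover have "degree (\<phi> ^ (d - 1 - b)) \<le> (d - 1) * (e * m)"
        proof -
          have "degree (\<phi> ^ (d - 1 - b)) \<le> degree \<phi> * (d - 1 - b)" by (rule degree_power_le)
          also have "\<dots> \<le> (e * m) * (d - 1)" by (intro mult_le_mono degphi) auto
          finally show ?thesis by (simp add: mult_ac)
        qed
        moreover have "degree (monom (1::'a) a) \<le> a" by (rule degree_monom_le)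
        ultimately have "degree (monom 1 a * SR u a b * \<phi> ^ (d - 1 - b)) \<le> a + (M - 1) * R + (d - 1) * (e * m)"
          by (intro order_trans[OF degree_mult_le] add_mono)
        also have "\<dots> < n" using ab by (simp add: n_def)
        finally show "degree (monom 1 a * SR u a b * \<phi> ^ (d - 1 - b)) < n" .
      qed (use eM in \<open>auto simp: n_def A_def\<close>)
      thus ?thesis using that(2) by (intro coeff_eq_0) simp
    qed
  qed
  then obtain u where u: "u \<in> U \<rightarrow> fixed_by q" "\<exists>i\<in>U. u i \<noteq> 0" "T u = 0" by blast
  define s where "s = S u"
  have coeff_s: "coeff (s a b) j = (if j < M then u (a, b, j) else 0)" for a b j
    by (simp add: s_def S_def coeff_sum coeff_monom)
  have deg_s: "degree (s a b) \<le> M - 1" for a b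
    by (rule degree_le) (auto simp: coeff_s)
  define w' where "w' = inverse w"
  have w0: "w \<noteq> 0" "w' \<noteq> 0" using w d by (auto simp: power_0_left w'_def)
  define H where "H = (\<lambda>a. \<Sum>b<d. \<phi> ^ b * smult (w' ^ b) (s a b))"
  define h where "h = (\<Sum>a<A. monom 1 (a * R) * H a)"
  have "h \<noteq> 0"
  proof
    assume h0: "h = 0"
    define P where "P = (\<lambda>a. a < A \<and> (\<exists>b<d. s a b \<noteq> 0))"
    obtain a b j where abj: "a < A" "b < d" "j < M" "u (a, b, j) \<noteq> 0" using u(2) by (auto simp: U_def)
    hence "P a" using coeff_s[of a b j] unfolding P_def by (metis coeff_0)
    \<comment> \<open>Beyond the first nonzero row every term of h carries a further factor x^R. If
      h were 0, then x^R would divide \<open>H a0\<close>, against the independence of the powers of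
      \<phi>.\<close>
    define a0 where "a0 = Least P"
    have a0: "P a0" "\<And>a. a < a0 \<Longrightarrow> \<not> P a"
      unfolding a0_def using LeastI[of P, OF \<open>P a\<close>] not_less_Least by blast+
    have H0: "H a = 0" if "a < a0" for a
    proof -
      have "a < A" using a0(1) that by (simp add: P_def)
      thus ?thesis using a0(2)[OF that] by (auto simp: P_def H_def)
    qed
    have sum0: "0 = (\<Sum>a\<in>{a0<..<A}. monom 1 (a * R) * H a) + monom 1 (a0 * R) * H a0"
    proof -
      have "0 = (\<Sum>a\<in>insert a0 {a0<..<A}. monom 1 (a * R) * H a)"
        unfolding h0[symmetric] h_def
        by (rule sum.mono_neutral_right) (use a0(1) H0 in \<open>auto simp: P_def\<close>, meson linorder_neqE_nat)
      thus ?thesis by (simp add: add.commute)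
    qed
    have dvd_sum: "monom 1 (Suc a0 * R) dvd (\<Sum>a\<in>{a0<..<A}. monom 1 (a * R) * H a)"
    proof (intro dvd_sum dvd_mult2)
      fix a assume "a \<in> {a0<..<A}"
      hence "Suc a0 * R \<le> a * R" by (intro mult_le_mono) auto
      thus "monom 1 (Suc a0 * R) dvd monom (1::'a) (a * R)"
        by (simp add: monom_1_dvd_iff' coeff_monom)
    qed
    have "monom 1 (Suc a0 * R) dvd monom 1 (a0 * R) * H a0"
      using dvd_add_right_iff[OF dvd_sum] sum0 by (metis dvd_0_right)
    hence "monom 1 (a0 * R) * monom 1 R dvd monom 1 (a0 * R) * H a0"
      by (simp add: mult_monom add.commute)
    hence dvdH: "monom 1 R dvd H a0" by (simp add: dvd_times_left_cancel_iff)
    obtain b where b: "b < d" "s a0 b \<noteq> 0" using a0(1) by (auto simp: P_def)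
    have "smult (w' ^ b) (s a0 b) = 0"
    proof (rule kummer_independence[where f = f and \<phi> = \<phi> and d = d and R = R and M = "M - 1"
          and ?c0.0 = "poly f 0 ^ R" and s = "\<lambda>b. smult (w' ^ b) (s a0 b)"])
      show "card {z::'a. z ^ d = 1} = d" by (rule card_roots_of_unity) (use d in auto)
      show "f \<noteq> 0" "poly f 0 ^ R \<noteq> 0" using f by auto
      \<comment> \<open>Here f \<phi>^d = f^(d m + 1) = f^R, and R is a power of q, so f^R - f(0)^R
        = (f - f(0))^R, which x^R divides.\<close>
      show "monom 1 R dvd f * \<phi> ^ d - [:poly f 0 ^ R:]"
      proof -
        have "f * \<phi> ^ d = f ^ R" by (simp add: \<phi>_def R(2) mult.commute flip: power_mult)
        hence "f * \<phi> ^ d - [:poly f 0 ^ R:] = (f - [:poly f 0:]) ^ R"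
          by (simp add: R(1) frob_poly_diff poly_const_pow)
        moreover have "monom 1 1 dvd f - [:poly f 0:]"
          by (simp add: monom_1_dvd_iff' poly_0_coeff_0)
        hence "monom 1 1 ^ R dvd (f - [:poly f 0:]) ^ R" by (rule dvd_power_same)
        ultimately show ?thesis by (simp add: monom_power)
      qed
      show "d * (M - 1) + (d - 1) * degree f < R"
      proof -
        obtain t where t: "m = e + 1 + t" using eM by (metis Suc_eq_plus1 add.commute add_Suc_right less_iff_Suc_add)
        obtain d' where d': "d = d' + 1" using d by (metis Suc_eq_plus1 gr0_implies_Suc)
        show ?thesis unfolding R(2) M_def e[symmetric] t d' by (simp add: algebra_simps)
      qed
    qed (use d irr b(1) dvdH deg_s in \<open>auto simp: H_def intro: order_trans[OF degree_smult_le]\<close>)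
    thus False using b(2) w0 by simp
  qed
  have "{x. x ^ R\<^sup>2 = x \<and> poly f x ^ ((R\<^sup>2 - 1) div d) = w} \<subseteq> {x. poly h x = 0}"
  proof safe
    fix x assume x: "x ^ R\<^sup>2 = x" "w = poly f x ^ ((R\<^sup>2 - 1) div d)"
    define t where "t = poly \<phi> x"
    have "R\<^sup>2 - 1 = d * (m * (R + 1))"
      by (subst R(2), simp add: R(2) power2_eq_square algebra_simps)
    hence "(R\<^sup>2 - 1) div d = m * (R + 1)" using d by simp
    \<comment> \<open>Because the exponent is m (R + 1), the condition on x reads w = t^R t, hence
      t^R / w = 1 / t. Raising to the power R therefore turns w^(-b) \<phi>^b into t^(-b), which is
      why the relation \<open>T\<close> carries the exponents d - 1 - b.\<close>
    hence wt: "w = t ^ R * t" by (simp add: x(2) t_def \<phi>_def power_add mult.commute flip: power_mult)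
    hence t0: "t \<noteq> 0" using w0 by auto
    have w'R: "w' ^ R = w'"
      using w w0 by (simp add: w'_def R(2) power_mult power_inverse)
    have sR: "poly (s a b) x ^ R = poly (SR u a b) x" if "a < A" "b < d" for a b
    proof -
      have "u (a, b, j) ^ R = u (a, b, j)" if "j < M" for j
        using fixed_by_mono[of "u (a, b, j)" k] u(1) that \<open>a < A\<close> \<open>b < d\<close>
        by (auto simp: U_def fixed_by_def R(1))
      thus ?thesis
        by (simp add: s_def S_def SR_def poly_sum poly_monom R(1) frob_sum power_mult_distrib
          flip: power_mult)
    qed
    \<comment> \<open>The coefficients of s_ab are fixed by the power R, so its R-th power at x is
      s_ab(x^R); likewise x^(a R^2) = x^a.\<close>
    have "poly h x ^ R * t ^ (d - 1) = (\<Sum>a<A. \<Sum>b<d. ((x ^ (a * R)) * (t ^ b * (w' ^ b * poly (s a b) x))) ^ R * t ^ (d - 1))"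
      by (simp add: h_def H_def poly_sum poly_monom R(1) frob_sum t_def power_mult_distrib sum_distrib_left
        sum_distrib_right mult_ac)
    also have "\<dots> = (\<Sum>a<A. \<Sum>b<d. x ^ a * poly (SR u a b) x * t ^ (d - 1 - b))"
    proof (intro sum.cong refl)
      fix a b assume ab: "a \<in> {..<A}" "b \<in> {..<d}"
      have "((x ^ (a * R)) * (t ^ b * (w' ^ b * poly (s a b) x))) ^ R * t ^ (d - 1)
          = (x ^ R\<^sup>2) ^ a * ((w' ^ R * t ^ R) ^ b * t ^ (d - 1)) * poly (s a b) x ^ R"
        by (simp add: power_mult_distrib power2_eq_square mult_ac flip: power_mult)
      also have "(w' ^ R * t ^ R) ^ b * t ^ (d - 1) = t ^ (d - 1 - b)"
      proof -
        have "w' ^ R * t ^ R = inverse t" using t0 unfolding w'R unfolding w'_def wt by simp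
        moreover have "t ^ (d - 1) = t ^ (d - 1 - b) * t ^ b" using ab by (simp flip: power_add)
        ultimately show ?thesis using t0 by (simp add: power_inverse)
      qed
      finally show "((x ^ (a * R)) * (t ^ b * (w' ^ b * poly (s a b) x))) ^ R * t ^ (d - 1) =
          x ^ a * poly (SR u a b) x * t ^ (d - 1 - b)"
        using ab sR[of a b] by (simp add: x(1) mult_ac)
    qed
    also have "\<dots> = poly (T u) x" by (simp add: T_def poly_sum poly_monom t_def)
    finally show "poly h x = 0" using t0 u(3) by simp
  qed
  hence "card {x. x ^ R\<^sup>2 = x \<and> poly f x ^ ((R\<^sup>2 - 1) div d) = w} \<le> card {x. poly h x = 0}"
    using \<open>h \<noteq> 0\<close> by (intro card_mono poly_roots_finite)
  also have "\<dots> \<le> degree h" using \<open>h \<noteq> 0\<close> by (rule card_poly_roots_bound)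
  also have "degree h \<le> (A - 1) * R + ((d - 1) * (e * m) + (M - 1))"
    unfolding h_def
  proof (intro degree_sum_le)
    fix a assume "a \<in> {..<A}"
    hence "degree (monom (1::'a) (a * R)) \<le> (A - 1) * R"
      by (intro order_trans[OF degree_monom_le] mult_le_mono) auto
    moreover have "degree (H a) \<le> (d - 1) * (e * m) + (M - 1)"
      unfolding H_def
    proof (intro degree_sum_le order_trans[OF degree_mult_le] add_mono)
      fix b assume "b \<in> {..<d}"
      have "degree (\<phi> ^ b) \<le> degree \<phi> * b" by (rule degree_power_le)
      also have "\<dots> \<le> (e * m) * (d - 1)" using \<open>b \<in> {..<d}\<close> by (intro mult_le_mono degphi) auto
      finally show "degree (\<phi> ^ b) \<le> (d - 1) * (e * m)" by (simp add: mult_ac)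
      show "degree (smult (w' ^ b) (s a b)) \<le> M - 1"
        by (intro order_trans[OF degree_smult_le] deg_s)
    qed auto
    ultimately show "degree (monom 1 (a * R) * H a) \<le> (A - 1) * R + ((d - 1) * (e * m) + (M - 1))"
      by (intro order_trans[OF degree_mult_le] add_mono)
  qed auto
  finally have "d * card {x. x ^ R\<^sup>2 = x \<and> poly f x ^ ((R\<^sup>2 - 1) div d) = w}
      \<le> d * ((A - 1) * R + ((d - 1) * (e * m) + (M - 1)))" by (rule mult_le_mono2)
  also have "\<dots> \<le> R\<^sup>2 + (d * (2 * e + 3) + 1) * R"
  proof -
    have "d * (A - 1) \<le> R + d * (e + 3)" by (simp add: A_def R(2) algebra_simps)
    hence "d * (A - 1) * R \<le> (R + d * (e + 3)) * R" by (rule mult_le_mono1)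
    moreover have dm: "d * m \<le> R" by (simp add: R(2))
    have "d * ((d - 1) * (e * m)) \<le> d * e * R"
    proof -
      have "d * ((d - 1) * (e * m)) = (d - 1) * e * (d * m)" by (simp add: mult_ac)
      also have "\<dots> \<le> d * e * R" using dm by (intro mult_le_mono) auto
      finally show ?thesis .
    qed
    moreover have "d * (M - 1) \<le> R"
    proof -
      have "d * (M - 1) \<le> d * m" by (simp add: M_def)
      thus ?thesis using dm by linarith
    qed
    ultimately show ?thesis by (simp add: algebra_simps power2_eq_square)
  qed
  finally show ?thesis .
qed

end

section \<open>Weil's bound in an algebraic closure\<close>

lemma alg_closed_proots:
  fixes p :: "'a::alg_closed_field poly"
  assumes "p \<noteq> 0"
  shows "size (proots p) = degree p" "p = smult (lead_coeff p) (\<Prod>x\<in>#proots p. [:-x, 1:])"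
proof -
  obtain M where M: "size M = degree p" "p = smult (lead_coeff p) (\<Prod>x\<in>#M. [:-x, 1:])"
    using alg_closed_imp_factorization[OF assms] by blast
  have "proots p = proots (\<Prod>x\<in>#M. [:-x, 1:])"
    by (subst M(2)) (use assms in simp)
  also have "\<dots> = (\<Sum>x\<in>#M. {#x#})"
  proof -
    have "proots [:-x, 1:] = {#x#}" for x :: 'a
      using order_power_n_n[of x 1] by (intro multiset_eqI) (auto intro!: order_0I)
    moreover have "(\<Prod>x\<in>#N. [:-x, 1:]) \<noteq> 0" for N :: "'a multiset"
      by (auto simp: prod_mset_zero_iff)
    ultimately have "proots (\<Prod>x\<in>#N. [:-x, 1:]) = N" for N :: "'a multiset"
    proof (induction N)
      case (add x N)
      have "proots (\<Prod>x\<in>#add_mset x N. [:-x, 1:]) = proots ([:-x, 1:] * (\<Prod>x\<in>#N. [:-x, 1:]))"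
        by simp
      also have "\<dots> = proots [:-x, 1:] + proots (\<Prod>x\<in>#N. [:-x, 1:])"
        by (rule proots_mult) (use add.prems(2)[of "{#x#}"] add.prems(2)[of N] in auto)
      finally show ?case using add by simp
    qed simp
    thus ?thesis by simp
  qed
  also have "\<dots> = M" by simp
  finally show "size (proots p) = degree p" "p = smult (lead_coeff p) (\<Prod>x\<in>#proots p. [:-x, 1:])"
    using M by simp_all
qed

lemma dvd_iff_proots_subset:
  fixes p q :: "'a::alg_closed_field poly"
  assumes "p \<noteq> 0" "q \<noteq> 0"
  shows "p dvd q \<longleftrightarrow> proots p \<subseteq># proots q"
proof
  assume "p dvd q"
  then obtain r where "q = p * r" by blast
  thus "proots p \<subseteq># proots q" using assms by (auto simp: proots_mult)
next
  assume "proots p \<subseteq># proots q"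
  then obtain M where M: "proots q = proots p + M" by (metis subset_mset.add_diff_inverse)
  have "q = smult (lead_coeff q) ((\<Prod>x\<in>#proots p. [:-x, 1:]) * (\<Prod>x\<in>#M. [:-x, 1:]))"
    by (subst alg_closed_proots(2)[OF assms(2)]) (simp add: M)
  moreover have "p dvd smult (lead_coeff q) ((\<Prod>x\<in>#proots p. [:-x, 1:]) * (\<Prod>x\<in>#M. [:-x, 1:]))"
    by (subst alg_closed_proots(2)[OF assms(1)])
      (use assms in \<open>simp add: smult_dvd_iff dvd_smult\<close>)
  ultimately show "p dvd q" by simp
qed

lemma card_mod_eq:
  fixes \<delta> e l :: nat
  assumes "l < \<delta>"
  shows "card {i. i < \<delta> * e \<and> i mod \<delta> = l} = e"
proof -
  have "{i. i < \<delta> * e \<and> i mod \<delta> = l} = (\<lambda>t. \<delta> * t + l) ` {..<e}"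
  proof safe
    fix i assume i: "i < \<delta> * e" "l = i mod \<delta>"
    hence "i div \<delta> < e" by (simp add: less_mult_imp_div_less mult.commute)
    thus "i \<in> (\<lambda>t. \<delta> * t + i mod \<delta>) ` {..<e}"
      by (intro image_eqI[of _ _ "i div \<delta>"]) auto
  next
    fix t assume "t < e"
    hence "\<delta> * t + \<delta> \<le> \<delta> * e" by (metis Suc_leI mult_Suc_right add.commute mult_le_mono2)
    thus "\<delta> * t + l < \<delta> * e" using assms by linarith
  qed (use assms in auto)
  thus ?thesis using assms by (simp add: card_image inj_on_def)
qed

section \<open>Monic polynomials over the field with q elements and Frobenius orbits of their
  roots\<close>

context frobenius_power
begin

definition Mon :: "nat \<Rightarrow> 'a poly set" where
  "Mon k = {g. degree g = k \<and> lead_coeff g = 1 \<and> (\<forall>i. coeff g i \<in> fixed_by q)}"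

text \<open>For \<alpha> fixed by the power q^j this is its characteristic polynomial over the field
  with q elements: the minimal polynomial raised to j / \<delta>, where \<delta> is the degree of
  \<alpha>.\<close>

definition conj_prod :: "nat \<Rightarrow> 'a \<Rightarrow> 'a poly" where
  "conj_prod j \<alpha> = (\<Prod>i<j. [:-(\<alpha> ^ q ^ i), 1:])"

abbreviation frob :: "'a poly \<Rightarrow> 'a poly" where
  "frob \<equiv> map_poly (\<lambda>x. x ^ q)"

lemma frob1: "(x + y :: 'a) ^ q = x ^ q + y ^ q" "(- x :: 'a) ^ q = - (x ^ q)"
  using frob_add[of x y 1] frob_minus[of x 1] by simp_all

lemma q_pos: "q > 0" "(0::'a) ^ q = 0"
  using q_gt_1 by (auto simp: power_0_left)

lemma frob_mult: "frob (f * g) = frob f * frob g"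
  by (rule map_poly_mult_hom) (auto simp: frob1 q_pos power_mult_distrib)

lemma frob_prod: "frob (prod f A) = (\<Prod>i\<in>A. frob (f i))"
  by (rule map_poly_prod_hom) (auto simp: frob1 q_pos power_mult_distrib)

lemma frob_fixed_iff: "frob f = f \<longleftrightarrow> (\<forall>i. coeff f i \<in> fixed_by q)"
  by (auto simp: poly_eq_iff coeff_map_poly q_pos fixed_by_def)

lemma poly_frob: "poly (frob f) (x ^ q) = poly f x ^ q"
  by (induction f) (auto simp: map_poly_pCons q_pos frob1 power_mult_distrib)

lemma finite_Mon: "finite (Mon k)"
proof -
  have "Mon k \<subseteq> Poly ` {xs. set xs \<subseteq> fixed_by q \<and> length xs \<le> k + 1}"
  proof
    fix g assume g: "g \<in> Mon k"
    have "set (coeffs g) \<subseteq> fixed_by q" "length (coeffs g) \<le> k + 1"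
      using g by (auto simp: Mon_def coeffs_def)
    thus "g \<in> Poly ` {xs. set xs \<subseteq> fixed_by q \<and> length xs \<le> k + 1}"
      by (intro image_eqI[of _ _ "coeffs g"]) auto
  qed
  moreover have "finite {xs. set xs \<subseteq> (fixed_by q :: 'a set) \<and> length xs \<le> k + 1}"
    using finite_fixed_by[of 1] by (intro finite_lists_length_le) auto
  ultimately show ?thesis by (meson finite_imageI finite_subset)
qed

lemma Mon_nonzero: "g \<in> Mon k \<Longrightarrow> g \<noteq> 0"
  by (auto simp: Mon_def)

lemma Mon_mult:
  assumes "f \<in> Mon j" "g \<in> Mon k"
  shows "f * g \<in> Mon (j + k)"
proof -
  have "f \<noteq> 0" "g \<noteq> 0" using assms Mon_nonzero by blast+
  hence "degree (f * g) = j + k" using assms by (simp add: degree_mult_eq Mon_def)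
  moreover have "lead_coeff (f * g) = lead_coeff f * lead_coeff g" by (rule lead_coeff_mult)
  moreover have "frob (f * g) = f * g" using assms by (simp add: frob_mult Mon_def flip: frob_fixed_iff)
  ultimately show ?thesis using assms by (auto simp: Mon_def frob_fixed_iff)
qed

lemma Mon_mult_cancel:
  assumes "f \<in> Mon j" "f * g \<in> Mon k"
  shows "g \<in> Mon (k - j)" "j \<le> k"
proof -
  have nz: "f \<noteq> 0" "g \<noteq> 0"
    using Mon_nonzero[OF assms(1)] Mon_nonzero[OF assms(2)] by auto
  have "frob f * frob g = f * g" "frob f = f"
    using assms by (auto simp: Mon_def frob_mult simp flip: frob_fixed_iff)
  hence "frob g = g" using nz by simp
  moreover have "degree (f * g) = degree f + degree g" using nz by (rule degree_mult_eq)
  moreover have "lead_coeff (f * g) = lead_coeff f * lead_coeff g" by (rule lead_coeff_mult)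
  ultimately show "g \<in> Mon (k - j)" "j \<le> k" using assms
    by (auto simp: Mon_def simp flip: frob_fixed_iff)
qed

lemma Mon_0: "Mon 0 = {1}"
proof -
  have "1 \<in> Mon 0" using fixed_by_01[of 1] by (auto simp: Mon_def coeff_pCons split: nat.splits)
  thus ?thesis by (auto simp: Mon_def elim!: degree_eq_zeroE)
qed

lemma Mon_1: "Mon 1 = (\<lambda>x. [:-x, 1:]) ` fixed_by q"
proof (intro equalityI subsetI)
  fix g assume g: "g \<in> Mon 1"
  have "g = [:coeff g 0, coeff g 1:]"
    using g by (intro poly_eqI) (auto simp: coeff_pCons Mon_def coeff_eq_0 split: nat.splits)
  moreover have "coeff g 1 = 1" "- coeff g 0 \<in> fixed_by q"
    using g fixed_by_closed(5)[of "coeff g 0" 1] by (auto simp: Mon_def)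
  ultimately show "g \<in> (\<lambda>x. [:-x, 1:]) ` fixed_by q"
    by (intro image_eqI[of _ _ "- coeff g 0"]) auto
next
  fix g :: "'a poly" assume "g \<in> (\<lambda>x. [:-x, 1:]) ` fixed_by q"
  thus "g \<in> Mon 1"
    using fixed_by_01[of 1] fixed_by_closed(5)[of _ 1]
    by (auto simp: Mon_def coeff_pCons split: nat.splits)
qed

lemma conj_prod_Mon:
  assumes "\<alpha> ^ q ^ j = \<alpha>"
  shows "conj_prod j \<alpha> \<in> Mon j"
proof -
  have "frob (conj_prod j \<alpha>) = (\<Prod>i<j. [:-(\<alpha> ^ q ^ Suc i), 1:])"
    by (simp add: conj_prod_def frob_prod map_poly_pCons q_pos frob1 mult.commute flip: power_mult)
  also have "\<dots> = conj_prod j \<alpha>"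
  proof (cases j)
    case (Suc n)
    have "(\<Prod>i<Suc n. [:-(\<alpha> ^ q ^ Suc i), 1:]) = (\<Prod>i<n. [:-(\<alpha> ^ q ^ Suc i), 1:]) * [:-\<alpha>, 1:]"
      using assms by (simp only: prod.lessThan_Suc Suc)
    also have "\<dots> = (\<Prod>i<Suc n. [:-(\<alpha> ^ q ^ i), 1:])"
      by (subst prod.lessThan_Suc_shift) (simp add: mult.commute)
    finally show ?thesis by (simp only: Suc conj_prod_def)
  qed (simp add: conj_prod_def)
  finally have "frob (conj_prod j \<alpha>) = conj_prod j \<alpha>" .
  moreover have "lead_coeff (conj_prod j \<alpha>) = 1" by (simp add: conj_prod_def lead_coeff_prod)
  moreover have "degree (conj_prod j \<alpha>) = j"
    by (simp add: conj_prod_def degree_prod_sum_eq)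
  ultimately show ?thesis by (simp add: Mon_def frob_fixed_iff)
qed

text \<open>Applying Frobenius to the coefficients fixes g and carries the root \<alpha> to
  \<alpha>^q, so conjugate roots have equal multiplicity.\<close>

lemma order_frob:
  assumes "frob g = g" "g \<noteq> 0"
  shows "order (\<alpha> ^ q) g = order \<alpha> g"
proof -
  define n where "n = order \<alpha> g"
  obtain h where h: "g = [:-\<alpha>, 1:] ^ n * h" "\<not> [:-\<alpha>, 1:] dvd h"
    using order_decomp[OF assms(2), of \<alpha>] by (auto simp: n_def)
  have "frob ([:-\<alpha>, 1:] ^ n) = [:-(\<alpha> ^ q), 1:] ^ n"
    by (induction n) (simp_all add: frob_mult map_poly_pCons q_pos frob1 del: mult_pCons_left)
  hence "g = [:-(\<alpha> ^ q), 1:] ^ n * frob h"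
    using assms(1) h(1) frob_mult by metis
  moreover  have "poly (frob h) (\<alpha> ^ q) \<noteq> 0"
    using h(2) by (simp add: poly_frob poly_eq_0_iff_dvd)
  hence "order (\<alpha> ^ q) (frob h) = 0" by (rule order_0I)
  ultimately show ?thesis unfolding n_def[symmetric]
    using assms(2) by (metis add.right_neutral order_mult order_power_n_n)
qed

text \<open>The product over \<delta> e conjugates runs e times through the orbit of \<alpha>, and g
  contains the whole orbit with one common multiplicity.\<close>

lemma conj_prod_dvd_iff:
  assumes g: "g \<in> Mon k" and \<delta>: "\<delta> > 0" "\<alpha> ^ q ^ \<delta> = \<alpha>"
    and min: "\<And>i. 0 < i \<Longrightarrow> i < \<delta> \<Longrightarrow> \<alpha> ^ q ^ i \<noteq> \<alpha>"
  shows "conj_prod (\<delta> * e) \<alpha> dvd g \<longleftrightarrow> e \<le> order \<alpha> g"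
proof -
  have g': "frob g = g" "g \<noteq> 0" using g by (auto simp: Mon_def frob_fixed_iff)
  have conj_mod: "\<alpha> ^ q ^ i = \<alpha> ^ q ^ (i mod \<delta>)" for i
  proof -
    have "\<alpha> ^ q ^ (\<delta> * t) = \<alpha>" for t
      by (induction t) (auto simp: power_add power_mult \<delta>(2))
    moreover have "q ^ i = q ^ (\<delta> * (i div \<delta>)) * q ^ (i mod \<delta>)" by (simp flip: power_add)
    ultimately show ?thesis by (simp add: power_mult)
  qed
  have conj_less: "i = j" if "\<alpha> ^ q ^ i = \<alpha> ^ q ^ j" "i < \<delta>" "j < \<delta>" "i \<le> j" for i j
  proof (rule ccontr)
    assume "i \<noteq> j"
    have "(\<alpha> ^ q ^ (j - i)) ^ q ^ i = \<alpha> ^ q ^ i"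
      using that by (simp flip: power_mult power_add)
    hence "\<alpha> ^ q ^ (j - i) = \<alpha>" by (rule frob_inj)
    thus False using min[of "j - i"] that \<open>i \<noteq> j\<close> by auto
  qed
  have conj_eq: "\<alpha> ^ q ^ i = \<alpha> ^ q ^ j \<longleftrightarrow> i mod \<delta> = j mod \<delta>" for i j
    using conj_mod[of i] conj_mod[of j] conj_less[of "i mod \<delta>" "j mod \<delta>"]
      conj_less[of "j mod \<delta>" "i mod \<delta>"] \<delta>(1)
    by (metis le_cases mod_less_divisor)
  have ord_conj: "order (\<alpha> ^ q ^ i) g = order \<alpha> g" for i
  proof (induction i)
    case (Suc i)
    have "\<alpha> ^ q ^ Suc i = (\<alpha> ^ q ^ i) ^ q" by (simp add: mult.commute flip: power_mult)
    thus ?case using order_frob[OF g', of "\<alpha> ^ q ^ i"] Suc by simp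
  qed simp
  have nz: "conj_prod n \<alpha> \<noteq> 0" for n by (simp add: conj_prod_def)
  have "proots (conj_prod n \<alpha>) = image_mset (\<lambda>i. \<alpha> ^ q ^ i) (mset_set {..<n})" for n
  proof -
    have "proots [:-x, 1:] = {#x#}" for x :: 'a
      using order_power_n_n[of x 1] by (intro multiset_eqI) (auto intro!: order_0I)
    moreover have "(\<Sum>i<n. {#\<alpha> ^ q ^ i#}) = image_mset (\<lambda>i. \<alpha> ^ q ^ i) (mset_set {..<n})"
      by (induction n) (auto simp: lessThan_Suc)
    ultimately show ?thesis unfolding conj_prod_def by (subst proots_prod) auto
  qed
  hence cnt: "count (proots (conj_prod n \<alpha>)) x = card {i. i < n \<and> \<alpha> ^ q ^ i = x}" for n x
    by (simp add: count_image_mset' Int_def conj_commute flip: card_eq_sum)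
      (metis (no_types, lifting) lessThan_iff)
  have cnt_conj: "count (proots (conj_prod (\<delta> * e) \<alpha>)) (\<alpha> ^ q ^ l) = e" for l
    unfolding cnt conj_eq using card_mod_eq[of "l mod \<delta>" \<delta> e] \<delta>(1) by simp
  have "conj_prod (\<delta> * e) \<alpha> dvd g \<longleftrightarrow> (\<forall>x. count (proots (conj_prod (\<delta> * e) \<alpha>)) x \<le> order x g)"
    using g'(2) by (subst dvd_iff_proots_subset[OF nz]) (auto simp: subseteq_mset_def)
  also have "\<dots> \<longleftrightarrow> e \<le> order \<alpha> g"
  proof
    assume "\<forall>x. count (proots (conj_prod (\<delta> * e) \<alpha>)) x \<le> order x g"
    thus "e \<le> order \<alpha> g" using cnt_conj[of 0] by (metis power_0 power_one_right)
  next
    assume e: "e \<le> order \<alpha> g"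
    show "\<forall>x. count (proots (conj_prod (\<delta> * e) \<alpha>)) x \<le> order x g"
    proof
      fix x
      show "count (proots (conj_prod (\<delta> * e) \<alpha>)) x \<le> order x g"
      proof (cases "\<exists>i. x = \<alpha> ^ q ^ i")
        case True
        then obtain i where "x = \<alpha> ^ q ^ i" by blast
        thus ?thesis using cnt_conj[of i] ord_conj[of i] e by simp
      next
        case False
        hence "count (proots (conj_prod (\<delta> * e) \<alpha>)) x = 0" unfolding cnt by (auto simp: card_eq_0_iff)
        thus ?thesis by simp
      qed
    qed
  qed
  finally show ?thesis .
qed

text \<open>The Frobenius orbit of a root consists of roots, so it is finite, and injectivity of
  Frobenius makes it purely periodic.\<close>

lemma root_period:
  assumes g: "g \<in> Mon k" "poly g \<alpha> = 0"
  obtains \<delta> where "\<delta> > 0" "\<alpha> ^ q ^ \<delta> = \<alpha>" "\<And>i. 0 < i \<Longrightarrow> i < \<delta> \<Longrightarrow> \<alpha> ^ q ^ i \<noteq> \<alpha>"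
    "\<And>j. \<alpha> ^ q ^ j = \<alpha> \<longleftrightarrow> \<delta> dvd j"
proof -
  have g': "frob g = g" "g \<noteq> 0" using g by (auto simp: Mon_def frob_fixed_iff)
  have root: "poly g (\<alpha> ^ q ^ i) = 0" for i
  proof (induction i)
    case (Suc i)
    have "\<alpha> ^ q ^ Suc i = (\<alpha> ^ q ^ i) ^ q" by (simp add: mult.commute flip: power_mult)
    thus ?case using poly_frob[of g "\<alpha> ^ q ^ i"] g' Suc q_pos by simp
  qed (use g in simp)
  hence "finite (range (\<lambda>i. \<alpha> ^ q ^ i))"
    by (intro finite_subset[OF _ poly_roots_finite[OF g'(2)]]) auto
  hence "\<not> inj (\<lambda>i. \<alpha> ^ q ^ i)" using finite_imageD infinite_UNIV_nat by blast
  then obtain i j where ij: "i < j" "\<alpha> ^ q ^ i = \<alpha> ^ q ^ j"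
    unfolding inj_def by (metis linorder_neqE_nat)
  have "(\<alpha> ^ q ^ (j - i)) ^ q ^ i = \<alpha> ^ q ^ i"
    using ij by (simp flip: power_mult power_add)
  hence ex: "\<alpha> ^ q ^ (j - i) = \<alpha>" by (rule frob_inj)
  define P where "P = (\<lambda>n. 0 < n \<and> \<alpha> ^ q ^ n = \<alpha>)"
  define \<delta> where "\<delta> = Least P"
  have "P (j - i)" using ij ex by (simp add: P_def)
  hence \<delta>: "P \<delta>" unfolding \<delta>_def by (rule LeastI)
  have min: "\<alpha> ^ q ^ i \<noteq> \<alpha>" if "0 < i" "i < \<delta>" for i
    using not_less_Least[of i P] that unfolding \<delta>_def by (auto simp: P_def)
  have mult: "\<alpha> ^ q ^ (\<delta> * t) = \<alpha>" for t
    using \<delta> by (induction t) (auto simp: P_def power_add power_mult)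
  have "\<alpha> ^ q ^ j = \<alpha> \<longleftrightarrow> \<delta> dvd j" for j
  proof
    assume "\<alpha> ^ q ^ j = \<alpha>"
    moreover have eq: "q ^ j = q ^ (\<delta> * (j div \<delta>)) * q ^ (j mod \<delta>)" by (simp flip: power_add)
    have "\<alpha> ^ q ^ j = (\<alpha> ^ q ^ (\<delta> * (j div \<delta>))) ^ q ^ (j mod \<delta>)"
      by (subst eq) (rule power_mult)
    ultimately have "\<alpha> ^ q ^ (j mod \<delta>) = \<alpha>" by (simp add: mult)
    hence "j mod \<delta> = 0" using min[of "j mod \<delta>"] \<delta> by (auto simp: P_def)
    thus "\<delta> dvd j" by auto
  qed (use mult in auto)
  thus ?thesis using that[of \<delta>] \<delta> min by (auto simp: P_def)
qed

text \<open>This count takes the place of an Euler product. A root of period \<delta> and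
  multiplicity e contributes exactly the pairs with j = \<delta>, 2 \<delta>, ..., e \<delta>, and
  the multiplicities of all roots add up to k.\<close>

lemma card_conj_prod_dvd:
  assumes g: "g \<in> Mon k"
  shows "card {(j, \<alpha>). j \<in> {1..k} \<and> \<alpha> \<in> fixed_by (q ^ j) \<and> conj_prod j \<alpha> dvd g} = k"
proof -
  have g0: "g \<noteq> 0" using g Mon_nonzero by blast
  define J where "J = (\<lambda>\<alpha>. {j\<in>{1..k}. \<alpha> \<in> fixed_by (q ^ j) \<and> conj_prod j \<alpha> dvd g})"
  have J: "card (J \<alpha>) = order \<alpha> g" if root: "poly g \<alpha> = 0" for \<alpha>
  proof -
    obtain \<delta> where \<delta>: "\<delta> > 0" "\<alpha> ^ q ^ \<delta> = \<alpha>" "\<And>i. 0 < i \<Longrightarrow> i < \<delta> \<Longrightarrow> \<alpha> ^ q ^ i \<noteq> \<alpha>"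
      "\<And>j. \<alpha> ^ q ^ j = \<alpha> \<longleftrightarrow> \<delta> dvd j"
      using root_period[OF g root] by blast
    have "J \<alpha> = (\<lambda>e. \<delta> * e) ` {1..order \<alpha> g}"
    proof (intro equalityI subsetI)
      fix j assume j: "j \<in> J \<alpha>"
      hence "\<delta> dvd j" using \<delta>(4) by (auto simp: J_def fixed_by_def)
      then obtain e where e: "j = \<delta> * e" by blast
      hence "e \<le> order \<alpha> g" using j conj_prod_dvd_iff[OF g \<delta>(1,2,3), of e] by (auto simp: J_def)
      thus "j \<in> (\<lambda>e. \<delta> * e) ` {1..order \<alpha> g}"
        using e j by (intro image_eqI[of _ _ e]) (auto simp: J_def intro!: Suc_leI gr0I)
    next
      fix j assume "j \<in> (\<lambda>e. \<delta> * e) ` {1..order \<alpha> g}"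
      then obtain e where e: "j = \<delta> * e" "1 \<le> e" "e \<le> order \<alpha> g"
        by (elim imageE) (auto simp: atLeastAtMost_iff)
      have fx: "\<alpha> ^ q ^ j = \<alpha>" using \<delta>(4) e(1) by simp
      have dvd: "conj_prod j \<alpha> dvd g" using conj_prod_dvd_iff[OF g \<delta>(1,2,3), of e] e by simp
      hence "degree (conj_prod j \<alpha>) \<le> degree g" using g0 by (rule dvd_imp_degree_le)
      hence "j \<le> k" using conj_prod_Mon[OF fx] g by (simp add: Mon_def)
      thus "j \<in> J \<alpha>" using fx dvd e \<delta>(1) by (auto simp: J_def fixed_by_def Suc_le_eq)
    qed
    thus ?thesis using \<delta>(1) by (simp add: card_image inj_on_def)
  qed
  have dvd_root: "poly g \<alpha> = 0" if "j \<ge> 1" "conj_prod j \<alpha> dvd g" for j \<alpha>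
  proof -
    have "[:-(\<alpha> ^ q ^ 0), 1:] dvd conj_prod j \<alpha>"
      unfolding conj_prod_def using that by (intro dvd_prodI) auto
    thus ?thesis using that(2) dvd_trans by (auto simp: poly_eq_0_iff_dvd)
  qed
  have "{(j, \<alpha>). j \<in> {1..k} \<and> \<alpha> \<in> fixed_by (q ^ j) \<and> conj_prod j \<alpha> dvd g} =
      (\<lambda>(\<alpha>, j). (j, \<alpha>)) ` (SIGMA \<alpha>:{\<alpha>. poly g \<alpha> = 0}. J \<alpha>)"
    using dvd_root by (auto simp: J_def image_iff)
  also have "card \<dots> = card (SIGMA \<alpha>:{\<alpha>. poly g \<alpha> = 0}. J \<alpha>)"
    by (rule card_image) (auto simp: inj_on_def)
  also have "\<dots> = (\<Sum>\<alpha> | poly g \<alpha> = 0. card (J \<alpha>))"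
    by (rule card_SigmaI) (use poly_roots_finite[OF g0] in \<open>auto simp: J_def\<close>)
  also have "\<dots> = (\<Sum>\<alpha> | poly g \<alpha> = 0. order \<alpha> g)" by (intro sum.cong) (auto simp: J)
  also have "\<dots> = size (proots g)"
    by (subst size_multiset_overloaded_eq) (use g0 in simp)
  also have "\<dots> = k" using alg_closed_proots(1)[OF g0] g by (simp add: Mon_def)
  finally show ?thesis .
qed

end

section \<open>The L-function of a product of multiplicative characters\<close>

lemma order_power:
  fixes p :: "'a::idom poly"
  assumes "p \<noteq> 0"
  shows "order a (p ^ n) = n * order a p"
  using assms by (induction n) (auto simp: order_mult)

text \<open>The character \<psi> lives on the d-th roots of unity of the closure, so that it serves
  all extensions at once: over the field with q^j elements it is composed with the power (q^j - 1) /
  d. The last assumption says that no exponent below d makes all the characters trivial together; it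
  yields the irreducibility used in Stepanov's method.\<close>

locale char_sum = frobenius_power ty q for ty :: "'a::alg_closed_field itself" and q +
  fixes d :: nat and \<psi> :: "'a \<Rightarrow> complex" and B :: "'a set" and e :: "'a \<Rightarrow> nat"
  assumes d: "d > 1" "d dvd q - 1"
    and psi_0: "\<psi> 0 = 0" and psi_mult: "\<And>x y. x ^ d = 1 \<Longrightarrow> y ^ d = 1 \<Longrightarrow> \<psi> (x * y) = \<psi> x * \<psi> y"
    and psi_norm: "\<And>x. x ^ d = 1 \<Longrightarrow> norm (\<psi> x) = 1"
    and psi_inj: "\<And>x. x ^ d = 1 \<Longrightarrow> \<psi> x = 1 \<Longrightarrow> x = 1"
    and B: "B \<subseteq> fixed_by q" "0 \<notin> B"
    and e: "\<And>\<delta>. 0 < \<delta> \<Longrightarrow> \<delta> < d \<Longrightarrow> \<exists>b\<in>B. \<not> d dvd \<delta> * e b"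
begin

definition \<chi> :: "'a \<Rightarrow> complex" where "\<chi> z = \<psi> (z ^ ((q - 1) div d))"

text \<open>Completely multiplicative on monic polynomials, as evaluation at each b is. Its values
  on linear polynomials give the character sum to be bounded.\<close>

definition X_val :: "'a poly \<Rightarrow> complex" where "X_val g = (\<Prod>b\<in>B. \<chi> (poly g b) ^ e b)"

definition L_coeff :: "nat \<Rightarrow> complex" where "L_coeff k = (\<Sum>g\<in>Mon k. X_val g)"

text \<open>This is the character sum over the extension of degree j, since the value at b of the
  characteristic polynomial of \<alpha> is the norm of b - \<alpha>.\<close>

definition S_sum :: "nat \<Rightarrow> complex" where
  "S_sum j = (\<Sum>\<alpha>\<in>fixed_by (q ^ j). X_val (conj_prod j \<alpha>))"

lemma finite_B: "finite B"
  using finite_fixed_by[of 1] B by (auto intro: finite_subset)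

lemma d_exp: "d * ((q - 1) div d) = q - 1" "(q - 1) div d > 0"
  using d q_gt_1 by (auto simp: div_greater_zero_iff dvd_imp_le)

lemma fixed_pow: "(z::'a) \<in> fixed_by q \<Longrightarrow> z \<noteq> 0 \<Longrightarrow> z ^ (q - 1) = 1"
proof -
  assume z: "z \<in> fixed_by q" "z \<noteq> 0"
  have "z ^ (q - 1) * z = z" using z q_pos by (simp add: fixed_by_def flip: power_Suc2)
  thus ?thesis using z by simp
qed

lemma mu_pow: "(z::'a) \<in> fixed_by q \<Longrightarrow> z \<noteq> 0 \<Longrightarrow> (z ^ ((q - 1) div d)) ^ d = 1"
  using fixed_pow[of z] d_exp by (simp add: mult.commute flip: power_mult)

lemma psi_1: "\<psi> 1 = 1"
  using psi_mult[of 1 1] psi_norm[of 1] by auto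

lemma chi_0: "\<chi> 0 = 0" and chi_1: "\<chi> 1 = 1"
  using d_exp by (auto simp: \<chi>_def psi_0 psi_1 power_0_left)

lemma chi_mult:
  assumes "x \<in> fixed_by q" "y \<in> fixed_by q"
  shows "\<chi> (x * y) = \<chi> x * \<chi> y"
proof (cases "x = 0 \<or> y = 0")
  case False
  thus ?thesis using assms mu_pow by (simp add: \<chi>_def power_mult_distrib psi_mult)
qed (auto simp: chi_0)

text \<open>A solution of z^((q-1)/d) = x found in the closure already lies in the field with q
  elements, because z^(q-1) = x^d = 1.\<close>

lemma psi_surj:
  assumes "x ^ d = 1"
  obtains z where "z \<in> fixed_by q" "z \<noteq> 0" "\<chi> z = \<psi> x"
proof -
  obtain z where z: "z ^ ((q - 1) div d) = x" using nth_root_exists[OF d_exp(2)] by blast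
  have x0: "x \<noteq> 0" using assms d by (auto simp: power_0_left)
  hence "z \<noteq> 0" using z d_exp by (auto simp: power_0_left)
  have "z ^ (q - 1) = (z ^ ((q - 1) div d)) ^ d" using d_exp(1) by (metis mult.commute power_mult)
  hence "z ^ (q - 1) = 1" using z assms by simp
  hence "z \<in> fixed_by q"
    using power_minus_mult[of q z] q_pos by (simp add: fixed_by_def)
  thus ?thesis using that \<open>z \<noteq> 0\<close> z by (simp add: \<chi>_def)
qed

lemma psi_pow: "x ^ d = 1 \<Longrightarrow> \<psi> (x ^ n) = \<psi> x ^ n"
  by (induction n) (auto simp: psi_1 psi_mult mult.commute[of _ d] power_mult[symmetric] simp flip: power_mult,
    metis mult.commute power_mult power_one psi_mult)

text \<open>Otherwise injectivity of \<psi> gives x^r = 1 with r = n mod d for all d-th roots of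
  unity x, which is too many roots for a degree r < d.\<close>

lemma exists_nontrivial:
  assumes "\<not> d dvd n"
  shows "\<exists>x. x ^ d = 1 \<and> \<psi> x ^ n \<noteq> 1"
proof (rule ccontr)
  assume "\<not> ?thesis"
  hence triv: "\<And>x. x ^ d = 1 \<Longrightarrow> \<psi> x ^ n = 1" by blast
  define r where "r = n mod d"
  have r: "0 < r" "r < d" using assms d by (auto simp: r_def dvd_eq_mod_eq_0)
  have "x ^ r = 1" if x: "x ^ d = 1" for x :: 'a
  proof -
    have "(x ^ n) ^ d = 1" using x by (metis mult.commute power_mult power_one)
    hence "x ^ n = 1" using triv[OF x] psi_pow[OF x, of n] psi_inj by simp
    moreover have "x ^ n = (x ^ d) ^ (n div d) * x ^ r"
      by (simp add: r_def flip: power_mult power_add)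
    ultimately show ?thesis using x by simp
  qed
  hence "{x::'a. x ^ d = 1} \<subseteq> {x. poly (monom 1 r - 1) x = 0}" by (auto simp: poly_monom)
  moreover have nz: "monom 1 r - (1::'a poly) \<noteq> 0"
    using r by (metis degree_0 degree_1 degree_monom_eq eq_iff_diff_eq_0 less_irrefl one_neq_zero)
  moreover have "degree (monom 1 r - (1::'a poly)) \<le> r"
    by (intro degree_diff_le) (auto simp: degree_monom_le)
  ultimately have "card {x::'a. x ^ d = 1} \<le> r"
    using card_poly_roots_bound[OF nz] card_mono[OF poly_roots_finite[OF nz]] by (meson order_trans)
  thus False using card_roots_of_unity[of d] d r by simp
qed

lemma poly_fixed:
  fixes g :: "'a poly"
  assumes "\<And>i. coeff g i \<in> fixed_by q" "b \<in> fixed_by q"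
  shows "poly g b \<in> fixed_by q"
  using assms poly_frob[of g b] frob_fixed_iff[of g] by (simp add: fixed_by_def)

lemma X_mult: "g \<in> Mon j \<Longrightarrow> h \<in> Mon k \<Longrightarrow> X_val (g * h) = X_val g * X_val h"
  unfolding X_val_def prod.distrib[symmetric]
  by (intro prod.cong refl) (use B in \<open>auto simp: chi_mult power_mult_distrib poly_fixed Mon_def\<close>)

lemma L_0: "L_coeff 0 = 1"
  by (simp add: L_coeff_def Mon_0 X_val_def chi_1)

lemma L_1: "L_coeff 1 = (\<Sum>x\<in>fixed_by q. \<Prod>b\<in>B. \<chi> (b - x) ^ e b)"
  unfolding L_coeff_def Mon_1
  by (subst sum.reindex) (auto simp: inj_on_def X_val_def)

text \<open>Multiplying the value of a polynomial at one point by a constant permutes the monic polynomials.\<close>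
lemma L_eq_0:
  assumes k: "k \<ge> card B"
  shows "L_coeff k = 0"
proof -
  obtain b0 where b0: "b0 \<in> B" "\<not> d dvd e b0" using e[of 1] d by auto
  obtain x where x: "x ^ d = 1" "\<psi> x ^ e b0 \<noteq> 1" using exists_nontrivial[OF b0(2)] by blast
  obtain z where z: "z \<in> fixed_by q" "z \<noteq> 0" "\<chi> z = \<psi> x" using psi_surj[OF x(1)] by blast
  \<comment> \<open>The Lagrange polynomial that is 1 at \<open>b0\<close> and 0 on the rest of
    \<open>B\<close>. Its degree is at most card B - 1 < k, so adding multiples of it keeps a
    polynomial monic of degree k.\<close>
  define P where "P = (\<Prod>b\<in>B - {b0}. smult (1 / (b0 - b)) [:-b, 1:])"
  have P1: "poly P b0 = 1" unfolding P_def poly_prod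
    by (intro prod.neutral) (auto simp flip: diff_divide_distrib)
  have P0: "poly P b = 0" if "b \<in> B" "b \<noteq> b0" for b
    unfolding P_def poly_prod using that finite_B by auto
  have Pf: "frob P = P"
    unfolding P_def frob_prod
  proof (intro prod.cong refl)
    fix b assume "b \<in> B - {b0}"
    define c where "c = 1 / (b0 - b)"
    have b: "b \<in> fixed_by q" "b0 \<in> fixed_by q" using B b0 \<open>b \<in> B - {b0}\<close> by auto
    moreover have "c \<in> fixed_by q"
      unfolding c_def using fixed_by_01[of 1] fixed_by_closed(4)[of 1 1 "b0 - b"] fixed_by_closed(2)[of b0 1 b] b
      by simp
    ultimately have "c \<in> fixed_by q" "b \<in> fixed_by q" by simp_all
    hence "c ^ q = c" "b ^ q = b" by (auto simp: fixed_by_def)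
    thus "frob (smult (1 / (b0 - b)) [:-b, 1:]) = smult (1 / (b0 - b)) [:-b, 1:]"
      unfolding c_def[symmetric] by (simp add: map_poly_pCons q_pos frob1 power_mult_distrib)
  qed
  have degP: "degree P < k"
  proof -
    have "degree P \<le> sum (degree \<circ> (\<lambda>b. smult (1 / (b0 - b)) [:-b, 1:])) (B - {b0})"
      unfolding P_def by (rule degree_prod_sum_le) (simp add: finite_B)
    also have "\<dots> \<le> (\<Sum>b\<in>B - {b0}. 1)"
      unfolding o_def by (intro sum_mono order_trans[OF degree_smult_le]) simp
    also have "\<dots> = card (B - {b0})" by simp
    also have "\<dots> < card B" using b0 finite_B by (intro card_Diff1_less)
    finally show ?thesis using k by simp
  qed
  \<comment> \<open>\<open>t c\<close> multiplies the value at \<open>b0\<close> by c and keeps the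
    other values on \<open>B\<close>. These maps compose like their parameters, so
    \<open>t (inverse z)\<close> undoes \<open>t z\<close>.\<close>
  define t where "t = (\<lambda>c (g::'a poly). g + smult ((c - 1) * poly g b0) P)"
  have t_Mon: "t c g \<in> Mon k" if c: "c \<in> fixed_by q" and g: "g \<in> Mon k" for c g
  proof -
    define a where "a = (c - 1) * poly g b0"
    have "poly g b0 \<in> fixed_by q" using g b0 B by (intro poly_fixed) (auto simp: Mon_def)
    hence a: "a \<in> fixed_by q"
      unfolding a_def using fixed_by_closed(2,3)[of _ 1, simplified] fixed_by_01[of 1] c by simp
    have deg: "degree (smult a P) < k" using degP by (meson degree_smult_le le_less_trans)
    hence "degree (t c g) = k" using g unfolding t_def a_def[symmetric]
      by (subst degree_add_eq_left) (auto simp: Mon_def)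
    moreover have "coeff (t c g) k = 1" using g deg unfolding t_def a_def[symmetric]
      by (auto simp: Mon_def coeff_eq_0 simp del: coeff_smult)
    moreover have "coeff (t c g) i \<in> fixed_by q" for i
    proof -
      have "coeff P i \<in> fixed_by q" "coeff g i \<in> fixed_by q" using Pf g by (auto simp: Mon_def frob_fixed_iff)
      thus ?thesis unfolding t_def a_def[symmetric] coeff_add coeff_smult
        using fixed_by_closed(1,3)[of _ 1, simplified] a by simp
    qed
    ultimately show ?thesis by (simp add: Mon_def)
  qed
  have tb0: "poly (t c g) b0 = c * poly g b0" for c g by (simp add: t_def P1 algebra_simps)
  have tb: "poly (t c g) b = poly g b" if "b \<in> B" "b \<noteq> b0" for c g b using that by (simp add: t_def P0)
  have t_eq: "t c g = g + smult ((c - 1) * poly g b0) P" for c g by (simp add: t_def)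
  have tt: "t c (t c' g) = t (c * c') g" for c c' g
  proof -
    have "t c (t c' g) = g + (smult ((c' - 1) * poly g b0) P + smult ((c - 1) * (c' * poly g b0)) P)"
      by (simp only: t_eq[of c] tb0) (simp only: t_eq add.assoc)
    also have "\<dots> = t (c * c') g"
      unfolding t_eq smult_add_left[symmetric] by (simp add: algebra_simps)
    finally show ?thesis .
  qed
  have t1: "t 1 g = g" for g by (simp add: t_def)
  have X_t: "X_val (t z g) = \<psi> x ^ e b0 * X_val g" if g: "g \<in> Mon k" for g
  proof -
    have "poly g b0 \<in> fixed_by q" using g b0 B by (intro poly_fixed) (auto simp: Mon_def)
    hence "\<chi> (poly (t z g) b0) = \<psi> x * \<chi> (poly g b0)"
      using z by (simp add: tb0 chi_mult)
    thus ?thesis unfolding X_val_def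
      by (subst (1 2) prod.remove[OF finite_B b0(1)]) (simp add: tb power_mult_distrib)
  qed
  have zi: "inverse z \<in> fixed_by q"
    using z fixed_by_closed(4)[of 1 1 z] fixed_by_01[of 1] by (simp add: inverse_eq_divide)
  have "L_coeff k = (\<Sum>g\<in>Mon k. X_val (t z g))"
    unfolding L_coeff_def
    by (rule sum.reindex_bij_witness[of _ "t z" "t (inverse z)"])
      (use t_Mon z zi in \<open>auto simp: tt t1\<close>)
  also have "\<dots> = \<psi> x ^ e b0 * L_coeff k"
    by (simp add: X_t L_coeff_def sum_distrib_left)
  finally have "(\<psi> x ^ e b0 - 1) * L_coeff k = 0" by (simp add: algebra_simps)
  thus ?thesis using x(2) by simp
qed

text \<open>Both sides sum \<open>X_val g\<close> over the triples (g, j, \<alpha>) for which the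
  characteristic polynomial of \<alpha> divides g. Splitting off that polynomial leaves a free
  cofactor of degree k - j; for a fixed g there are exactly k pairs (j, \<alpha>).\<close>

lemma newton:
  "of_nat k * L_coeff k = (\<Sum>j=1..k. S_sum j * L_coeff (k - j))"
proof -
  define D where "D = (\<lambda>g. {(j, \<alpha>). j \<in> {1..k} \<and> \<alpha> \<in> fixed_by (q ^ j) \<and> conj_prod j \<alpha> dvd g})"
  define PA where "PA = (SIGMA j:{1..k}. (fixed_by (q ^ j) :: 'a set))"
  have finPA: "finite PA" unfolding PA_def using finite_fixed_by by (intro finite_SigmaI) auto
  have "(\<Sum>j=1..k. S_sum j * L_coeff (k - j)) =
      (\<Sum>j=1..k. \<Sum>\<alpha>\<in>fixed_by (q ^ j). X_val (conj_prod j \<alpha>) * L_coeff (k - j))"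
    by (simp add: S_sum_def sum_distrib_right)
  also have "\<dots> = (\<Sum>(j, \<alpha>)\<in>PA. X_val (conj_prod j \<alpha>) * L_coeff (k - j))"
    unfolding PA_def by (rule sum.Sigma) (use finite_fixed_by in auto)
  also have "\<dots> = (\<Sum>(j, \<alpha>)\<in>PA. \<Sum>g | g \<in> Mon k \<and> conj_prod j \<alpha> dvd g. X_val g)"
  proof (intro sum.cong refl, clarify)
    fix j \<alpha> assume "(j, \<alpha>) \<in> PA"
    hence j: "j \<in> {1..k}" "\<alpha> ^ q ^ j = \<alpha>" by (auto simp: PA_def fixed_by_def)
    define c where "c = conj_prod j \<alpha>"
    have c: "c \<in> Mon j" "c \<noteq> 0" using conj_prod_Mon[OF j(2)] Mon_nonzero by (auto simp: c_def)
    have "X_val c * L_coeff (k - j) = (\<Sum>h\<in>Mon (k - j). X_val (c * h))"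
      unfolding L_coeff_def sum_distrib_left by (intro sum.cong refl) (simp add: X_mult[OF c(1)])
    also have "\<dots> = (\<Sum>g | g \<in> Mon k \<and> c dvd g. X_val g)"
      by (rule sum.reindex_bij_witness[of _ "\<lambda>g. g div c" "\<lambda>h. c * h"])
        (use c j Mon_mult[OF c(1)] Mon_mult_cancel(1)[OF c(1)] in \<open>fastforce elim!: dvdE\<close>)+
    finally show "X_val (conj_prod j \<alpha>) * L_coeff (k - j) = (\<Sum>g | g \<in> Mon k \<and> conj_prod j \<alpha> dvd g. X_val g)"
      by (simp add: c_def)
  qed
  also have "\<dots> = (\<Sum>x\<in>PA. \<Sum>g\<in>Mon k. if conj_prod (fst x) (snd x) dvd g then X_val g else 0)"
    by (intro sum.cong refl) (auto simp: sum.If_cases finite_Mon Int_def)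
  also have "\<dots> = (\<Sum>g\<in>Mon k. \<Sum>x\<in>PA. if conj_prod (fst x) (snd x) dvd g then X_val g else 0)"
    by (rule sum.swap)
  also have "\<dots> = (\<Sum>g\<in>Mon k. of_nat k * X_val g)"
  proof (intro sum.cong refl)
    fix g assume g: "g \<in> Mon k"
    have "{x \<in> PA. conj_prod (fst x) (snd x) dvd g} =
        {(j, \<alpha>). j \<in> {1..k} \<and> \<alpha> \<in> fixed_by (q ^ j) \<and> conj_prod j \<alpha> dvd g}"
      by (auto simp: PA_def)
    thus "(\<Sum>x\<in>PA. if conj_prod (fst x) (snd x) dvd g then X_val g else 0) = of_nat k * X_val g"
      using card_conj_prod_dvd[OF g] finPA by (simp add: sum.If_cases Int_def)
  qed
  finally show ?thesis by (simp add: L_coeff_def sum_distrib_left)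
qed

end

section \<open>From power sums to the size of the reciprocal roots\<close>

text \<open>A polynomial vanishing at all the other values combines the power sums into a multiple
  of v_i^k alone. Equal values only add a positive multiplicity, so nothing cancels, and letting k
  grow excludes a modulus above r.\<close>

lemma power_sum_growth:
  fixes v :: "'i \<Rightarrow> complex" and r C :: real
  assumes I: "finite I" and r: "r \<ge> 0"
    and bound: "\<And>k. k \<ge> k0 \<Longrightarrow> norm (\<Sum>i\<in>I. v i ^ k) \<le> C * r ^ k"
    and i: "i \<in> I"
  shows "norm (v i) \<le> r"
proof (rule ccontr)
  assume gt: "\<not> norm (v i) \<le> r"
  define W where "W = v ` I - {v i}"
  define E where "E = (\<Prod>w\<in>W. [:-w, 1:])"
  define n where "n = card {j\<in>I. v j = v i}"
  have "n > 0" using I i by (auto simp: n_def card_gt_0_iff)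
  have fin: "finite W" using I by (simp add: W_def)
  have Ev: "poly E (v i) \<noteq> 0" using fin by (auto simp: E_def poly_prod W_def)
  have E0: "poly E (v j) = 0" if "j \<in> I" "v j \<noteq> v i" for j
    using fin that by (auto simp: E_def poly_prod W_def)
  have id: "of_nat n * v i ^ k * poly E (v i) = (\<Sum>l\<le>degree E. coeff E l * (\<Sum>j\<in>I. v j ^ (k + l)))" for k
  proof -
    have "(\<Sum>l\<le>degree E. coeff E l * (\<Sum>j\<in>I. v j ^ (k + l))) = (\<Sum>j\<in>I. v j ^ k * poly E (v j))"
      unfolding poly_altdef sum_distrib_left
      by (subst sum.swap) (simp add: power_add mult_ac)
    also have "\<dots> = (\<Sum>j | j \<in> I \<and> v j = v i. v j ^ k * poly E (v j))"
      by (rule sum.mono_neutral_right) (use I E0 in auto)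
    also have "\<dots> = of_nat n * v i ^ k * poly E (v i)" by (simp add: n_def)
    finally show ?thesis by simp
  qed
  define D where "D = (\<Sum>l\<le>degree E. norm (coeff E l) * (C * r ^ l))"
  define c where "c = of_nat n * norm (poly E (v i))"
  have "c > 0" using \<open>n > 0\<close> Ev by (simp add: c_def)
  have main: "c * norm (v i) ^ k \<le> D * r ^ k" if "k \<ge> k0" for k
  proof -
    have "c * norm (v i) ^ k = norm (of_nat n * v i ^ k * poly E (v i))"
      by (simp add: c_def norm_mult norm_power)
    also have "\<dots> \<le> (\<Sum>l\<le>degree E. norm (coeff E l) * (C * r ^ (k + l)))"
      unfolding id by (intro order_trans[OF norm_sum] sum_mono)
        (auto simp: norm_mult intro!: mult_left_mono bound that trans_le_add1)
    also have "\<dots> = D * r ^ k" by (simp add: D_def sum_distrib_left power_add mult_ac)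
    finally show ?thesis .
  qed
  have vpos: "norm (v i) > 0" using gt r by linarith
  define x where "x = r / norm (v i)"
  have x: "0 \<le> x" "x < 1" using gt r vpos by (auto simp: x_def)
  have "(\<lambda>k. D * x ^ k) \<longlonglongrightarrow> D * 0"
    by (intro tendsto_mult tendsto_const LIMSEQ_power_zero) (use x in auto)
  moreover have "\<forall>\<^sub>F k in sequentially. c \<le> D * x ^ k"
    using eventually_ge_at_top[of k0]
  proof eventually_elim
    case (elim k)
    have "c \<le> D * r ^ k / norm (v i) ^ k" using main[OF elim] vpos by (simp add: field_simps)
    thus ?case by (simp add: x_def power_divide)
  qed
  ultimately have "c \<le> D * 0"
    by (rule tendsto_lowerbound) simp
  thus False using \<open>c > 0\<close> by simp
qed

text \<open>The a_k are the coefficients of the product of the factors 1 - w X, whose logarithmic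
  derivative generates the power sums; since a_0 = 1, the recursion determines S. The numbers w are
  the roots of the reversed polynomial, which has degree exactly n, so 0 occurs among them when a_n
  vanishes.\<close>

lemma newton_power_sums:
  fixes a :: "nat \<Rightarrow> complex" and S :: "nat \<Rightarrow> complex"
  assumes a0: "a 0 = 1" and an: "\<And>k. k > n \<Longrightarrow> a k = 0"
    and rec: "\<And>k. of_nat k * a k = (\<Sum>j=1..k. S j * a (k - j))"
  shows "\<exists>ws. length ws = n \<and> (\<forall>k\<ge>1. S k = - (\<Sum>w\<leftarrow>ws. w ^ k))"
proof -
  define p where "p = (\<Sum>k\<le>n. monom (a k) (n - k))"
  have coeff_p: "coeff p i = (if i \<le> n then a (n - i) else 0)" for i
  proof -
    have "coeff p i = (\<Sum>k\<le>n. if k = n - i \<and> i \<le> n then a k else 0)"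
      unfolding p_def coeff_sum coeff_monom by (intro sum.cong) auto
    also have "\<dots> = (if i \<le> n then a (n - i) else 0)"
      by (cases "i \<le> n") (auto simp: sum.delta)
    finally show ?thesis .
  qed
  have deg: "degree p = n"
    by (intro antisym degree_le le_degree) (auto simp: coeff_p a0)
  have "lead_coeff p = 1" by (simp add: deg coeff_p a0)
  moreover have "p \<noteq> 0" using \<open>lead_coeff p = 1\<close> by force
  ultimately obtain M where M: "size M = n" "p = (\<Prod>x\<in>#M. [:-x, 1:])"
    using alg_closed_imp_factorization[of p] deg by auto
  obtain ws where ws: "mset ws = M" using ex_mset by blast
  have pws: "p = (\<Prod>w\<leftarrow>ws. [:-w, 1:])" unfolding M(2) ws[symmetric] by (simp flip: prod_mset_prod_list)
  have len: "length ws = n" using M ws by auto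
  define A where "A = (\<lambda>ws. \<Prod>w\<leftarrow>ws. 1 - fps_const w * fps_X :: complex fps)"
  define P where "P = (\<lambda>ws. Abs_fps (\<lambda>k. if k = 0 then 0 else (\<Sum>w\<leftarrow>ws. w ^ k)) :: complex fps)"
  have refl: "A ws = fps_of_poly (reflect_poly (\<Prod>w\<leftarrow>ws. [:-w, 1:]))" for ws
  proof (induction ws)
    case (Cons w ws)
    have "reflect_poly [:-w, 1:] = [:1, -w:]" by (simp add: reflect_poly_def)
    moreover have "fps_of_poly [:1, -w:] = 1 - fps_const w * fps_X"
      by (simp add: fps_of_poly_pCons fps_const_neg[symmetric] mult.commute del: fps_const_neg)
    ultimately show ?case using Cons
      by (simp add: A_def reflect_poly_mult fps_of_poly_mult del: mult_pCons_left)
  qed (simp add: A_def)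
  have A_nth: "fps_nth (A ws) k = a k" for k
  proof -
    have "fps_nth (A ws) k = coeff (reflect_poly p) k" by (simp add: refl pws)
    also have "\<dots> = a k" using an by (auto simp: coeff_reflect_poly deg coeff_p)
    finally show ?thesis .
  qed
  have deriv: "fps_X * fps_deriv (A ws) = - (A ws * P ws)" for ws
  proof (induction ws)
    case Nil
    show ?case by (simp add: A_def P_def fps_eq_iff fps_zero_def[symmetric])
  next
    case (Cons w ws)
    have P1: "P (w # ws) = P [w] + P ws"
      by (rule fps_ext) (simp add: P_def)
    have "(1 - fps_const w * fps_X) * P [w] = fps_const w * fps_X"
    proof (rule fps_ext)
      fix k
      have "(1 - fps_const w * fps_X) * P [w] = P [w] - fps_const w * (fps_X * P [w])"
        by (simp add: left_diff_distrib mult.assoc)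
      hence "fps_nth ((1 - fps_const w * fps_X) * P [w]) k =
          fps_nth (P [w]) k - w * (if k = 0 then 0 else fps_nth (P [w]) (k - 1))"
        by simp
      also have "\<dots> = w * (if k = 1 then 1 else 0)"
        by (cases k) (auto simp: P_def)
      also have "\<dots> = fps_nth (fps_const w * fps_X) k" by simp
      finally show "fps_nth ((1 - fps_const w * fps_X) * P [w]) k = fps_nth (fps_const w * fps_X) k" .
    qed
    hence P2: "(1 - fps_const w * fps_X) * A ws * P [w] = A ws * (fps_const w * fps_X)"
      by (simp only: mult.commute[of _ "A ws"] mult.assoc)
    have "fps_X * fps_deriv (A (w # ws)) =
        (1 - fps_const w * fps_X) * (fps_X * fps_deriv (A ws)) - A ws * (fps_const w * fps_X)"
      by (simp add: A_def algebra_simps)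
    also have "\<dots> = - (A (w # ws) * P (w # ws))"
      unfolding Cons P1 P2[symmetric] by (simp add: A_def algebra_simps)
    finally show ?case .
  qed
  have newton: "of_nat k * a k = (\<Sum>j=1..k. - (\<Sum>w\<leftarrow>ws. w ^ j) * a (k - j))" for k
  proof -
    have "of_nat k * a k = fps_nth (fps_X * fps_deriv (A ws)) k"
      by (cases k) (auto simp: A_nth)
    also have "\<dots> = - (\<Sum>j=0..k. fps_nth (P ws) j * fps_nth (A ws) (k - j))"
      unfolding deriv by (simp add: fps_mult_nth mult.commute[of "A ws"])
    also have "(\<Sum>j=0..k. fps_nth (P ws) j * fps_nth (A ws) (k - j)) = (\<Sum>j=1..k. (\<Sum>w\<leftarrow>ws. w ^ j) * a (k - j))"
      by (rule sum.mono_neutral_cong_right) (auto simp: P_def A_nth)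
    finally show ?thesis by (simp add: sum_negf)
  qed
  have "S k = - (\<Sum>w\<leftarrow>ws. w ^ k)" if "k \<ge> 1" for k
    using that
  proof (induction k rule: less_induct)
    case (less k)
    have split: "(\<Sum>j=1..k. f j) = (\<Sum>j=1..<k. f j) + f k" for f :: "nat \<Rightarrow> complex"
      using less.prems by (simp add: atLeastLessThanSuc_atLeastAtMost[symmetric])
    have "(\<Sum>j=1..<k. S j * a (k - j)) = (\<Sum>j=1..<k. - (\<Sum>w\<leftarrow>ws. w ^ j) * a (k - j))"
      by (intro sum.cong refl) (use less.IH in auto)
    thus ?case using rec[of k] newton[of k] unfolding split by (simp add: a0)
  qed
  thus ?thesis using len by blast
qed

section \<open>Character sums over even extensions and Weil's bound\<close>

context char_sum
begin

text \<open>The factors are b - X instead of X - b in order to match the arguments b - x of the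
  characters in \<open>L_1\<close>.\<close>

definition f_poly :: "'a poly" where "f_poly = (\<Prod>b\<in>B. [:b, -1:] ^ e b)"

text \<open>At a point b where d does not divide \<delta> e_b, the multiplicities of the two sides
  differ modulo d.\<close>

lemma f_poly_irr:
  assumes "0 < \<delta>" "\<delta> < d" "u \<noteq> 0" "v \<noteq> 0" "c \<noteq> 0"
  shows "u ^ d * f_poly ^ \<delta> \<noteq> smult c (v ^ d)"
proof
  assume eq: "u ^ d * f_poly ^ \<delta> = smult c (v ^ d)"
  obtain b where b: "b \<in> B" "\<not> d dvd \<delta> * e b" using e assms by blast
  define g where "g = (\<Prod>b\<in>B - {b}. [:b, -1:] ^ e b)"
  have fg: "f_poly = [:b, -1:] ^ e b * g"
    unfolding f_poly_def g_def by (rule prod.remove[OF finite_B b(1)])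
  have "poly g b \<noteq> 0" using finite_B by (auto simp: g_def poly_prod)
  hence og: "order b g = 0" and g0: "g \<noteq> 0" by (auto intro: order_0I)
  have "[:b, -1:] = smult (-1) [:-b, 1:]" by simp
  hence "order b [:b, -1:] = 1" using order_power_n_n[of b 1] by (metis neg_equal_0_iff_equal order_smult power_one_right zero_neq_one)
  hence "order b f_poly = e b" using g0
    by (simp add: fg order_mult order_power og del: mult_pCons_left)
  moreover have "f_poly \<noteq> 0" using finite_B by (simp add: f_poly_def)
  ultimately have "d * order b u + \<delta> * e b = d * order b v"
    using arg_cong[OF eq, of "order b"] assms by (simp add: order_mult order_power order_smult)
  hence "d dvd \<delta> * e b" by (metis dvd_add_right_iff dvd_triv_left)
  thus False using b by simp
qed

lemma coeff_f_poly: "coeff f_poly i \<in> fixed_by q"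
proof -
  have pow: "frob (g ^ n) = g ^ n" if "frob g = g" for g :: "'a poly" and n
    using that by (induction n) (auto simp: frob_mult q_pos)
  have "frob f_poly = f_poly"
    unfolding f_poly_def frob_prod
    by (intro prod.cong refl pow) (use B in \<open>auto simp: map_poly_pCons q_pos frob1 fixed_by_def\<close>)
  thus ?thesis using frob_fixed_iff by blast
qed

text \<open>At b the characteristic polynomial of \<alpha> takes the value (b - \<alpha>)^s with s =
  1 + q + ... + q^(j-1), and s (q - 1) / d = (q^j - 1) / d.\<close>

lemma X_conj_prod:
  assumes j: "j > 0" and \<alpha>: "\<alpha> \<in> fixed_by (q ^ j)"
  shows "X_val (conj_prod j \<alpha>) = \<psi> (poly f_poly \<alpha> ^ ((q ^ j - 1) div d))"
proof -
  define s where "s = (\<Sum>i<j. q ^ i)"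
  have geo: "s * (q - 1) = q ^ j - 1"
    using q_gt_1 unfolding s_def by (induction j) (auto simp: algebra_simps diff_mult_distrib2)
  hence ex: "(q ^ j - 1) div d = s * ((q - 1) div d)"
    using d by (metis div_mult_swap)
  have pb: "poly (conj_prod j \<alpha>) b = (b - \<alpha>) ^ s" if "b \<in> B" for b
  proof -
    have "b ^ q ^ i = b" for i using fixed_by_mono[of b i] B that by (auto simp: fixed_by_def)
    hence "(b - \<alpha>) ^ q ^ i = b - \<alpha> ^ q ^ i" for i by (simp add: frob_diff)
    thus ?thesis by (simp add: conj_prod_def poly_prod s_def power_sum)
  qed
  have cF: "poly (conj_prod j \<alpha>) b \<in> fixed_by q" if "b \<in> B" for b
    using conj_prod_Mon[of \<alpha> j] \<alpha> B that by (intro poly_fixed) (auto simp: Mon_def fixed_by_def)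
  have "X_val (conj_prod j \<alpha>) = \<chi> (\<Prod>b\<in>B. poly (conj_prod j \<alpha>) b ^ e b)"
  proof -
    have pw: "x ^ n \<in> fixed_by q \<and> \<chi> (x ^ n) = \<chi> x ^ n" if "x \<in> fixed_by q" for x n
      using that fixed_by_01[of 1] fixed_by_closed(3)[of _ 1]
      by (induction n) (auto simp: chi_1 chi_mult)
    have "(\<Prod>b\<in>A. poly (conj_prod j \<alpha>) b ^ e b) \<in> fixed_by q \<and>
       \<chi> (\<Prod>b\<in>A. poly (conj_prod j \<alpha>) b ^ e b) = (\<Prod>b\<in>A. \<chi> (poly (conj_prod j \<alpha>) b) ^ e b)" if "A \<subseteq> B" for A
      using finite_subset[OF that finite_B] that
    proof (induction A rule: finite_induct)
      case empty
      show ?case using fixed_by_01[of 1] by (simp add: chi_1)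
    next
      case (insert b A)
      thus ?case using pw[OF cF[of b], of "e b"] fixed_by_closed(3)[of _ 1] by (simp add: chi_mult)
    qed
    thus ?thesis unfolding X_val_def by simp
  qed
  also have "(\<Prod>b\<in>B. poly (conj_prod j \<alpha>) b ^ e b) = poly f_poly \<alpha> ^ s"
    by (simp add: f_poly_def poly_prod pb prod_power_distrib mult.commute flip: power_mult)
  finally show ?thesis by (simp only: \<chi>_def ex power_mult)
qed

lemma sum_psi: "(\<Sum>w | w ^ d = 1. \<psi> w) = 0"
proof -
  obtain x where x: "x ^ d = 1" "\<psi> x \<noteq> 1" using exists_nontrivial[of 1] d by auto
  have x0: "x \<noteq> 0" using x d by (auto simp: power_0_left)
  have "(\<Sum>w | w ^ d = 1. \<psi> w) = (\<Sum>w | w ^ d = 1. \<psi> (x * w))"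
    by (rule sum.reindex_bij_witness[of _ "\<lambda>w. x * w" "\<lambda>w. w / x"])
      (use x x0 in \<open>auto simp: power_mult_distrib power_divide\<close>)
  also have "\<dots> = \<psi> x * (\<Sum>w | w ^ d = 1. \<psi> w)"
    by (simp add: sum_distrib_left psi_mult x)
  finally have "(\<psi> x - 1) * (\<Sum>w | w ^ d = 1. \<psi> w) = 0" by (simp add: algebra_simps)
  thus ?thesis using x by simp
qed

text \<open>Stepanov's method bounds each class only from above. The d classes together contain all
  but at most deg f of the R^2 elements, so each class is bounded from below as well; the common
  main term R^2 / d cancels because \<psi> sums to zero.\<close>

lemma S_sum_bound:
  "\<exists>C k0. \<forall>k\<ge>k0. norm (S_sum (2 * k)) \<le> C * real q ^ k"
proof -
  define E where "E = degree f_poly"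
  define C where "C = real (d * (2 * E + 3) + 1)"
  \<comment> \<open>The threshold for k makes m large enough for \<open>stepanov_at\<close>, since k
    < q^k = d m + 1.\<close>
  have "norm (S_sum (2 * k)) \<le> (real d * (C + real E)) * real q ^ k" if k: "k \<ge> d * (E\<^sup>2 + 4 * E + 3) + 1" for k
  proof -
    define R where "R = q ^ k"
    define m where "m = (R - 1) div d"
    define F where "F = (fixed_by (q ^ (2 * k)) :: 'a set)"
    have kpos: "k > 0" using k by simp
    have RQ: "q ^ (2 * k) = R\<^sup>2" by (simp add: R_def mult.commute flip: power_mult)
    have finF: "finite F" and cardF: "card F = R\<^sup>2"
      using finite_fixed_by[of "2 * k"] card_fixed_by[of "2 * k"] kpos by (auto simp: F_def RQ)
    have "k < R" unfolding R_def using q_gt_1 by (intro power_gt_expt) simp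
    have dvdR: "d dvd R - 1"
    proof -
      have "[q = 1] (mod d)" using d(2) q_gt_1 by (simp add: cong_altdef_nat)
      hence "[R = 1 ^ k] (mod d)" unfolding R_def by (rule cong_pow)
      thus ?thesis using \<open>k < R\<close> by (simp add: cong_altdef_nat)
    qed
    hence Rm: "R = d * m + 1" using \<open>k < R\<close> by (simp add: m_def)
    have m: "m \<ge> E\<^sup>2 + 4 * E + 3"
    proof -
      have "d * (E\<^sup>2 + 4 * E + 3) \<le> d * m" using k \<open>k < R\<close> Rm by linarith
      thus ?thesis using d by simp
    qed
    define N where "N = (\<lambda>w. card {x. x ^ R\<^sup>2 = x \<and> poly f_poly x ^ ((R\<^sup>2 - 1) div d) = w})"
    have N_le: "real d * real (N w) \<le> real R ^ 2 + C * real R" if "w ^ d = 1" for w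
    proof -
      have "d * N w \<le> R\<^sup>2 + (d * (2 * E + 3) + 1) * R" unfolding N_def
      proof (rule stepanov_at[where m = m])
        show "poly f_poly 0 \<noteq> 0" using finite_B B by (auto simp: f_poly_def poly_prod)
      qed (use d coeff_f_poly f_poly_irr that R_def Rm E_def m in auto)
      hence "real (d * N w) \<le> real (R\<^sup>2 + (d * (2 * E + 3) + 1) * R)" by (simp only: of_nat_le_iff)
      thus ?thesis by (simp add: C_def algebra_simps)
    qed
    define Z where "Z = {w::'a. w ^ d = 1}"
    have Z: "card Z = d" "finite Z"
      using card_roots_of_unity[of d] d by (auto simp: Z_def card_ge_0_finite)
    define G where "G = {x\<in>F. poly f_poly x \<noteq> 0}"
    have val: "poly f_poly x ^ ((R\<^sup>2 - 1) div d) \<in> Z" if "x \<in> G" for x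
    proof -
      have x: "x ^ R\<^sup>2 = x" "poly f_poly x \<noteq> 0" using that by (auto simp: G_def F_def fixed_by_def RQ)
      have fr: "poly f_poly (x ^ q ^ n) = poly f_poly x ^ q ^ n" for n
      proof (induction n)
        case (Suc n)
        have "x ^ q ^ Suc n = (x ^ q ^ n) ^ q" by (simp add: mult.commute flip: power_mult)
        hence "poly f_poly (x ^ q ^ Suc n) = poly f_poly (x ^ q ^ n) ^ q"
          using poly_frob[of f_poly "x ^ q ^ n"] coeff_f_poly frob_fixed_iff[of f_poly] by simp
        also have "\<dots> = poly f_poly x ^ q ^ Suc n" by (simp add: Suc mult.commute flip: power_mult)
        finally show ?case .
      qed simp
      have "poly f_poly x ^ R\<^sup>2 = poly f_poly x"
        using fr[of "2 * k"] x(1) by (simp add: RQ)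
      hence "poly f_poly x ^ (R\<^sup>2 - 1) * poly f_poly x = poly f_poly x"
        using power_minus_mult[of "R\<^sup>2" "poly f_poly x"] \<open>k < R\<close> by simp
      hence "poly f_poly x ^ (R\<^sup>2 - 1) = 1" using x by simp
      moreover have "d dvd R\<^sup>2 - 1"
      proof -
        have "R\<^sup>2 - 1 = (R - 1) * (R + 1)" using Rm by (simp add: power2_eq_square algebra_simps)
        thus ?thesis using dvdR by simp
      qed
      ultimately show ?thesis by (simp add: Z_def flip: power_mult)
    qed
    have N_eq: "N w = card {x\<in>G. poly f_poly x ^ ((R\<^sup>2 - 1) div d) = w}" if "w \<in> Z" for w
    proof -
      have "w \<noteq> 0" using that d by (auto simp: Z_def power_0_left)
      moreover have "(R\<^sup>2 - 1) div d > 0"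
      proof -
        have "d \<le> R\<^sup>2 - 1" using Rm m by (simp add: power2_eq_square algebra_simps trans_le_add2)
        thus ?thesis using d by (simp add: div_greater_zero_iff)
      qed
      ultimately have "{x. x ^ R\<^sup>2 = x \<and> poly f_poly x ^ ((R\<^sup>2 - 1) div d) = w} =
          {x\<in>G. poly f_poly x ^ ((R\<^sup>2 - 1) div d) = w}"
        by (auto simp: G_def F_def fixed_by_def RQ power_0_left)
      thus ?thesis by (simp add: N_def)
    qed
    have finG: "finite G" using finF by (simp add: G_def)
    have sumN: "(\<Sum>w\<in>Z. N w) = card G"
    proof -
      have "(\<Sum>w\<in>Z. \<Sum>x | x \<in> G \<and> poly f_poly x ^ ((R\<^sup>2 - 1) div d) = w. 1) = (\<Sum>x\<in>G. (1::nat))"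
        by (rule sum.group[OF finG Z(2)]) (use val in auto)
      thus ?thesis by (simp add: N_eq)
    qed
    have cardG: "real (card G) \<ge> real R ^ 2 - real E"
    proof -
      have f0: "f_poly \<noteq> 0" using finite_B by (simp add: f_poly_def)
      have "F \<subseteq> G \<union> {x. poly f_poly x = 0}" by (auto simp: G_def)
      hence "card F \<le> card (G \<union> {x. poly f_poly x = 0})"
        using finG poly_roots_finite[OF f0] by (intro card_mono) auto
      also have "\<dots> \<le> card G + E"
        using card_Un_le[of G "{x. poly f_poly x = 0}"] card_poly_roots_bound[OF f0] by (simp add: E_def)
      finally have "real (R\<^sup>2) \<le> real (card G + E)" unfolding cardF by (simp only: of_nat_le_iff)
      thus ?thesis by simp
    qed
    have dev: "\<bar>real (N w) - real R ^ 2 / real d\<bar> \<le> (C + real E) * real R" if w: "w \<in> Z" for w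
    proof -
      have R1: "real R \<ge> 1" using \<open>k < R\<close> by simp
      have C0: "C \<ge> 0" by (simp add: C_def)
      have dp: "real d \<ge> 1" using d by simp
      have each: "real (N w') \<le> real R ^ 2 / real d + C * real R" if "w' \<in> Z" for w'
      proof -
        have "real (N w') \<le> (real R ^ 2 + C * real R) / real d"
          using N_le[of w'] that dp by (simp add: Z_def field_simps)
        also have "\<dots> \<le> real R ^ 2 / real d + C * real R"
        proof -
          have "C * real R * 1 \<le> C * real R * real d" using C0 dp by (intro mult_left_mono) auto
          hence "C * real R / real d \<le> C * real R" using dp by (simp add: pos_divide_le_eq)
          thus ?thesis by (simp add: add_divide_distrib)
        qed
        finally show ?thesis .
      qed
      have sumN': "(\<Sum>w\<in>Z. real (N w)) = real (card G)" by (simp flip: sumN)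
      have "real (card G) = real (N w) + (\<Sum>w'\<in>Z - {w}. real (N w'))"
        unfolding sumN'[symmetric] by (rule sum.remove[OF Z(2) w])
      also have "(\<Sum>w'\<in>Z - {w}. real (N w')) \<le> (\<Sum>w'\<in>Z - {w}. (real R ^ 2 + C * real R) / real d)"
        by (intro sum_mono) (use N_le dp in \<open>auto simp: Z_def field_simps\<close>)
      also have "\<dots> = (real d - 1) * ((real R ^ 2 + C * real R) / real d)"
        using Z w dp by (simp add: of_nat_diff)
      also have "\<dots> = real R ^ 2 + C * real R - (real R ^ 2 + C * real R) / real d"
        using dp by (simp add: field_simps)
      finally have "real (N w) \<ge> (real R ^ 2 + C * real R) / real d - C * real R - real E"
        using cardG by linarith
      moreover have "(real R ^ 2 + C * real R) / real d \<ge> real R ^ 2 / real d"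
        using C0 dp by (intro divide_right_mono) auto
      moreover have "real E \<le> real E * real R" using R1 mult_left_mono[of 1 "real R" "real E"] by simp
      moreover have "(C + real E) * real R = C * real R + real E * real R" by (simp add: algebra_simps)
      moreover have "real E * real R \<ge> 0" by simp
      ultimately show ?thesis using each[OF w] by linarith
    qed
    have "S_sum (2 * k) = (\<Sum>x\<in>F. \<psi> (poly f_poly x ^ ((R\<^sup>2 - 1) div d)))"
      unfolding S_sum_def F_def by (intro sum.cong refl) (use kpos X_conj_prod[of "2 * k"] in \<open>simp add: RQ\<close>)
    also have "\<dots> = (\<Sum>x\<in>G. \<psi> (poly f_poly x ^ ((R\<^sup>2 - 1) div d)))"
    proof (rule sum.mono_neutral_right)
      have "(R\<^sup>2 - 1) div d > 0"
      proof -
        have "d \<le> R\<^sup>2 - 1" using Rm m by (simp add: power2_eq_square algebra_simps trans_le_add2)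
        thus ?thesis using d by (simp add: div_greater_zero_iff)
      qed
      thus "\<forall>i\<in>F - G. \<psi> (poly f_poly i ^ ((R\<^sup>2 - 1) div d)) = 0"
        by (auto simp: G_def power_0_left psi_0)
    qed (use finF in \<open>auto simp: G_def\<close>)
    also have "\<dots> = (\<Sum>w\<in>Z. \<Sum>x | x \<in> G \<and> poly f_poly x ^ ((R\<^sup>2 - 1) div d) = w. \<psi> (poly f_poly x ^ ((R\<^sup>2 - 1) div d)))"
      by (rule sum.group[symmetric, OF finG Z(2)]) (use val in auto)
    also have "\<dots> = (\<Sum>w\<in>Z. of_nat (N w) * \<psi> w)"
      by (intro sum.cong refl) (simp add: N_eq)
    also have "\<dots> = (\<Sum>w\<in>Z. of_nat (N w) * \<psi> w) - of_real (real R ^ 2 / real d) * (\<Sum>w\<in>Z. \<psi> w)"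
      using sum_psi by (simp add: Z_def)
    also have "\<dots> = (\<Sum>w\<in>Z. (of_nat (N w) - of_real (real R ^ 2 / real d)) * \<psi> w)"
      by (simp only: left_diff_distrib sum_subtractf sum_distrib_left)
    finally have "norm (S_sum (2 * k)) \<le> (\<Sum>w\<in>Z. norm ((of_nat (N w) - of_real (real R ^ 2 / real d)) * \<psi> w))"
      using norm_sum by metis
    also have "\<dots> \<le> (\<Sum>w\<in>Z. (C + real E) * real R)"
    proof (intro sum_mono)
      fix w assume w: "w \<in> Z"
      have "norm ((of_nat (N w) - of_real (real R ^ 2 / real d)) * \<psi> w) = norm (complex_of_real (real (N w) - real R ^ 2 / real d))"
        using psi_norm[of w] w by (simp add: norm_mult Z_def)
      also have "\<dots> = \<bar>real (N w) - real R ^ 2 / real d\<bar>" by (rule norm_of_real)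
      finally show "norm ((of_nat (N w) - of_real (real R ^ 2 / real d)) * \<psi> w) \<le> (C + real E) * real R"
        using dev[OF w] by simp
    qed
    also have "\<dots> = (real d * (C + real E)) * real q ^ k" using Z by (simp add: R_def)
    finally show ?thesis .
  qed
  thus ?thesis by blast
qed

theorem weil_bound:
  "norm (\<Sum>x\<in>fixed_by q. \<Prod>b\<in>B. \<chi> (b - x) ^ e b) \<le> (real (card B) - 1) * sqrt (real q)"
proof -
  obtain b0 where "b0 \<in> B" using e[of 1] d by auto
  hence cB: "card B \<ge> 1" using finite_B by (metis One_nat_def Suc_leI card_gt_0_iff empty_iff)
  have "\<exists>ws. length ws = card B - 1 \<and> (\<forall>k\<ge>1. S_sum k = - (\<Sum>w\<leftarrow>ws. w ^ k))"
    by (rule newton_power_sums[of L_coeff]) (use L_0 L_eq_0 newton in auto)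
  then obtain ws where ws: "length ws = card B - 1" "\<And>k. k \<ge> 1 \<Longrightarrow> S_sum k = - (\<Sum>w\<leftarrow>ws. w ^ k)"
    by blast
  obtain C k0 where C: "\<And>k. k \<ge> k0 \<Longrightarrow> norm (S_sum (2 * k)) \<le> C * real q ^ k"
    using S_sum_bound by blast
  have sum_list: "(\<Sum>w\<leftarrow>ws. g w) = (\<Sum>i<length ws. g (ws ! i))" for g :: "complex \<Rightarrow> 'z::comm_monoid_add"
    by (simp add: sum_list_sum_nth atLeast0LessThan)
  \<comment> \<open>Only even extensions are controlled, so the growth argument is applied to the
    squares of the reciprocal roots, whose k-th power sums are -S_(2k).\<close>
  have "norm ((ws ! i)\<^sup>2) \<le> real q" if "i < length ws" for i
  proof (rule power_sum_growth[where I = "{..<length ws}" and v = "\<lambda>i. (ws ! i)\<^sup>2" and ?k0.0 = "max k0 1" and C = C])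
    fix k assume k: "k \<ge> max k0 1"
    hence "(\<Sum>i<length ws. ((ws ! i)\<^sup>2) ^ k) = - S_sum (2 * k)"
      using ws(2)[of "2 * k"] by (simp add: sum_list power_mult)
    thus "norm (\<Sum>i<length ws. ((ws ! i)\<^sup>2) ^ k) \<le> C * real q ^ k" using C[of k] k by simp
  qed (use that in auto)
  hence le: "norm (ws ! i) \<le> sqrt (real q)" if "i < length ws" for i
    using that by (simp add: norm_power real_le_rsqrt)
  have "L_coeff 1 = - (\<Sum>i<length ws. ws ! i)"
    using newton[of 1] ws(2)[of 1] L_0 sum_list[of "\<lambda>w. w"] by simp
  hence "norm (L_coeff 1) \<le> (\<Sum>i<length ws. sqrt (real q))"
    by (simp only: norm_minus_cancel) (intro order_trans[OF norm_sum] sum_mono, use le in auto)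
  also have "\<dots> = (real (card B) - 1) * sqrt (real q)" using ws(1) cB by (simp add: of_nat_diff)
  finally show ?thesis by (simp only: L_1)
qed

end

section \<open>Characters of finite fields\<close>

text \<open>Cyclicity of the multiplicative group is transferred from the record-based algebra,
  applied to the ring structure of the type.\<close>

lemma finite_field_generator:
  "\<exists>g::'k::{field,finite}. g \<noteq> 0 \<and> (\<forall>x. x \<noteq> 0 \<longrightarrow> (\<exists>i. x = g ^ i))"
proof -
  define R where "R = (ring_of_type_algebra :: 'k ring)"
  interpret R: field R unfolding R_def by (rule field_from_type_algebra)
  have carr: "carrier R = UNIV" and mult: "x \<otimes>\<^bsub>R\<^esub> y = x * y" and one: "\<one>\<^bsub>R\<^esub> = 1" and zero: "\<zero>\<^bsub>R\<^esub> = 0" for x y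
    by (auto simp: R_def ring_of_type_algebra_def)
  have pow: "a [^]\<^bsub>R\<^esub> i = a ^ i" for a and i :: nat
    by (induction i) (auto simp: one mult mult.commute)
  obtain a where a: "a \<in> carrier (Multiplicative_Group.mult_of R)"
      "carrier (Multiplicative_Group.mult_of R) = {a [^]\<^bsub>R\<^esub> i |i. i \<in> (UNIV :: nat set)}"
    using R.finite_field_mult_group_has_gen by (auto simp: carr)
  have "a \<noteq> 0" using a(1) by (simp add: carr zero)
  moreover have "\<exists>i. x = a ^ i" if "x \<noteq> 0" for x
  proof -
    have "x \<in> carrier (Multiplicative_Group.mult_of R)" using that by (simp add: carr zero)
    thus ?thesis unfolding a(2) pow by auto
  qed
  ultimately show ?thesis by blast
qed

text \<open>An additive subgroup of maximal prime power order is everything.\<close>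
lemma card_finite_field_prime_power:
  "\<exists>r>0. CARD('k::{field,finite}) = CHAR('k) ^ r"
proof -
  define p where "p = CHAR('k)"
  have "p > 0" unfolding p_def using finite_imp_CHAR_pos[where ?'a = 'k] by simp
  have p: "prime p" unfolding p_def using prime_CHAR_semidom[where ?'a = 'k] \<open>p > 0\<close> by (simp add: p_def)
  define P where "P = (\<lambda>S::'k set. 0 \<in> S \<and> (\<forall>x\<in>S. \<forall>y\<in>S. x + y \<in> S) \<and> (\<exists>r. card S = p ^ r))"
  have "P {0}" unfolding P_def by (auto intro!: exI[of _ 0])
  moreover have "card S < Suc CARD('k)" for S :: "'k set"
    using card_mono[of UNIV S] by (simp add: less_Suc_eq_le)
  ultimately obtain S where S: "P S" "\<And>T. P T \<Longrightarrow> card T \<le> card S"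
    using ex_has_greatest_nat[of P "{0}" card "Suc CARD('k)"] by (metis less_imp_le)
  obtain r where r: "card S = p ^ r" using S by (auto simp: P_def)
  have S0: "0 \<in> S" and Sadd: "x \<in> S \<Longrightarrow> y \<in> S \<Longrightarrow> x + y \<in> S" for x y using S(1) by (auto simp: P_def)
  have Smult: "of_nat n * x \<in> S" if "x \<in> S" for n x
    by (induction n) (auto simp: S0 algebra_simps Sadd that)
  have char: "of_nat m = (of_nat n :: 'k)" if "[m = n] (mod p)" for m n
    using that by (simp add: p_def of_nat_eq_iff_cong_CHAR)
  have Sneg: "- x \<in> S" if "x \<in> S" for x
  proof -
    have "of_nat (p - 1) = (- 1 :: 'k)"
      using \<open>p > 0\<close> by (simp add: of_nat_diff p_def)
    thus ?thesis using Smult[OF that, of "p - 1"] by simp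
  qed
  have "S = UNIV"
  proof (rule ccontr)
    assume "S \<noteq> UNIV"
    then obtain x where x: "x \<notin> S" by blast
    define T where "T = (\<lambda>(s, i). s + of_nat i * x) ` (S \<times> {..<p})"
    have key: "i = j" if "s + of_nat i * x = t + of_nat j * x" "s \<in> S" "t \<in> S" "i < p" "j < p" "i \<le> j" for s t i j
    proof (rule ccontr)
      assume "i \<noteq> j"
      hence "coprime (j - i) p"
        using p that by (metis coprime_commute diff_is_0_eq le_antisym less_imp_diff_less nat_dvd_not_less neq0_conv prime_imp_coprime_nat)
      then obtain k where k: "[(j - i) * k = 1] (mod p)"
        using cong_solve_coprime_nat[OF \<open>coprime (j - i) p\<close>] by auto
      have "of_nat (j - i) * x = s - t" using that by (simp add: of_nat_diff algebra_simps)
      also have "s - t \<in> S" using Sadd[OF that(2) Sneg[OF that(3)]] by simp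
      finally have "of_nat k * (of_nat (j - i) * x) \<in> S" by (rule Smult)
      also have "of_nat k * (of_nat (j - i) * x) = of_nat ((j - i) * k) * x" by simp
      also have "of_nat ((j - i) * k) = (1::'k)" using char[OF k] by simp
      finally show False using x by simp
    qed
    have "inj_on (\<lambda>(s, i). s + of_nat i * x) (S \<times> {..<p})"
    proof (rule inj_onI)
      fix a b assume ab: "a \<in> S \<times> {..<p}" "b \<in> S \<times> {..<p}"
        "(case a of (s, i) \<Rightarrow> s + of_nat i * x) = (case b of (s, i) \<Rightarrow> s + of_nat i * x)"
      obtain s i t j where eq: "a = (s, i)" "b = (t, j)" by fastforce
      have "i = j"
      proof (cases "i \<le> j")
        case True thus ?thesis using key[of s i t j] ab eq by auto
      next
        case False thus ?thesis using key[of t j s i] ab eq by auto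
      qed
      thus "a = b" using ab eq by auto
    qed
    hence "card T = p ^ Suc r" unfolding T_def by (simp add: card_image card_cartesian_product r mult.commute)
    moreover have "0 \<in> T" unfolding T_def by (rule image_eqI[of _ _ "(0, 0)"]) (auto simp: S0 \<open>p > 0\<close>)
    moreover have "u + v \<in> T" if "u \<in> T" "v \<in> T" for u v
    proof -
      obtain s i t j where "s \<in> S" "t \<in> S" "u = s + of_nat i * x" "v = t + of_nat j * x"
        using \<open>u \<in> T\<close> \<open>v \<in> T\<close> by (auto simp: T_def)
      moreover have "of_nat (i + j) = (of_nat ((i + j) mod p) :: 'k)" by (rule char) (simp add: cong_def)
      hence "of_nat i * x + of_nat j * x = of_nat ((i + j) mod p) * x"
        by (simp flip: distrib_right)
      ultimately have "u + v = (s + t) + of_nat ((i + j) mod p) * x" "s + t \<in> S"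
        by (simp_all add: Sadd algebra_simps)
      thus ?thesis unfolding T_def using \<open>p > 0\<close> by (intro image_eqI[of _ _ "(s + t, (i + j) mod p)"]) auto
    qed
    ultimately have "P T" unfolding P_def by blast
    hence "p ^ Suc r \<le> p ^ r" using S(2)[of T] r \<open>card T = p ^ Suc r\<close> by simp
    thus False using prime_gt_1_nat[OF p] by simp
  qed
  hence "CARD('k) = p ^ r" using r by simp
  moreover have "r \<noteq> 0"
  proof
    assume "r = 0"
    hence "CARD('k) = 1" using \<open>CARD('k) = p ^ r\<close> by simp
    hence "(0::'k) = 1" by (metis card_1_singletonE UNIV_I singletonD)
    thus False by simp
  qed
  ultimately show ?thesis unfolding p_def by blast
qed

section \<open>Complex roots of unity, discrete logarithms and multiplicative characters\<close>

definition unit_root :: "nat \<Rightarrow> nat \<Rightarrow> complex" where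
  "unit_root d n = cis (2 * pi * real n / real d)"

lemma unit_root_add: "unit_root d (m + n) = unit_root d m * unit_root d n"
  by (simp add: unit_root_def cis_mult add_divide_distrib distrib_left)

lemma unit_root_mult: "unit_root d (n * k) = unit_root d n ^ k"
  by (simp add: unit_root_def DeMoivre mult_ac)

lemma norm_unit_root [simp]: "norm (unit_root d n) = 1"
  by (simp add: unit_root_def)

lemma unit_root_dvd: "d > 0 \<Longrightarrow> d dvd n \<Longrightarrow> unit_root d n = 1"
proof -
  assume d: "d > 0" "d dvd n"
  then obtain k where k: "n = d * k" by blast
  have "2 * pi * real n / real d = 2 * pi * real k" using d by (simp add: k)
  thus ?thesis using cis_multiple_2pi[of "real k"] by (simp add: unit_root_def)
qed

lemma unit_root_eq_1_iff:
  assumes "d > 0"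
  shows "unit_root d n = 1 \<longleftrightarrow> d dvd n"
proof
  assume 1: "unit_root d n = 1"
  have "unit_root d n = unit_root d (d * (n div d)) * unit_root d (n mod d)"
    by (simp flip: unit_root_add)
  hence "unit_root d (n mod d) = unit_root d 0"
    using 1 assms by (simp add: unit_root_dvd)
  moreover have "inj_on (unit_root d) {..<d}"
    using bij_betw_roots_unity[OF assms] unfolding bij_betw_def unit_root_def[abs_def] by simp
  ultimately have "n mod d = 0" using assms by (auto dest: inj_onD)
  thus "d dvd n" by auto
qed (use assms unit_root_dvd in blast)

lemma unit_root_cong:
  assumes "d > 0" "[m = n] (mod d)"
  shows "unit_root d m = unit_root d n"
proof -
  have "unit_root d m = unit_root d (m mod d)" for m
    using assms(1) unit_root_add[of d "d * (m div d)" "m mod d"] by (simp add: unit_root_dvd)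
  thus ?thesis using assms(2) by (metis cong_def)
qed

lemma sum_unit_root:
  assumes "d > 0"
  shows "(\<Sum>j<d. unit_root d (n * j)) = (if d dvd n then of_nat d else 0)"
proof (cases "d dvd n")
  case True
  thus ?thesis using assms by (simp add: unit_root_mult unit_root_dvd)
next
  case False
  hence "unit_root d n \<noteq> 1" using assms unit_root_eq_1_iff by blast
  hence "(\<Sum>j<d. unit_root d n ^ j) = (unit_root d n ^ d - 1) / (unit_root d n - 1)"
    by (rule geometric_sum)
  also have "unit_root d n ^ d = 1" using assms by (simp flip: unit_root_mult add: unit_root_dvd)
  finally show ?thesis using False by (simp add: unit_root_mult)
qed

locale generated_field =
  fixes g :: "'k::{field,finite}"
  assumes g_nonzero: "g \<noteq> 0" and g_gen: "\<And>x. x \<noteq> 0 \<Longrightarrow> \<exists>i. x = g ^ i"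
begin

text \<open>The order of g is \<open>CARD('k) - 1\<close> because the powers of g exhaust the
  nonzero elements.\<close>

lemma g_pow_eq_1_iff: "g ^ i = 1 \<longleftrightarrow> CARD('k) - 1 dvd i"
  and card_gt_1: "CARD('k) > 1"
proof -
  show "CARD('k) > 1"
    using card_mono[of UNIV "{0, 1 :: 'k}"] by simp
  have "\<not> inj (\<lambda>i. g ^ i)"
    using range_inj_infinite[of "\<lambda>i. g ^ i"] by auto
  then obtain a b where "a < b" "g ^ a = g ^ b" unfolding inj_def by (metis linorder_neqE_nat)
  moreover have "g ^ a * g ^ (b - a) = g ^ b" using \<open>a < b\<close> by (simp flip: power_add)
  ultimately have "g ^ a * g ^ (b - a) = g ^ a * 1" by simp
  hence "g ^ (b - a) = 1" using g_nonzero by simp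
  define P where "P = (\<lambda>n. n > 0 \<and> g ^ n = 1)"
  define n where "n = Least P"
  have "P (b - a)" using \<open>a < b\<close> \<open>g ^ (b - a) = 1\<close> by (simp add: P_def)
  hence "P n" unfolding n_def by (rule LeastI)
  hence n: "n > 0" "g ^ n = 1" by (auto simp: P_def)
  have min: "g ^ m \<noteq> 1" if "0 < m" "m < n" for m
    using not_less_Least[of m P] that by (auto simp: n_def P_def)
  have mod: "g ^ i = g ^ (i mod n)" for i
  proof -
    have "g ^ i = (g ^ n) ^ (i div n) * g ^ (i mod n)" by (simp flip: power_mult power_add)
    thus ?thesis by (simp add: n)
  qed
  have iff: "g ^ i = 1 \<longleftrightarrow> n dvd i" for i
    using mod[of i] min[of "i mod n"] n by (metis dvd_eq_mod_eq_0 mod_less_divisor neq0_conv power_0)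
  have inj: "inj_on (\<lambda>i. g ^ i) {..<n}"
  proof (rule linorder_inj_onI)
    fix i j assume "i < j" "i \<in> {..<n}" "j \<in> {..<n}"
    show "g ^ i \<noteq> g ^ j"
    proof
      assume "g ^ i = g ^ j"
      moreover have "g ^ i * g ^ (j - i) = g ^ j" using \<open>i < j\<close> by (simp flip: power_add)
      ultimately have "g ^ i * g ^ (j - i) = g ^ i * 1" by simp
      hence "g ^ (j - i) = 1" using g_nonzero by simp
      thus False using min[of "j - i"] \<open>i < j\<close> \<open>j \<in> {..<n}\<close>
          by (simp add: less_imp_diff_less)
    qed
  qed auto
  have "UNIV - {0} = (\<lambda>i. g ^ i) ` {..<n}"
  proof (intro equalityI subsetI)
    fix x assume "x \<in> UNIV - {0::'k}"
    then obtain i where "x = g ^ i" using g_gen by blast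
    hence "x = g ^ (i mod n)" using mod by metis
    thus "x \<in> (\<lambda>i. g ^ i) ` {..<n}" using n by auto
  qed (use g_nonzero in auto)
  hence "CARD('k) - 1 = n" using card_image[OF inj] by (metis card_Diff_singleton card_lessThan UNIV_I)
  thus "g ^ i = 1 \<longleftrightarrow> CARD('k) - 1 dvd i" using iff by simp
qed

lemma g_pow_eq_iff: "g ^ i = g ^ j \<longleftrightarrow> [i = j] (mod CARD('k) - 1)"
proof -
  have main: "g ^ i = g ^ j \<longleftrightarrow> [i = j] (mod CARD('k) - 1)" if "i \<le> j" for i j
  proof -
    have "g ^ j = g ^ i * g ^ (j - i)" using that by (simp flip: power_add)
    hence "g ^ i = g ^ j \<longleftrightarrow> g ^ (j - i) = 1" using g_nonzero by (auto simp: mult_cancel_left2)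
    also have "\<dots> \<longleftrightarrow> [i = j] (mod CARD('k) - 1)"
      using that by (simp add: g_pow_eq_1_iff cong_sym_eq[of i] cong_altdef_nat)
    finally show ?thesis .
  qed
  show ?thesis using main[of i j] main[of j i] by (metis cong_sym le_cases)
qed

text \<open>An arbitrary exponent is selected, so the value is meaningful only modulo
  \<open>CARD('k) - 1\<close> and only at nonzero arguments.\<close>

definition dlog :: "'k \<Rightarrow> nat" where "dlog x = (SOME i. x = g ^ i)"

lemma g_pow_dlog: "x \<noteq> 0 \<Longrightarrow> g ^ dlog x = x"
  unfolding dlog_def using someI_ex[OF g_gen, of x] by simp

lemma dlog_pow: "[dlog (g ^ i) = i] (mod CARD('k) - 1)"
  unfolding g_pow_eq_iff[symmetric] using g_nonzero by (simp add: g_pow_dlog)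

lemma dlog_mult:
  assumes "x \<noteq> 0" "y \<noteq> 0"
  shows "[dlog (x * y) = dlog x + dlog y] (mod CARD('k) - 1)"
  unfolding g_pow_eq_iff[symmetric] using assms by (simp add: g_pow_dlog power_add)

text \<open>For d dividing \<open>CARD('k) - 1\<close> this is the j-th power of a character of
  order d, extended by 0. The trivial character j = 0 also vanishes at 0, which matters for the
  excluded points in \<open>coset_exists\<close>.\<close>

definition ch :: "nat \<Rightarrow> nat \<Rightarrow> 'k \<Rightarrow> complex" where
  "ch d j x = (if x = 0 then 0 else unit_root d (j * dlog x))"

text \<open>
  If the exponents share a factor with $d$, the characters have a smaller common order $d'$; only
  for this order do they satisfy the irreducibility hypothesis behind the bound in the closure.
\<close>
lemma weil_finite_field_aux:
  assumes d: "d dvd CARD('k) - 1" and B: "B \<noteq> {}" "0 \<notin> B"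
    and ndvd: "\<And>b. b \<in> B \<Longrightarrow> \<not> d dvd e b"
  shows "norm (\<Sum>x\<in>UNIV. \<Prod>b\<in>B. ch d (e b) (b - x)) \<le> (real (card B) - 1) * sqrt (real CARD('k))"
proof -
  define q where "q = CARD('k)"
  have q1: "q > 1" using card_gt_1 by (simp add: q_def)
  have d0: "d > 0" using d q1 by (intro Nat.gr0I) (auto simp: q_def)
  \<comment> \<open>\<open>d'\<close> is the common order of the characters, the least \<delta> for
    which all their \<delta>-th powers are trivial. It divides d, and all exponents are multiples of
    G = d / d', so the product can be rewritten with a character of order d'.\<close>
  define P where "P = (\<lambda>\<delta>. \<delta> > 0 \<and> (\<forall>b\<in>B. d dvd \<delta> * e b))"
  define d' where "d' = Least P"
  have "P d" using d0 by (simp add: P_def)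
  hence d': "P d'" unfolding d'_def by (rule LeastI)
  have min: "\<not> P \<delta>" if "\<delta> < d'" for \<delta> using that not_less_Least unfolding d'_def by blast
  have "d' dvd d"
  proof -
    have "d dvd (d mod d') * e b" if "b \<in> B" for b
    proof -
      have "d dvd (d' * e b) * (d div d')" using d' that by (simp add: P_def)
      moreover have "(d' * (d div d') + d mod d') * e b = (d' * e b) * (d div d') + (d mod d') * e b"
        by (simp only: distrib_right mult.assoc mult.commute[of "d div d'"])
      hence "d * e b = (d' * e b) * (d div d') + (d mod d') * e b" by simp
      ultimately show ?thesis by (metis dvd_add_right_iff dvd_triv_left)
    qed
    hence "d mod d' = 0" using min[of "d mod d'"] d' unfolding P_def by (metis mod_less_divisor neq0_conv)
    thus ?thesis by auto
  qed
  then obtain G where G: "d = d' * G" by blast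
  have G0: "G > 0" using G d0 by (auto intro!: Nat.gr0I)
  have "\<exists>c. e b = G * c" if "b \<in> B" for b
  proof -
    have "d' * G dvd d' * e b" using d' that unfolding P_def G by blast
    hence "G dvd e b" using d' by (auto simp: P_def)
    thus ?thesis by blast
  qed
  then obtain c where c: "\<And>b. b \<in> B \<Longrightarrow> e b = G * c b" by metis
  have d'1: "d' > 1"
  proof -
    obtain b where b: "b \<in> B" using B by blast
    have "d' \<noteq> 1" using d' ndvd[OF b] b by (auto simp: P_def)
    thus ?thesis using d' by (auto simp: P_def)
  qed
  have d'q: "d' dvd q - 1" using \<open>d' dvd d\<close> d by (auto simp: q_def intro: dvd_trans)
  then obtain n where n: "q - 1 = d' * n" by blast
  have n0: "n > 0" using n q1 by (auto intro!: Nat.gr0I)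
  have divn: "(q - 1) div d' = n" using n d'1 by simp
  \<comment> \<open>\<gamma> generates the d'-th roots of unity of the closure, and \<psi> maps its
    powers to those of a complex root of unity. The default value 0 supplies \<psi>(0) = 0.\<close>
  define \<gamma> where "\<gamma> = to_ac g ^ n"
  define \<psi> where "\<psi> = (\<lambda>w. if \<exists>i. w = \<gamma> ^ i then unit_root d' (SOME i. w = \<gamma> ^ i) else 0)"
  have gam_eq: "\<gamma> ^ i = \<gamma> ^ j \<longleftrightarrow> [i = j] (mod d')" for i j
  proof -
    have "\<gamma> ^ i = \<gamma> ^ j \<longleftrightarrow> g ^ (n * i) = g ^ (n * j)"
      unfolding \<gamma>_def by (simp flip: power_mult to_ac_power)
    also have "\<dots> \<longleftrightarrow> [n * i = n * j] (mod n * d')"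
      unfolding g_pow_eq_iff q_def[symmetric] n by (simp add: mult.commute)
    also have "\<dots> \<longleftrightarrow> [i = j] (mod d')"
      using n0 by (simp add: cong_def mult_mod_right[symmetric])
    finally show ?thesis .
  qed
  have psi: "\<psi> (\<gamma> ^ i) = unit_root d' i" for i
  proof -
    have "\<gamma> ^ i = \<gamma> ^ (SOME j. \<gamma> ^ i = \<gamma> ^ j)" by (rule someI[where P = "\<lambda>j. \<gamma> ^ i = \<gamma> ^ j"]) simp
    hence "unit_root d' (SOME j. \<gamma> ^ i = \<gamma> ^ j) = unit_root d' i"
      using d'1 by (intro unit_root_cong) (auto simp: gam_eq cong_sym)
    thus ?thesis unfolding \<psi>_def by auto
  qed
  interpret frobenius_power "TYPE('k alg_closure)" q
  proof
    show "prime CHAR('k alg_closure)"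
      using prime_CHAR_semidom[where ?'a = 'k] finite_imp_CHAR_pos[where ?'a = 'k] by simp
    show "\<exists>r>0. q = CHAR('k alg_closure) ^ r"
      using card_finite_field_prime_power[where ?'k = 'k] by (simp add: q_def)
  qed
  have pow_q: "x ^ q = x" for x :: 'k
  proof (cases "x = 0")
    case False
    have "x ^ (q - 1) = (g ^ (q - 1)) ^ dlog x" using g_pow_dlog[OF False] by (metis mult.commute power_mult)
    also have "g ^ (q - 1) = 1" by (simp add: g_pow_eq_1_iff q_def)
    finally have "x ^ (q - 1) * x = x" by simp
    moreover have "x ^ (q - 1) * x = x ^ q" using q1 by (intro power_minus_mult) simp
    ultimately show ?thesis by metis
  qed (use q1 in simp)
  have fixed: "fixed_by q = range (to_ac :: 'k \<Rightarrow> _)"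
  proof -
    have "range (to_ac :: 'k \<Rightarrow> _) \<subseteq> fixed_by q" by (auto simp: fixed_by_def pow_q simp flip: to_ac_power)
    moreover have "card (range (to_ac :: 'k \<Rightarrow> _)) = card (fixed_by q :: 'k alg_closure set)"
      using card_fixed_by[of 1] by (simp add: card_image inj_to_ac q_def)
    ultimately show ?thesis using card_subset_eq[of "fixed_by q" "range (to_ac :: 'k \<Rightarrow> _)"] finite_fixed_by[of 1]
      by simp
  qed
  have mu: "\<exists>i. w = \<gamma> ^ i" if "w ^ d' = 1" for w
  proof -
    have "w \<in> fixed_by q" by (rule root_of_unity_fixed[OF d'q that])
    then obtain x where x: "w = to_ac x" by (auto simp: fixed)
    have "x \<noteq> 0" using that d'1 by (auto simp: x power_0_left)
    hence xg: "x = g ^ dlog x" by (simp add: g_pow_dlog)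
    have "x ^ d' = 1" using that by (simp add: x flip: to_ac_power)
    hence "g ^ (dlog x * d') = 1" using xg by (metis power_mult)
    hence "d' * n dvd d' * dlog x" unfolding g_pow_eq_1_iff q_def[symmetric] n by (simp add: mult.commute)
    hence "n dvd dlog x" using d'1 by simp
    then obtain i where "dlog x = n * i" by blast
    hence "w = \<gamma> ^ i" unfolding x \<gamma>_def using xg by (metis power_mult to_ac_power)
    thus ?thesis by blast
  qed
  define B' where "B' = to_ac ` B"
  define e' where "e' = (\<lambda>z. c (of_ac z))"
  interpret char_sum "TYPE('k alg_closure)" q d' \<psi> B' e'
  proof
    show "1 < d'" "d' dvd q - 1" by fact+
    have "\<gamma> \<noteq> 0" using g_nonzero by (simp add: \<gamma>_def)
    thus "\<psi> 0 = 0" by (auto simp: \<psi>_def)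
    show "\<psi> (x * y) = \<psi> x * \<psi> y" if xy: "x ^ d' = 1" "y ^ d' = 1" for x y
    proof -
      obtain i where "x = \<gamma> ^ i" using mu[OF xy(1)] by blast
      moreover obtain j where "y = \<gamma> ^ j" using mu[OF xy(2)] by blast
      ultimately show ?thesis by (simp add: psi unit_root_add flip: power_add)
    qed
    show "norm (\<psi> x) = 1" if "x ^ d' = 1" for x
      using mu[OF that] by (auto simp: psi)
    show "x = 1" if x1: "x ^ d' = 1" "\<psi> x = 1" for x
    proof -
      obtain i where i: "x = \<gamma> ^ i" using mu[OF x1(1)] by blast
      hence "d' dvd i" using x1 d'1 by (simp add: psi unit_root_eq_1_iff)
      thus ?thesis using gam_eq[of i 0] by (simp add: i cong_0_iff)
    qed
    show "B' \<subseteq> fixed_by q" by (auto simp: B'_def fixed)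
    show "0 \<notin> B'" using B by (auto simp: B'_def)
    show "\<exists>b\<in>B'. \<not> d' dvd \<delta> * e' b" if "0 < \<delta>" "\<delta> < d'" for \<delta>
    proof (rule ccontr)
      assume "\<not> ?thesis"
      hence "d' dvd \<delta> * c b" if "b \<in> B" for b using that by (auto simp: B'_def e'_def)
      hence "d dvd \<delta> * e b" if "b \<in> B" for b
        using that by (simp add: G c[OF that] mult.left_commute mult.commute[of d' G])
      thus False using min[of \<delta>] that by (simp add: P_def)
    qed
  qed
  have chi: "\<chi> (to_ac x) = ch d G x" for x
  proof (cases "x = 0")
    case True
    thus ?thesis using chi_0 by (simp add: ch_def)
  next
    case False
    have "to_ac x ^ n = \<gamma> ^ dlog x"
      unfolding \<gamma>_def using g_pow_dlog[OF False] by (metis mult.commute power_mult to_ac_power)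
    hence "\<chi> (to_ac x) = unit_root d' (dlog x)" by (simp only: \<chi>_def divn psi)
    also have "\<dots> = unit_root d (G * dlog x)"
      using G0 d'1 by (simp add: unit_root_def G mult_ac)
    finally show ?thesis using False by (simp add: ch_def)
  qed
  have "(\<Sum>z\<in>fixed_by q. \<Prod>b\<in>B'. \<chi> (b - z) ^ e' b) = (\<Sum>x\<in>UNIV. \<Prod>b\<in>B. \<chi> (to_ac b - to_ac x) ^ c b)"
    unfolding fixed B'_def
    by (subst sum.reindex[OF inj_to_ac], subst prod.reindex)
      (auto simp: e'_def inj_on_def)
  also have "\<dots> = (\<Sum>x\<in>UNIV. \<Prod>b\<in>B. ch d (e b) (b - x))"
  proof (intro sum.cong prod.cong refl)
    fix x b assume b: "b \<in> B"
    have "c b \<noteq> 0" using ndvd[OF b] c[OF b] by (intro notI) simp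
    have "\<chi> (to_ac b - to_ac x) = ch d G (b - x)" using chi[of "b - x"] by simp
    also have "\<dots> ^ c b = ch d (e b) (b - x)"
      using \<open>c b \<noteq> 0\<close> by (auto simp: ch_def c[OF b] mult_ac simp flip: unit_root_mult)
    finally show "\<chi> (to_ac b - to_ac x) ^ c b = ch d (e b) (b - x)" .
  qed
  finally show ?thesis using weil_bound
    by (simp add: B'_def card_image inj_on_def q_def)
qed

text \<open>Substituting y = t - x with t outside \<open>B\<close> turns y - b into (t - b) - x and
  moves the points away from 0, as the argument in the closure requires.\<close>

lemma weil_finite_field:
  assumes d: "d dvd CARD('k) - 1" and B: "B \<noteq> {}" "card B < CARD('k)"
    and e: "\<And>b. b \<in> B \<Longrightarrow> \<not> d dvd e b"
  shows "norm (\<Sum>y\<in>UNIV. \<Prod>b\<in>B. ch d (e b) (y - b)) \<le> (real (card B) - 1) * sqrt (real CARD('k))"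
proof -
  obtain t where t: "t \<notin> B" using B(2) by (metis UNIV_eq_I less_irrefl)
  define B' where "B' = (\<lambda>b. t - b) ` B"
  have "(\<Sum>y\<in>UNIV. \<Prod>b\<in>B. ch d (e b) (y - b)) = (\<Sum>x\<in>UNIV. \<Prod>b\<in>B. ch d (e b) (t - b - x))"
    by (rule sum.reindex_bij_witness[of _ "\<lambda>x. t - x" "\<lambda>y. t - y"]) (auto simp: algebra_simps)
  also have "\<dots> = (\<Sum>x\<in>UNIV. \<Prod>b\<in>B'. ch d (e (t - b)) (b - x))"
    unfolding B'_def by (subst prod.reindex) (auto simp: inj_on_def)
  moreover have "norm (\<Sum>x\<in>UNIV. \<Prod>b\<in>B'. ch d (e (t - b)) (b - x))
      \<le> (real (card B') - 1) * sqrt (real CARD('k))"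
    by (rule weil_finite_field_aux[OF d]) (use B(1) e t in \<open>auto simp: B'_def\<close>)
  moreover have "card B' = card B" by (simp add: B'_def card_image inj_on_def)
  ultimately show ?thesis by simp
qed

end

section \<open>Elements in prescribed cosets after several translations\<close>

lemma sum_Pow_by_card:
  fixes G :: "nat \<Rightarrow> real"
  assumes "finite B"
  shows "(\<Sum>H\<in>Pow B. G (card H)) = (\<Sum>h\<le>card B. real (card B choose h) * G h)"
proof -
  have "(\<Sum>H\<in>Pow B. G (card H)) = (\<Sum>h\<le>card B. \<Sum>H | H \<in> Pow B \<and> card H = h. G (card H))"
    by (rule sum.group[symmetric]) (use assms in \<open>auto intro: card_mono\<close>)
  also have "\<dots> = (\<Sum>h\<le>card B. real (card {H. H \<subseteq> B \<and> card H = h}) * G h)"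
    by (intro sum.cong refl) (simp add: Pow_def)
  finally show ?thesis using assms by (simp add: n_subsets)
qed

text \<open>Tuples of character exponents are sorted by the set where they are nonzero. There are (m
  choose h) (d - 1)^h tuples with h nontrivial characters, which is where the weights in U come
  from.\<close>

lemma sum_PiE_by_support:
  fixes F :: "nat \<Rightarrow> real"
  assumes "finite B" "d > 0"
  shows "(\<Sum>J\<in>B \<rightarrow>\<^sub>E {..<d}. F (card {b\<in>B. J b \<noteq> 0})) =
    (\<Sum>h\<le>card B. real (card B choose h) * (real d - 1) ^ h * F h)"
proof -
  have "(\<Sum>J\<in>B \<rightarrow>\<^sub>E {..<d}. F (card {b\<in>B. J b \<noteq> 0})) =
      (\<Sum>H\<in>Pow B. \<Sum>J | J \<in> B \<rightarrow>\<^sub>E {..<d} \<and> {b\<in>B. J b \<noteq> 0} = H. F (card {b\<in>B. J b \<noteq> 0}))"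
    by (rule sum.group[symmetric]) (use assms in \<open>auto intro: finite_PiE\<close>)
  also have "\<dots> = (\<Sum>H\<in>Pow B. (real d - 1) ^ card H * F (card H))"
  proof (intro sum.cong refl)
    fix H assume H: "H \<in> Pow B"
    have "{J. J \<in> B \<rightarrow>\<^sub>E {..<d} \<and> {b\<in>B. J b \<noteq> 0} = H} = (\<Pi>\<^sub>E b\<in>B. if b \<in> H then {1..<d} else {0})"
    proof (intro equalityI subsetI)
      fix J assume "J \<in> {J. J \<in> B \<rightarrow>\<^sub>E {..<d} \<and> {b\<in>B. J b \<noteq> 0} = H}"
      thus "J \<in> (\<Pi>\<^sub>E b\<in>B. if b \<in> H then {1..<d} else {0})"
        by (auto simp: PiE_iff Suc_le_eq)
    next
      fix J assume J: "J \<in> (\<Pi>\<^sub>E b\<in>B. if b \<in> H then {1..<d} else {0})"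
      hence val: "J b \<in> (if b \<in> H then {1..<d} else {0})" if "b \<in> B" for b using that by (rule PiE_mem)
      have "J b < d" if "b \<in> B" for b using val[OF that] assms(2) by (auto split: if_splits)
      moreover have "J b \<noteq> 0 \<longleftrightarrow> b \<in> H" if "b \<in> B" for b using val[OF that] by (auto split: if_splits)
      ultimately show "J \<in> {J. J \<in> B \<rightarrow>\<^sub>E {..<d} \<and> {b\<in>B. J b \<noteq> 0} = H}"
        using J H by (auto simp: PiE_iff)
    qed
    moreover have "card (\<Pi>\<^sub>E b\<in>B. if b \<in> H then {1..<d} else {0::nat}) = (d - 1) ^ card H"
    proof -
      have "card (\<Pi>\<^sub>E b\<in>B. if b \<in> H then {1..<d} else {0::nat}) = (\<Prod>b\<in>B. if b \<in> H then d - 1 else 1)"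
        unfolding card_PiE[OF assms(1)] by (intro prod.cong) auto
      also have "\<dots> = (\<Prod>b\<in>H. d - 1)"
        using H assms(1) by (intro prod.mono_neutral_cong_right) auto
      finally show ?thesis by simp
    qed
    moreover have "(\<Sum>J | J \<in> B \<rightarrow>\<^sub>E {..<d} \<and> {b\<in>B. J b \<noteq> 0} = H. F (card {b\<in>B. J b \<noteq> 0})) =
        real (card {J. J \<in> B \<rightarrow>\<^sub>E {..<d} \<and> {b\<in>B. J b \<noteq> 0} = H}) * F (card H)"
      by simp
    ultimately show "(\<Sum>J | J \<in> B \<rightarrow>\<^sub>E {..<d} \<and> {b\<in>B. J b \<noteq> 0} = H. F (card {b\<in>B. J b \<noteq> 0})) =
        (real d - 1) ^ card H * F (card H)"
      using assms(2) by (simp add: of_nat_diff)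
  qed
  also have "\<dots> = (\<Sum>h\<le>card B. real (card B choose h) * ((real d - 1) ^ h * F h))"
    by (rule sum_Pow_by_card[OF assms(1)])
  finally show ?thesis by (simp add: mult.assoc)
qed

text \<open>Follows from (m - h) (m choose h) = m (m - 1 choose h) and the binomial theorem. This
  total is the source of the term d^(m-1) m in Q(d,m).\<close>

lemma sum_binomial_complement:
  assumes "d > 0" "m > 0"
  shows "(\<Sum>h\<le>m. real (m choose h) * (real d - 1) ^ h * (real m - real h)) = real m * real d ^ (m - 1)"
proof -
  have "(\<Sum>h\<le>m. real (m choose h) * (real d - 1) ^ h * (real m - real h))
      = (\<Sum>h\<le>m. real m * (real (m - 1 choose h) * (real d - 1) ^ h))"
  proof (intro sum.cong refl)
    fix h assume "h \<in> {..m}"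
    hence "real m - real h = real (m - h)" by simp
    hence "(real m - real h) * real (m choose h) = real ((m - h) * (m choose h))"
      by (simp only: of_nat_mult)
    also have "\<dots> = real m * real (m - 1 choose h)" by (simp only: binomial_absorb_comp of_nat_mult)
    finally have eq: "(real m - real h) * real (m choose h) = real m * real (m - 1 choose h)" .
    have "real (m choose h) * (real d - 1) ^ h * (real m - real h) =
        (real m - real h) * real (m choose h) * (real d - 1) ^ h" by (simp only: mult_ac)
    thus "real (m choose h) * (real d - 1) ^ h * (real m - real h) =
        real m * (real (m - 1 choose h) * (real d - 1) ^ h)"
      by (simp only: eq mult.assoc)
  qed
  also have "\<dots> = real m * (\<Sum>h\<le>m - 1. real (m - 1 choose h) * (real d - 1) ^ h)"
    unfolding sum_distrib_left using assms(2)
    by (intro sum.mono_neutral_right) (auto simp: binomial_eq_0_iff)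
  also have "(\<Sum>h\<le>m - 1. real (m - 1 choose h) * (real d - 1) ^ h) = ((real d - 1) + 1) ^ (m - 1)"
    by (subst binomial_ring) simp
  finally show ?thesis by simp
qed

text \<open>The square root of Q(d,m) is the larger root of s^2 = U s + m d^(m-1).\<close>

lemma Q_bound_sqrt:
  assumes "d > 0" "real q > Q_bound d m"
  shows "real q > U_sum d m * sqrt (real q) + real m * real d ^ (m - 1)"
proof -
  define U where "U = U_sum d m"
  define D where "D = real m * real d ^ (m - 1)"
  define r where "r = sqrt (U\<^sup>2 + 4 * D)"
  define s where "s = sqrt (real q)"
  have "D \<ge> 0" by (simp add: D_def)
  have U0: "U \<ge> 0" unfolding U_def U_sum_def using assms(1)
    by (intro sum_nonneg mult_nonneg_nonneg zero_le_power) auto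
  have r: "r\<^sup>2 = U\<^sup>2 + 4 * D" "r \<ge> 0" using \<open>D \<ge> 0\<close> by (auto simp: r_def)
  have "Q_bound d m = ((U + r) / 2)\<^sup>2"
    by (simp add: Q_bound_def U_def r_def D_def power_divide mult_ac)
  hence "sqrt (((U + r) / 2)\<^sup>2) < s"
    unfolding s_def by (intro real_sqrt_less_mono) (use assms(2) in simp)
  hence gt: "(U + r) / 2 < s" using U0 r by simp
  have "(2 * s - U)\<^sup>2 > r\<^sup>2" using gt r by (intro power_strict_mono) auto
  hence "s\<^sup>2 > U * s + D" unfolding r(1) by (simp add: power2_eq_square algebra_simps)
  moreover have "s\<^sup>2 = real q" by (simp add: s_def)
  ultimately show ?thesis by (simp add: U_def D_def s_def)
qed

context generated_field
begin

lemma norm_ch_le: "norm (ch d j x) \<le> 1"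
  by (simp add: ch_def)

text \<open>Orthogonality: the sum is d times the indicator of one coset. The natural number d - t
  mod d stands for -t.\<close>

lemma sum_ch:
  assumes "d > 0"
  shows "(\<Sum>j<d. unit_root d (j * (d - t mod d)) * ch d j x) =
    (if x \<noteq> 0 \<and> [dlog x = t] (mod d) then of_nat d else 0)"
proof (cases "x = 0")
  case False
  have "(\<Sum>j<d. unit_root d (j * (d - t mod d)) * ch d j x) = (\<Sum>j<d. unit_root d ((dlog x + (d - t mod d)) * j))"
    using False by (intro sum.cong refl) (simp add: ch_def algebra_simps flip: unit_root_add)
  moreover have "d dvd dlog x + (d - t mod d) \<longleftrightarrow> [dlog x = t] (mod d)"
  proof -
    have "[t mod d + (d - t mod d) = 0] (mod d)"
      using assms by (simp add: cong_def)
    hence "[t + (d - t mod d) = 0] (mod d)"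
      by (metis cong_add_rcancel_nat cong_mod_left cong_refl cong_trans cong_sym)
    hence "[dlog x + (d - t mod d) = 0] (mod d) \<longleftrightarrow> [dlog x + (d - t mod d) = t + (d - t mod d)] (mod d)"
      by (meson cong_sym cong_trans)
    thus ?thesis by (simp add: cong_0_iff cong_add_rcancel_nat)
  qed
  ultimately show ?thesis using assms False by (simp add: sum_unit_root)
qed (simp add: ch_def)

text \<open>If no y exists, the product of the coset indicators vanishes at every y. Expanded in
  characters, the trivial tuple contributes q - m and a tuple with h > 0 nontrivial entries at most
  (h - 1) sqrt q + (m - h) by Weil's bound; for q > Q(d,m) these cannot add up to zero.\<close>

lemma coset_exists:
  assumes d: "d dvd CARD('k) - 1" and m: "card B = m" "m > 0"
    and Q: "real CARD('k) > Q_bound d m"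
  shows "\<exists>y. \<forall>b\<in>B. y \<noteq> b \<and> [dlog (y - b) = t b] (mod d)"
proof (rule ccontr)
  assume none: "\<not> ?thesis"
  define q where "q = CARD('k)"
  have d0: "d > 0" using d card_gt_1 by (intro Nat.gr0I) auto
  have finB: "finite B" by simp
  define s where "s = sqrt (real q)"
  have main: "real q > U_sum d m * s + real m * real d ^ (m - 1)"
    using Q_bound_sqrt[OF d0, of m q] Q by (simp add: q_def s_def)
  have U0: "U_sum d m \<ge> 0" unfolding U_sum_def using d0
    by (intro sum_nonneg mult_nonneg_nonneg zero_le_power) auto
  have "real m \<le> real m * real d ^ (m - 1)" using d0 by (simp add: mult_le_cancel_left1)
  moreover have "U_sum d m * s \<ge> 0" using U0 by (simp add: s_def)
  ultimately have mq: "m < q" using main by linarith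
  define \<J> where "\<J> = B \<rightarrow>\<^sub>E {..<d}"
  define T where "T = (\<lambda>J. \<Sum>y\<in>UNIV. \<Prod>b\<in>B. ch d (J b) (y - b))"
  define h where "h = (\<lambda>J::'k \<Rightarrow> nat. card {b\<in>B. J b \<noteq> 0})"
  have fin\<J>: "finite \<J>" unfolding \<J>_def by (intro finite_PiE) auto
  have T_split: "T J = (\<Sum>y\<in>UNIV - (B - H). \<Prod>b\<in>H. ch d (J b) (y - b))"
    if H: "H = {b\<in>B. J b \<noteq> 0}" for J H
  proof -
    have "(\<Prod>b\<in>B. ch d (J b) (y - b)) = (if y \<in> B - H then 0 else \<Prod>b\<in>H. ch d (J b) (y - b))" for y
    proof (cases "y \<in> B - H")
      case True
      hence "(\<Prod>b\<in>B. ch d (J b) (y - b)) = 0" using finB by (intro prod_zero) (auto simp: ch_def)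
      thus ?thesis using True by simp
    next
      case False
      have "(\<Prod>b\<in>B. ch d (J b) (y - b)) = (\<Prod>b\<in>H. ch d (J b) (y - b))"
        by (rule prod.mono_neutral_right) (use False H in \<open>auto simp: ch_def unit_root_def\<close>)
      thus ?thesis using False by (simp only: if_False)
    qed
    hence "T J = (\<Sum>y\<in>UNIV. if y \<in> B - H then 0 else \<Prod>b\<in>H. ch d (J b) (y - b))" by (simp add: T_def)
    also have "\<dots> = (\<Sum>y\<in>UNIV - (B - H). \<Prod>b\<in>H. ch d (J b) (y - b))"
      by (rule sum.mono_neutral_cong_right) auto
    finally show ?thesis .
  qed
  \<comment> \<open>The m - h trivial characters still vanish at their own points, so the complete
    sum is corrected by m - h terms of modulus at most 1.\<close>
  have T_bound: "norm (T J) \<le> (real (h J) - 1) * s + (real m - real (h J))" if J: "J \<in> \<J>" "h J \<noteq> 0" for J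
  proof -
    define H where "H = {b\<in>B. J b \<noteq> 0}"
    have H: "card H = h J" "H \<subseteq> B" by (auto simp: H_def h_def)
    have "T J = (\<Sum>y\<in>UNIV. \<Prod>b\<in>H. ch d (J b) (y - b)) - (\<Sum>y\<in>B - H. \<Prod>b\<in>H. ch d (J b) (y - b))"
      unfolding T_split[OF H_def] by (rule sum_diff) auto
    hence "norm (T J) \<le> norm (\<Sum>y\<in>UNIV. \<Prod>b\<in>H. ch d (J b) (y - b)) + norm (\<Sum>y\<in>B - H. \<Prod>b\<in>H. ch d (J b) (y - b))"
      by (simp add: norm_triangle_ineq4)
    also have "norm (\<Sum>y\<in>UNIV. \<Prod>b\<in>H. ch d (J b) (y - b)) \<le> (real (card H) - 1) * s"
      unfolding s_def q_def
    proof (rule weil_finite_field[OF d])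
      show "H \<noteq> {}" using H J by auto
      show "card H < CARD('k)" using H mq m card_mono[OF finB H(2)] by (simp add: q_def)
      show "\<not> d dvd J b" if "b \<in> H" for b
      proof -
        have "J b < d" "J b \<noteq> 0" using J that by (auto simp: \<J>_def H_def)
        thus ?thesis using nat_dvd_not_less by auto
      qed
    qed
    also have "norm (\<Sum>y\<in>B - H. \<Prod>b\<in>H. ch d (J b) (y - b)) \<le> (\<Sum>y\<in>B - H. 1)"
      by (intro order_trans[OF norm_sum] sum_mono)
        (simp add: prod_norm[symmetric] prod_le_1 norm_ch_le)
    also have "\<dots> = real m - real (h J)"
      using H m card_mono[OF finB H(2)] by (simp add: card_Diff_subset finite_subset of_nat_diff)
    finally show ?thesis using H by simp
  qed
  define J0 where "J0 = (\<lambda>b\<in>B. 0::nat)"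
  have J0: "J0 \<in> \<J>" "h J0 = 0" using d0 by (auto simp: J0_def \<J>_def h_def)
  have h0: "J = J0" if "J \<in> \<J>" "h J = 0" for J
    using that by (auto simp: J0_def \<J>_def h_def PiE_iff extensional_def restrict_def card_eq_0_iff)
  have T0: "T J0 = of_nat q - of_nat m"
  proof -
    have "{b\<in>B. J0 b \<noteq> 0} = {}" by (auto simp: J0_def)
    hence "T J0 = (\<Sum>y\<in>UNIV - B. 1)" using T_split[of "{}" J0] by simp
    also have "\<dots> = of_nat (q - m)" using m by (simp add: card_Diff_subset q_def)
    finally show ?thesis using mq by (simp add: of_nat_diff)
  qed
  define a where "a = (\<lambda>b j. unit_root d (j * (d - t b mod d)))"
  have "0 = (\<Sum>y\<in>UNIV. \<Prod>b\<in>B. \<Sum>j<d. a b j * ch d j (y - b))"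
  proof -
    have "(\<Prod>b\<in>B. \<Sum>j<d. a b j * ch d j (y - b)) = 0" for y
    proof -
      obtain b where "b \<in> B" "\<not> (y \<noteq> b \<and> [dlog (y - b) = t b] (mod d))" using none by blast
      moreover from this have "(\<Sum>j<d. a b j * ch d j (y - b)) = 0"
        using sum_ch[OF d0, of "t b" "y - b"] unfolding a_def by auto
      ultimately show ?thesis by (intro prod_zero[OF finB]) blast
    qed
    thus ?thesis by (simp only: sum.neutral_const)
  qed
  also have "\<dots> = (\<Sum>y\<in>UNIV. \<Sum>J\<in>\<J>. \<Prod>b\<in>B. a b (J b) * ch d (J b) (y - b))"
    unfolding \<J>_def by (subst prod_sum_PiE) auto
  also have "\<dots> = (\<Sum>J\<in>\<J>. (\<Prod>b\<in>B. a b (J b)) * T J)"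
    by (subst sum.swap) (simp add: T_def prod.distrib sum_distrib_left)
  also have "\<dots> = (\<Prod>b\<in>B. a b (J0 b)) * T J0 + (\<Sum>J\<in>\<J> - {J0}. (\<Prod>b\<in>B. a b (J b)) * T J)"
    by (rule sum.remove[OF fin\<J> J0(1)])
  also have "(\<Prod>b\<in>B. a b (J0 b)) = 1"
    by (intro prod.neutral) (auto simp: a_def J0_def unit_root_def)
  finally have "T J0 = - (\<Sum>J\<in>\<J> - {J0}. (\<Prod>b\<in>B. a b (J b)) * T J)"
    by (simp add: eq_neg_iff_add_eq_0)
  hence "norm (T J0) \<le> (\<Sum>J\<in>\<J> - {J0}. norm ((\<Prod>b\<in>B. a b (J b)) * T J))"
    by (simp only: norm_minus_cancel) (rule norm_sum)
  also have "\<dots> = (\<Sum>J\<in>\<J> - {J0}. norm (T J))"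
    by (intro sum.cong refl) (simp add: norm_mult prod_norm[symmetric] a_def)
  also have "\<dots> \<le> (\<Sum>J\<in>\<J> - {J0}. (real (h J) - 1) * s + (real m - real (h J)))"
    by (intro sum_mono T_bound) (use h0 in auto)
  \<comment> \<open>Adding the trivial tuple with its formal bound m - s lets the sum run over all
    tuples. Its part -s is the reason for U - 1 below, because U starts at h = 1.\<close>
  also have "\<dots> = (\<Sum>J\<in>\<J>. (real (h J) - 1) * s + (real m - real (h J))) - (real m - s)"
    by (subst sum.remove[OF fin\<J> J0(1)]) (simp add: J0(2))
  also have "(\<Sum>J\<in>\<J>. (real (h J) - 1) * s + (real m - real (h J))) =
      (\<Sum>i\<le>m. real (m choose i) * (real d - 1) ^ i * ((real i - 1) * s + (real m - real i)))"
    unfolding \<J>_def h_def m(1)[symmetric]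
    by (rule sum_PiE_by_support[OF finB d0])
  also have "\<dots> = (\<Sum>i\<le>m. real (m choose i) * (real d - 1) ^ i * (real i - 1)) * s + real m * real d ^ (m - 1)"
    unfolding sum_binomial_complement[OF d0 m(2), symmetric] sum_distrib_right sum.distrib[symmetric]
    by (intro sum.cong refl) (simp add: algebra_simps)
  also have "(\<Sum>i\<le>m. real (m choose i) * (real d - 1) ^ i * (real i - 1)) = U_sum d m - 1"
    unfolding U_sum_def
    by (subst atMost_atLeast0, subst sum.atLeast_Suc_atMost) auto
  finally have "norm (T J0) \<le> U_sum d m * s + real m * real d ^ (m - 1) - real m"
    by (simp add: algebra_simps)
  moreover have "norm (T J0) = real q - real m"
  proof -
    have "T J0 = complex_of_real (real q - real m)" by (simp add: T0)
    thus ?thesis using mq by (simp only: norm_of_real)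
  qed
  ultimately show False using main by linarith
qed

text \<open>Padding the point set to exactly m elements avoids comparing Q(d,m) for different
  m.\<close>

lemma coset_exists_le:
  assumes "d dvd CARD('k) - 1" "card B \<le> m" "m > 0" "real CARD('k) > Q_bound d m"
  shows "\<exists>y. \<forall>b\<in>B. y \<noteq> b \<and> [dlog (y - b) = t b] (mod d)"
proof -
  have d0: "d > 0" using assms(1) card_gt_1 by (intro Nat.gr0I) auto
  have U0: "U_sum d m \<ge> 0" unfolding U_sum_def using d0
    by (intro sum_nonneg mult_nonneg_nonneg zero_le_power) auto
  have "real m \<le> real m * real d ^ (m - 1)" using d0 by (simp add: mult_le_cancel_left1)
  moreover have "U_sum d m * sqrt (real CARD('k)) \<ge> 0" using U0 by simp
  ultimately have "m \<le> CARD('k)" using Q_bound_sqrt[OF d0 assms(4)] by linarith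
  then obtain B' where B': "B \<subseteq> B'" "card B' = m"
    using exists_subset_between[of B m UNIV] assms(2) by auto
  obtain y where "\<forall>b\<in>B'. y \<noteq> b \<and> [dlog (y - b) = t b] (mod d)"
    using coset_exists[OF assms(1) B'(2) assms(3,4), of t] by blast
  thus ?thesis using B'(1) by blast
qed

end

section \<open>Balanced colourings\<close>

text \<open>Greedy: as long as some point is uncoloured, fewer than d l points are coloured, so some
  class still has room.\<close>

lemma balanced_colouring_extension:
  fixes c0 :: "'x \<Rightarrow> nat" and d l :: nat
  assumes "finite V" "card V = d * l" "Y \<subseteq> V" "\<And>x. x \<in> Y \<Longrightarrow> c0 x < d"
    and "\<And>i. i < d \<Longrightarrow> card {x\<in>Y. c0 x = i} \<le> l"
  shows "\<exists>c. (\<forall>x\<in>Y. c x = c0 x) \<and> (\<forall>x\<in>V. c x < d) \<and> (\<forall>i<d. card {x\<in>V. c x = i} = l)"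
  using assms
proof (induction "card (V - Y)" arbitrary: Y c0)
  case 0
  have VY: "V = Y" using 0 by (simp add: card_eq_0_iff)
  have "(\<Sum>i<d. card {x\<in>V. c0 x = i}) = card V"
  proof -
    have "(\<Sum>i<d. \<Sum>x | x \<in> V \<and> c0 x = i. 1) = (\<Sum>x\<in>V. (1::nat))"
      by (rule sum.group) (use 0 VY in auto)
    thus ?thesis by simp
  qed
  also have "\<dots> = (\<Sum>i<d. l)" using 0 by simp
  finally have "(\<Sum>i<d. l) = (\<Sum>i<d. card {x\<in>V. c0 x = i})" by simp
  hence "card {x\<in>V. c0 x = i} = l" if "i < d" for i
    using sum_mono_inv[of "\<lambda>i. card {x\<in>V. c0 x = i}" "{..<d}" "\<lambda>_. l" i] 0(6) that VY by simp
  thus ?case using 0 VY by blast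
next
  case (Suc n)
  have "V - Y \<noteq> {}" using Suc(2) by (metis card.empty nat.distinct(1))
  then obtain x where x: "x \<in> V" "x \<notin> Y" by blast
  have finY: "finite Y" by (rule finite_subset[OF Suc(5,3)])
  have "\<exists>i<d. card {y\<in>Y. c0 y = i} < l"
  proof (rule ccontr)
    assume "\<not> ?thesis"
    hence "(\<Sum>i<d. l) \<le> (\<Sum>i<d. card {y\<in>Y. c0 y = i})" by (intro sum_mono) (use not_less in blast)
    also have "\<dots> = card Y"
    proof -
      have "(\<Sum>i<d. \<Sum>x | x \<in> Y \<and> c0 x = i. 1) = (\<Sum>x\<in>Y. (1::nat))"
        by (rule sum.group) (use Suc(6) finY in auto)
      thus ?thesis by simp
    qed
    also have "\<dots> < card V" using x Suc(3,5) by (intro psubset_card_mono) auto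
    finally show False using Suc(4) by simp
  qed
  then obtain i where i: "i < d" "card {y\<in>Y. c0 y = i} < l" by blast
  define c1 where "c1 = c0(x := i)"
  have set_eq: "{y \<in> insert x Y. c1 y = j} = (if j = i then insert x {y\<in>Y. c0 y = j} else {y\<in>Y. c0 y = j})" for j
    using x by (auto simp: c1_def)
  have "\<exists>c. (\<forall>y\<in>insert x Y. c y = c1 y) \<and> (\<forall>x\<in>V. c x < d) \<and> (\<forall>i<d. card {x\<in>V. c x = i} = l)"
  proof (rule Suc(1))
    show "n = card (V - insert x Y)"
    proof -
      have "V - insert x Y = (V - Y) - {x}" by auto
      thus ?thesis using Suc(2) x Suc(3) by simp
    qed
    show "card {y \<in> insert x Y. c1 y = j} \<le> l" if "j < d" for j
      using Suc(7)[OF that] i finY x unfolding set_eq by (auto simp: card_insert_if)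
  qed (use Suc(3-6) x i in \<open>auto simp: c1_def\<close>)
  then obtain c where c: "\<forall>y\<in>insert x Y. c y = c1 y" "\<forall>x\<in>V. c x < d" "\<forall>i<d. card {x\<in>V. c x = i} = l"
    by blast
  have "\<forall>y\<in>Y. c y = c0 y" using c(1) x by (auto simp: c1_def)
  thus ?case using c by blast
qed

text \<open>The colouring is chosen on the image of f and pulled back, which multiplies class sizes
  by the fibre size m. It serves for f sending a pair to its orbit, with m = 4.\<close>

lemma balanced_colouring_fibres:
  fixes c0 :: "'x \<Rightarrow> nat" and f :: "'x \<Rightarrow> 'z"
  assumes G: "finite G" "card G = m * (d * l)" "m > 0"
    and fib: "\<And>x. x \<in> G \<Longrightarrow> card {y\<in>G. f y = f x} = m"
    and P: "P \<subseteq> G" "\<And>x y. x \<in> P \<Longrightarrow> y \<in> G \<Longrightarrow> f x = f y \<Longrightarrow> y \<in> P \<and> c0 x = c0 y"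
    and c0: "\<And>x. x \<in> P \<Longrightarrow> c0 x < d"
    and le: "\<And>i. i < d \<Longrightarrow> card (f ` {x\<in>P. c0 x = i}) \<le> l"
  shows "\<exists>c. (\<forall>x\<in>P. c x = c0 x) \<and> (\<forall>x\<in>G. \<forall>y\<in>G. f x = f y \<longrightarrow> c x = c y) \<and> (\<forall>x\<in>G. c x < d) \<and>
    (\<forall>i<d. card {x\<in>G. c x = i} = m * l)"
proof -
  have card_fib: "card {x\<in>G. f x \<in> Z} = m * card Z" if "Z \<subseteq> f ` G" for Z
  proof -
    have "finite Z" using that G(1) finite_subset by blast
    have "{x\<in>G. f x \<in> Z} = (\<Union>z\<in>Z. {x\<in>G. f x = z})" by auto
    also have "card \<dots> = (\<Sum>z\<in>Z. card {x\<in>G. f x = z})"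
      by (rule card_UN_disjoint) (use \<open>finite Z\<close> G in auto)
    also have "\<dots> = (\<Sum>z\<in>Z. m)"
    proof (intro sum.cong refl)
      fix z assume "z \<in> Z"
      then obtain x where "x \<in> G" "z = f x" using \<open>Z \<subseteq> f ` G\<close> by blast
      thus "card {x\<in>G. f x = z} = m" using fib by simp
    qed
    finally show ?thesis by simp
  qed
  have "m * card (f ` G) = m * (d * l)"
    using card_fib[of "f ` G"] G by (simp add: Collect_conj_eq Int_absorb2 subset_iff)
  hence cV: "card (f ` G) = d * l" using G(3) by simp
  define r where "r = (\<lambda>z. SOME x. x \<in> P \<and> f x = z)"
  have r: "r z \<in> P \<and> f (r z) = z" if "z \<in> f ` P" for z
    unfolding r_def by (rule someI_ex) (use that in auto)
  have rc: "c0 (r (f x)) = c0 x" if "x \<in> P" for x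
    using r[of "f x"] that P(2)[of "r (f x)" x] P(1) by auto
  have "\<exists>c. (\<forall>z\<in>f ` P. c z = c0 (r z)) \<and> (\<forall>z\<in>f ` G. c z < d) \<and> (\<forall>i<d. card {z\<in>f ` G. c z = i} = l)"
  proof (rule balanced_colouring_extension)
    show "card {z \<in> f ` P. c0 (r z) = i} \<le> l" if "i < d" for i
    proof -
      have "{z \<in> f ` P. c0 (r z) = i} = f ` {x\<in>P. c0 x = i}" using rc by auto
      thus ?thesis using le[OF that] by simp
    qed
  qed (use G cV P c0 r in auto)
  then obtain c where c: "\<forall>z\<in>f ` P. c z = c0 (r z)" "\<forall>z\<in>f ` G. c z < d"
      "\<forall>i<d. card {z\<in>f ` G. c z = i} = l" by blast
  have "card {x\<in>G. c (f x) = i} = m * l" if "i < d" for i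
  proof -
    have "{x\<in>G. c (f x) = i} = {x\<in>G. f x \<in> {z\<in>f ` G. c z = i}}" by auto
    thus ?thesis using card_fib[of "{z\<in>f ` G. c z = i}"] c(3) that by auto
  qed
  thus ?thesis using c rc by (intro exI[of _ "\<lambda>x. c (f x)"]) auto
qed

lemma card_residue_class:
  fixes d l i :: nat
  assumes "i < d"
  shows "card {j\<in>{..<d * l}. j mod d = i} = l"
proof -
  have "{j\<in>{..<d * l}. j mod d = i} = (\<lambda>t. d * t + i) ` {..<l}"
  proof safe
    fix j assume j: "j < d * l" "i = j mod d"
    hence "j div d < l" by (simp add: less_mult_imp_div_less mult.commute)
    thus "j \<in> (\<lambda>t. d * t + j mod d) ` {..<l}"
      by (intro image_eqI[of _ _ "j div d"]) auto
  next
    fix t assume "t < l"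
    hence "d * t + d \<le> d * l" by (metis Suc_leI mult_Suc_right add.commute mult_le_mono2)
    thus "d * t + i < d * l" using assms by linarith
  qed (use assms in auto)
  thus ?thesis using assms by (simp add: card_image inj_on_def)
qed

text \<open>Modulo n, the increment C(i + s) - C(i) is s for the identity, which settles s \<noteq>
  \<kappa>, and -s for negation, which settles s = \<kappa> with 2 s \<noteq> 0. In the remaining
  case n = 2 s, and interleaving the two halves gives the increments 1 and -1, both different from s
  once s \<ge> 2, as n \<ge> 3 ensures.\<close>

lemma bij_avoiding_translation:
  fixes n s \<kappa> :: nat
  assumes n: "n > 0" and s: "s < n" and k: "\<kappa> < n" and c: "if s = 0 then \<kappa> \<noteq> 0 else n \<ge> 3"
  shows "\<exists>C. bij_betw C {..<n} {..<n} \<and> (\<forall>i<n. C ((i + s) mod n) \<noteq> (C i + \<kappa>) mod n)"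
proof -
  consider "s \<noteq> \<kappa>" | "s = \<kappa>" "(s + \<kappa>) mod n \<noteq> 0" | "s = \<kappa>" "(s + \<kappa>) mod n = 0" by blast
  thus ?thesis
  proof cases
    case 1
    have "(i + s) mod n \<noteq> (i + \<kappa>) mod n" for i
    proof
      assume "(i + s) mod n = (i + \<kappa>) mod n"
      hence "[s = \<kappa>] (mod n)" unfolding cong_def[symmetric] by (simp add: cong_add_lcancel_nat)
      thus False using 1 s k by (simp add: cong_def)
    qed
    thus ?thesis by (intro exI[of _ id]) auto
  next
    case 2
    define C where "C = (\<lambda>i. (n - i) mod n)"
    have C: "[C i + i = 0] (mod n)" if "i < n" for i
      using that by (simp add: C_def cong_def mod_simps)
    have "C (C i) = i" if "i < n" for i
      using that by (cases "i = 0") (auto simp: C_def)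
    hence "bij_betw C {..<n} {..<n}"
      by (intro bij_betwI[of _ _ _ C]) (use n in \<open>auto simp: C_def\<close>)
    moreover have "C ((i + s) mod n) \<noteq> (C i + \<kappa>) mod n" if "i < n" for i
    proof
      assume eq: "C ((i + s) mod n) = (C i + \<kappa>) mod n"
      have "[(C i + \<kappa>) + (i + s) = C ((i + s) mod n) + (i + s) mod n] (mod n)"
        by (intro cong_add) (auto simp: eq cong_def)
      also have "[C ((i + s) mod n) + (i + s) mod n = 0] (mod n)" using n by (intro C) simp
      finally have "[(C i + i) + (s + \<kappa>) = 0] (mod n)" by (simp add: algebra_simps)
      moreover have "[(C i + i) + (s + \<kappa>) = 0 + (s + \<kappa>)] (mod n)" by (intro cong_add C that cong_refl)
      ultimately have "[s + \<kappa> = 0] (mod n)" by (metis add_0 cong_sym cong_trans)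
      thus False using 2 by (simp add: cong_def)
    qed
    ultimately show ?thesis by blast
  next
    case 3
    have s0: "s \<noteq> 0" using 3 c by (cases "s = 0") auto
    hence n3: "n \<ge> 3" using c by simp
    have n2: "n = 2 * s"
    proof -
      have "n dvd 2 * s" using 3 by (simp add: mod_eq_0_iff_dvd mult_2)
      then obtain m where m: "2 * s = n * m" by blast
      have "n * m < n * 2" using m s by linarith
      hence "m < 2" by simp
      moreover have "m \<noteq> 0" using m s0 by (cases m) auto
      ultimately have "m = 1" by simp
      thus ?thesis using m by simp
    qed
    have s2: "s \<ge> 2" using n3 n2 by simp
    define C where "C = (\<lambda>i. if i < s then 2 * i else 2 * (i - s) + 1)"
    define C' where "C' = (\<lambda>i. if even i then i div 2 else s + i div 2)"
    have "bij_betw C {..<n} {..<n}"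
      by (rule bij_betwI[of _ _ _ C']) (use n2 in \<open>auto simp: C_def C'_def elim!: evenE oddE\<close>)
    moreover have "C ((i + s) mod n) \<noteq> (C i + \<kappa>) mod n" if "i < n" for i
    proof (cases "i < s")
      case True
      hence "(i + s) mod n = i + s" using n2 by simp
      hence "C ((i + s) mod n) = 2 * i + 1" by (simp add: C_def)
      moreover have "(C i + \<kappa>) mod n = (2 * i + s) mod n" using True 3 by (simp add: C_def)
      moreover have "(2 * i + 1) mod n = 2 * i + 1" using True n2 by simp
      moreover have "\<not> [2 * i + 1 = 2 * i + s] (mod n)"
        unfolding cong_add_lcancel_nat using s2 n2 by (simp add: cong_def)
      ultimately show ?thesis by (simp add: cong_def)
    next
      case False
      then obtain j where j: "i = s + j" using le_Suc_ex not_less by metis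
      hence "(i + s) mod n = j" using that n2 by (simp add: mod_if)
      moreover have "j < s" using j that n2 by simp
      ultimately have "C ((i + s) mod n) = 2 * j" "2 * j < n" "C i = 2 * j + 1" using n2 by (auto simp: C_def j)
      moreover have "\<not> [2 * j + 0 = 2 * j + (1 + s)] (mod n)"
        unfolding cong_add_lcancel_nat using s2 n2 by (simp add: cong_def)
      ultimately show ?thesis using 3 by (simp add: cong_def)
    qed
    ultimately show ?thesis by blast
  qed
qed

lemma count_differences:
  fixes B :: "'g::ab_group_add set"
  assumes "finite B"
  shows "count (differences B) x = card {(y, z). y \<in> B \<and> z \<in> B \<and> y \<noteq> z \<and> y - z = x}"
proof -
  have fin: "finite {(x, y). x \<in> B \<and> y \<in> B \<and> x \<noteq> y}"
    by (rule finite_subset[of _ "B \<times> B"]) (use assms in auto)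
  have "count (differences B) x = card {u \<in> {(x, y). x \<in> B \<and> y \<in> B \<and> x \<noteq> y}. (\<lambda>(x, y). x - y) u = x}"
    unfolding differences_def using fin
    by (simp add: count_image_mset' Int_def conj_commute eq_commute flip: card_eq_sum)
  also have "{u \<in> {(x, y). x \<in> B \<and> y \<in> B \<and> x \<noteq> y}. (\<lambda>(x, y). x - y) u = x} =
      {(y, z). y \<in> B \<and> z \<in> B \<and> y \<noteq> z \<and> y - z = x}" by auto
  finally show ?thesis .
qed

section \<open>The base blocks\<close>

text \<open>\<open>C\<close> prescribes the coset of \<Phi>(g^i) for i < n and uses every coset
  \<open>lam\<close> times. If t^2 = 2 u^2, the pairs (t, 0) and (u, \<iota> u) give the same first
  coordinate; \<open>C_avoid\<close> keeps their cosets apart when \<open>lam = 1\<close>.\<close>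

locale block_construction = P: generated_field g + Q: generated_field h
  for g :: "'a::{field,finite}" and h :: "'b::{field,finite}" +
  fixes lam d n :: nat and \<xi> :: 'b and C :: "nat \<Rightarrow> nat"
  assumes p: "CARD('a) = 4 * n + 1" and n: "n = d * lam" "n > 0"
    and q: "4 * d dvd CARD('b) - 1"
    and xi: "\<xi>\<^sup>2 = -1" "(1::'b) \<noteq> -1"
    and C: "\<And>i. i < d \<Longrightarrow> card {j\<in>{..<n}. C j = i} = lam" "\<And>j. j < n \<Longrightarrow> C j < d"
    and C_avoid: "\<And>t u. \<lbrakk>lam = 1; t \<noteq> 0; u \<noteq> 0; t\<^sup>2 = 2 * u\<^sup>2\<rbrakk> \<Longrightarrow>
      C (P.dlog t mod n) \<noteq> (C (P.dlog u mod n) + Q.dlog (1 - \<xi>)) mod d"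
begin

definition \<iota> :: 'a where "\<iota> = g ^ n"

text \<open>The index of the coset of the d-th powers that contains z; for nonzero z it is
  independent of the choice in \<open>dlog\<close>, as d divides
  \<open>CARD('b) - 1\<close>.\<close>

definition col :: "'b \<Rightarrow> nat" where "col z = Q.dlog z mod d"

definition cc :: "'a \<Rightarrow> nat" where "cc t = C (P.dlog t mod n)"

text \<open>The case c = 0 is included: it consists of the pairs (t, -t) with t nonzero, which yield
  the differences with first coordinate 0.\<close>

definition pairs :: "'a \<Rightarrow> ('a \<times> 'a) set" where
  "pairs c = {(t, u). t \<noteq> u \<and> t\<^sup>2 - u\<^sup>2 = c}"

lemma d_pos: "d > 0" and lam_pos: "lam > 0"
  using n by auto

lemma iota2: "\<iota>\<^sup>2 = -1" and one_ne: "(1::'a) \<noteq> -1"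
proof -
  have "\<iota>\<^sup>2 \<noteq> 1"
  proof
    assume "\<iota>\<^sup>2 = 1"
    hence "g ^ (2 * n) = 1" by (simp add: \<iota>_def mult.commute flip: power_mult)
    hence "4 * n dvd 2 * n" by (simp add: P.g_pow_eq_1_iff p)
    thus False using n(2) by (auto dest: dvd_imp_le)
  qed
  have "g ^ (4 * n) = 1" by (simp add: P.g_pow_eq_1_iff p)
  hence "(\<iota>\<^sup>2)\<^sup>2 = 1" by (simp add: \<iota>_def mult.commute flip: power_mult)
  thus "\<iota>\<^sup>2 = -1" using \<open>\<iota>\<^sup>2 \<noteq> 1\<close> power2_eq_1_iff by blast
  thus "(1::'a) \<noteq> -1" using \<open>\<iota>\<^sup>2 \<noteq> 1\<close> by metis
qed

lemma iota_mult: "\<iota> * (\<iota> * x) = - x" "\<iota> * \<iota> = -1"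
  using iota2 by (simp_all add: power2_eq_square flip: mult.assoc)

lemma xi_mult: "\<xi> * (\<xi> * x) = - x" "\<xi> * \<xi> = -1"
  using xi by (simp_all add: power2_eq_square flip: mult.assoc)

lemma iota_nonzero: "\<iota> \<noteq> 0" and xi_nonzero: "\<xi> \<noteq> 0"
  using iota2 xi by auto

lemma two_nonzero: "(2::'a) \<noteq> 0" "(2::'b) \<noteq> 0"
  using one_ne xi(2) by (metis add_eq_0_iff one_add_one)+

lemma four_nonzero: "(4::'a) \<noteq> 0"
proof -
  have "(4::'a) = 2 * 2" by simp
  thus ?thesis using two_nonzero(1) mult_eq_0_iff by metis
qed

lemma neg_eq_iff: "(x::'a) = - x \<longleftrightarrow> x = 0" "(y::'b) = - y \<longleftrightarrow> y = 0"
  using two_nonzero by (metis add.inverse_neutral add_eq_0_iff mult_2 mult_eq_0_iff)+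

lemma d_dvd: "d dvd CARD('b) - 1"
  using q by (metis dvd_mult_right)

lemma col_less: "col z < d"
  using d_pos by (simp add: col_def)

lemma col_mult:
  assumes "x \<noteq> 0" "y \<noteq> 0"
  shows "col (x * y) = (col x + col y) mod d"
proof -
  have "[Q.dlog (x * y) = Q.dlog x + Q.dlog y] (mod d)"
    using Q.dlog_mult[OF assms] d_dvd by (rule cong_dvd_modulus_nat)
  thus ?thesis by (simp add: col_def cong_def mod_simps)
qed

lemma col_eq_0_iff: "col z = 0 \<longleftrightarrow> d dvd Q.dlog z"
  by (simp add: col_def dvd_eq_mod_eq_0)

text \<open>From \<xi>^4 = 1, \<open>CARD('b) - 1\<close> divides four times the logarithm of \<xi>,
  and 4 d divides \<open>CARD('b) - 1\<close>. Hence multiplication by \<xi> or -1 never changes a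
  coset.\<close>

lemma col_xi: "col \<xi> = 0"
proof -
  have "\<xi> ^ 4 = (\<xi>\<^sup>2)\<^sup>2" by (simp flip: power_mult)
  hence "\<xi> ^ 4 = 1" by (simp add: xi)
  hence "h ^ (Q.dlog \<xi> * 4) = 1" by (simp add: power_mult Q.g_pow_dlog xi_nonzero)
  hence "CARD('b) - 1 dvd Q.dlog \<xi> * 4" by (simp only: Q.g_pow_eq_1_iff)
  hence "4 * d dvd 4 * Q.dlog \<xi>" using q by (metis dvd_trans mult.commute)
  thus ?thesis by (simp add: col_eq_0_iff)
qed

lemma col_xi_mult: "x \<noteq> 0 \<Longrightarrow> col (\<xi> * x) = col x"
  using col_mult[OF xi_nonzero, of x] col_less[of x] by (simp add: col_xi)

lemma col_neg: "x \<noteq> 0 \<Longrightarrow> col (- x) = col x"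
  using col_xi_mult[of "\<xi> * x"] col_xi_mult[of x] xi_nonzero by (simp add: xi_mult)

lemma col_xi_pow_mult: "x \<noteq> 0 \<Longrightarrow> col (\<xi> ^ k * x) = col x"
  by (induction k) (auto simp: mult.assoc col_xi_mult xi_nonzero)

lemma cc_iota: "t \<noteq> 0 \<Longrightarrow> cc (\<iota> * t) = cc t"
proof -
  assume t: "t \<noteq> 0"
  have "[P.dlog (\<iota> * t) = P.dlog \<iota> + P.dlog t] (mod 4 * n)"
    using P.dlog_mult[OF iota_nonzero t] by (simp add: p)
  moreover have "[P.dlog \<iota> = n] (mod 4 * n)" using P.dlog_pow[of n] by (simp add: \<iota>_def p)
  ultimately have "[P.dlog (\<iota> * t) = n + P.dlog t] (mod 4 * n)"
    by (meson cong_add_rcancel_nat cong_trans)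
  hence "[P.dlog (\<iota> * t) = n + P.dlog t] (mod n)" by (rule cong_dvd_modulus_nat) simp
  thus ?thesis by (simp add: cc_def cong_def)
qed

lemma cc_neg: "t \<noteq> 0 \<Longrightarrow> cc (- t) = cc t"
  using cc_iota[of "\<iota> * t"] cc_iota[of t] iota_nonzero by (simp add: iota_mult)

lemma cc_less: "cc t < d"
  unfolding cc_def by (rule C(2)) (use n(2) in simp)

lemma card_cc:
  assumes "i < d"
  shows "card {t. t \<noteq> 0 \<and> cc t = i} = 4 * lam"
proof -
  have "{t. t \<noteq> 0 \<and> cc t = i} = (\<lambda>j. g ^ j) ` {j\<in>{..<n * 4}. C (j mod n) = i}"
  proof (intro equalityI subsetI)
    fix t assume t: "t \<in> {t. t \<noteq> 0 \<and> cc t = i}"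
    define j where "j = P.dlog t mod (n * 4)"
    have "[j = P.dlog t] (mod CARD('a) - 1)" by (simp add: j_def p mult.commute cong_def)
    hence "g ^ j = g ^ P.dlog t" by (simp only: P.g_pow_eq_iff)
    hence "g ^ j = t" using t by (simp add: P.g_pow_dlog)
    moreover have "j mod n = P.dlog t mod n" by (simp add: j_def mod_mod_cancel)
    moreover have "j < n * 4" using n by (simp add: j_def)
    ultimately show "t \<in> (\<lambda>j. g ^ j) ` {j\<in>{..<n * 4}. C (j mod n) = i}"
      using t by (intro image_eqI[of _ _ j]) (auto simp: cc_def)
  next
    fix t assume "t \<in> (\<lambda>j. g ^ j) ` {j\<in>{..<n * 4}. C (j mod n) = i}"
    then obtain j where j: "t = g ^ j" "C (j mod n) = i" by auto
    have "[P.dlog t = j] (mod 4 * n)" using P.dlog_pow[of j] by (simp add: j p)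
    hence "[P.dlog t = j] (mod n)" by (rule cong_dvd_modulus_nat) simp
    thus "t \<in> {t. t \<noteq> 0 \<and> cc t = i}" using j P.g_nonzero by (simp add: cc_def cong_def)
  qed
  moreover have "inj_on (\<lambda>j. g ^ j) {j\<in>{..<n * 4}. C (j mod n) = i}"
    by (rule inj_onI) (simp add: P.g_pow_eq_iff p cong_def mult.commute)
  ultimately have "card {t. t \<noteq> 0 \<and> cc t = i} = card {j\<in>{..<n * 4}. C (j mod n) = i}"
    by (simp add: card_image)
  also have "{j\<in>{..<n * 4}. C (j mod n) = i} = (\<Union>r\<in>{r\<in>{..<n}. C r = i}. {j\<in>{..<n * 4}. j mod n = r})"
    using n by auto
  also have "card \<dots> = (\<Sum>r\<in>{r\<in>{..<n}. C r = i}. card {j\<in>{..<n * 4}. j mod n = r})"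
    by (rule card_UN_disjoint) auto
  also have "\<dots> = (\<Sum>r\<in>{r\<in>{..<n}. C r = i}. 4)"
    by (intro sum.cong refl) (use card_residue_class[of _ n 4] in auto)
  also have "\<dots> = 4 * lam" using C(1)[OF assms] by simp
  finally show ?thesis .
qed

text \<open>In odd characteristic t - u can be any nonzero w, and then t + u = c / w.\<close>

lemma card_pairs:
  assumes "c \<noteq> 0"
  shows "card (pairs c) = 4 * n"
proof -
  have "bij_betw (\<lambda>(t, u). t - u) (pairs c) (UNIV - {0})"
  proof (rule bij_betwI[where g = "\<lambda>w. ((c / w + w) / 2, (c / w - w) / 2)"])
    show "(\<lambda>w. ((c / w + w) / 2, (c / w - w) / 2)) \<in> UNIV - {0} \<rightarrow> pairs c"
    proof
      fix w :: 'a assume w: "w \<in> UNIV - {0}"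
      define t u where "t = (c / w + w) / 2" and "u = (c / w - w) / 2"
      have 1: "t - u = w" "t + u = c / w" using two_nonzero four_nonzero by (simp_all add: t_def u_def field_simps)
      have "t\<^sup>2 - u\<^sup>2 = (t - u) * (t + u)" by (simp add: power2_eq_square algebra_simps)
      also have "\<dots> = c" using w by (simp add: 1)
      finally have "(t, u) \<in> pairs c" using 1 w by (auto simp: pairs_def)
      thus "((c / w + w) / 2, (c / w - w) / 2) \<in> pairs c" by (simp add: t_def u_def)
    qed
    show "(case ((c / w + w) / 2, (c / w - w) / 2) of (t, u) \<Rightarrow> t - u) = w" if "w \<in> UNIV - {0}" for w
      using two_nonzero four_nonzero by (simp add: field_simps)
    show "((c / (case x of (t, u) \<Rightarrow> t - u) + (case x of (t, u) \<Rightarrow> t - u)) / 2,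
        (c / (case x of (t, u) \<Rightarrow> t - u) - (case x of (t, u) \<Rightarrow> t - u)) / 2) = x" if "x \<in> pairs c" for x
    proof -
      obtain t u where x: "x = (t, u)" by fastforce
      have "c = (t - u) * (t + u)" "t \<noteq> u" using that by (auto simp: x pairs_def power2_eq_square algebra_simps)
      hence "c / (t - u) = t + u" by simp
      thus ?thesis using two_nonzero by (simp add: x field_simps)
    qed
  qed (auto simp: pairs_def)
  hence "card (pairs c) = card (UNIV - {0::'a})" by (rule bij_betw_same_card)
  thus ?thesis by (simp add: p)
qed

section \<open>Orbits of pairs and the prescription of cosets\<close>

text \<open>Rotation by \<iota> and the swap each change the sign of t^2 - u^2; their composition
  therefore acts on \<open>pairs c\<close>.\<close>

definition \<tau> :: "'a \<times> 'a \<Rightarrow> 'a \<times> 'a" where "\<tau> = (\<lambda>(t, u). (\<iota> * u, \<iota> * t))"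

definition orb :: "'a \<times> 'a \<Rightarrow> ('a \<times> 'a) set" where "orb x = {x, \<tau> x, \<tau> (\<tau> x), \<tau> (\<tau> (\<tau> x))}"

lemma tau_pairs: "x \<in> pairs c \<Longrightarrow> \<tau> x \<in> pairs c"
  using iota_nonzero by (auto simp: pairs_def \<tau>_def power_mult_distrib iota2)

lemma tau4: "\<tau> (\<tau> (\<tau> (\<tau> x))) = x"
  by (cases x) (simp add: \<tau>_def iota_mult)

lemma tau2: "\<tau> (\<tau> (t, u)) = (- t, - u)"
  by (simp add: \<tau>_def iota_mult)

lemma orb_eq_iff: "orb x = orb y \<longleftrightarrow> y \<in> orb x"
proof
  assume "orb x = orb y"
  thus "y \<in> orb x" by (simp add: orb_def)
next
  have step: "orb (\<tau> x) = orb x" for x by (auto simp: orb_def tau4)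
  assume "y \<in> orb x"
  hence "y \<in> {x, \<tau> x, \<tau> (\<tau> x), \<tau> (\<tau> (\<tau> x))}" by (simp only: orb_def)
  thus "orb x = orb y" by (elim insertE emptyE) (simp_all only: step)
qed

text \<open>The square of \<tau> is negation, which fixes no pair because t \<noteq> u excludes (0,
  0); so all orbits have length exactly 4.\<close>

lemma card_orb_fibre:
  assumes "x \<in> pairs c"
  shows "card {y \<in> pairs c. orb y = orb x} = 4"
proof -
  have "orb x \<subseteq> pairs c" using assms tau_pairs by (auto simp: orb_def)
  moreover have "orb y = orb x \<longleftrightarrow> y \<in> orb x" for y using orb_eq_iff[of x y] by metis
  ultimately have "{y \<in> pairs c. orb y = orb x} = orb x" by blast
  moreover have ne2: "\<tau> (\<tau> x) \<noteq> x"
    using assms neg_eq_iff by (cases x) (auto simp: tau2 pairs_def dest: sym)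
  hence ne1: "\<tau> x \<noteq> x" by auto
  have "\<tau> (\<tau> (\<tau> x)) \<noteq> x" using ne1 tau4 by metis
  moreover have "\<tau> (\<tau> x) \<noteq> \<tau> x" "\<tau> (\<tau> (\<tau> x)) \<noteq> \<tau> x" "\<tau> (\<tau> (\<tau> x)) \<noteq> \<tau> (\<tau> x)"
    using ne1 ne2 tau4 by metis+
  hence "card (orb x) = 4" using ne1 ne2 \<open>\<tau> (\<tau> (\<tau> x)) \<noteq> x\<close>
    unfolding orb_def by (auto simp: card_insert_if)
  ultimately show ?thesis by simp
qed

text \<open>
  Once the cosets of the values of the map at nonzero arguments are fixed, the cosets of its
  differences are forced on these pairs; on all other pairs they can be prescribed.
\<close>
definition forced :: "'a \<times> 'a \<Rightarrow> bool" where
  "forced = (\<lambda>(t, u). t = 0 \<or> u = 0 \<or> u = \<iota> * t \<or> u = - (\<iota> * t))"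

text \<open>These are the cosets of \<Phi>(t) - \<Phi>(u) dictated by \<Phi>(0) = 0 and
  \<Phi>(\<iota> t) = \<xi> \<Phi>(t). The two signs in u = \<iota> t and u = -\<iota> t agree
  because 1 + \<xi> = \<xi> (1 - \<xi>).\<close>

definition c0 :: "'a \<times> 'a \<Rightarrow> nat" where
  "c0 = (\<lambda>(t, u). if t = 0 then cc u else if u = 0 then cc t else (cc t + col (1 - \<xi>)) mod d)"

lemma forced_tau:
  assumes "forced x" "x \<in> pairs c"
  shows "forced (\<tau> x)" "c0 (\<tau> x) = c0 x"
  using assms iota_nonzero
  by (auto simp: forced_def c0_def \<tau>_def pairs_def iota_mult cc_iota cc_neg)

lemma forced_orb:
  assumes "forced x" "x \<in> pairs c" "y \<in> orb x"
  shows "forced y" "c0 y = c0 x"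
  using assms forced_tau[OF assms(1,2)] forced_tau[of "\<tau> x" c] forced_tau[of "\<tau> (\<tau> x)" c] tau_pairs
  by (auto simp: orb_def)

lemma sq_eq: "(x::'a)\<^sup>2 = y\<^sup>2 \<longleftrightarrow> y = x \<or> y = - x"
  by (auto simp: power2_eq_iff)

text \<open>Up to \<tau> such a pair is (s, 0) with s^2 = c, and the sign of s is changed by the
  square of \<tau>.\<close>

lemma forced_axis:
  assumes "(t, u) \<in> pairs c" "(t', u') \<in> pairs c" "t = 0 \<or> u = 0" "t' = 0 \<or> u' = 0"
  shows "orb (t, u) = orb (t', u')"
proof -
  have 1: "\<exists>s. s\<^sup>2 = c \<and> (t, u) \<in> orb (s, 0)" if "(t, u) \<in> pairs c" "t = 0 \<or> u = 0" for t u
  proof (cases "u = 0")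
    case True
    thus ?thesis using that by (intro exI[of _ t]) (auto simp: pairs_def orb_def)
  next
    case False
    hence "t = 0" using that by simp
    thus ?thesis using that by (intro exI[of _ "\<iota> * u"])
      (auto simp: pairs_def orb_def power_mult_distrib iota2 \<tau>_def iota_mult)
  qed
  have 2: "orb (s, 0) = orb (s', 0)" if "s\<^sup>2 = c" "s'\<^sup>2 = c" for s s'
    unfolding orb_eq_iff using that sq_eq[of s s'] by (auto simp: orb_def tau2)
  obtain s where "s\<^sup>2 = c" "(t, u) \<in> orb (s, 0)" using 1 assms by blast
  moreover obtain s' where "s'\<^sup>2 = c" "(t', u') \<in> orb (s', 0)" using 1 assms by blast
  ultimately show ?thesis using 2 orb_eq_iff by metis
qed

text \<open>Here 2 t^2 = c determines t up to sign, and \<tau> exchanges the shapes u = \<iota> t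
  and u = -\<iota> t.\<close>

lemma forced_diag:
  assumes "(t, u) \<in> pairs c" "(t', u') \<in> pairs c" "u = \<iota> * t \<or> u = - (\<iota> * t)" "u' = \<iota> * t' \<or> u' = - (\<iota> * t')"
  shows "orb (t, u) = orb (t', u')"
proof -
  have 1: "2 * t\<^sup>2 = c" if "(t, u) \<in> pairs c" "u = \<iota> * t \<or> u = - (\<iota> * t)" for t u
    using that by (auto simp: pairs_def power_mult_distrib iota2)
  have "t' = t \<or> t' = - t" using 1[OF assms(1,3)] 1[OF assms(2,4)] two_nonzero sq_eq[of t t'] by auto
  thus ?thesis unfolding orb_eq_iff using assms(3,4) by (auto simp: orb_def tau2 \<tau>_def iota_mult)
qed

text \<open>There are at most two forced orbits, one from the axes and one from the diagonals, which
  is harmless for \<open>lam\<close> at least 2; for \<open>lam = 1\<close>, \<open>C_avoid\<close>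
  puts them into different classes.\<close>

lemma forced_count:
  assumes "i < d"
  shows "card (orb ` {x \<in> pairs c. forced x \<and> c0 x = i}) \<le> lam"
proof -
  define A where "A = {x \<in> pairs c. (fst x = 0 \<or> snd x = 0) \<and> c0 x = i}"
  define D where "D = {x \<in> pairs c. fst x \<noteq> 0 \<and> (snd x = \<iota> * fst x \<or> snd x = - (\<iota> * fst x)) \<and> c0 x = i}"
  have le1: "card (f ` S) \<le> 1" if "\<And>x y. x \<in> S \<Longrightarrow> y \<in> S \<Longrightarrow> f x = f y" for f :: "'a \<times> 'a \<Rightarrow> ('a \<times> 'a) set" and S
  proof (cases "S = {}")
    case False
    then obtain x where "x \<in> S" by blast
    hence "f ` S \<subseteq> {f x}" using that by blast
    hence "card (f ` S) \<le> card {f x}" by (intro card_mono) auto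
    thus ?thesis by simp
  qed simp
  have cA: "card (orb ` A) \<le> 1"
  proof (rule le1)
    fix x y assume "x \<in> A" "y \<in> A"
    thus "orb x = orb y" using forced_axis[of "fst x" "snd x" c "fst y" "snd y"] by (simp add: A_def)
  qed
  have cD: "card (orb ` D) \<le> 1"
  proof (rule le1)
    fix x y assume "x \<in> D" "y \<in> D"
    thus "orb x = orb y" using forced_diag[of "fst x" "snd x" c "fst y" "snd y"] by (simp add: D_def)
  qed
  have AD: "orb ` {x \<in> pairs c. forced x \<and> c0 x = i} \<subseteq> orb ` A \<union> orb ` D"
    by (auto simp: A_def D_def forced_def)
  have finAD: "finite (orb ` A \<union> orb ` D)" by (auto simp: A_def D_def)
  show ?thesis
  proof (cases "lam = 1")
    case False
    have "card (orb ` {x \<in> pairs c. forced x \<and> c0 x = i}) \<le> card (orb ` A \<union> orb ` D)"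
      by (rule card_mono[OF finAD AD])
    also have "\<dots> \<le> 2" using card_Un_le[of "orb ` A" "orb ` D"] cA cD by linarith
    finally show ?thesis using False lam_pos by linarith
  next
    case True
    have "A = {} \<or> D = {}"
    proof (rule ccontr)
      assume "\<not> ?thesis"
      then obtain x y where x: "x \<in> A" and y: "y \<in> D" by blast
      obtain t u where xt: "x = (t, u)" by fastforce
      obtain v w where yv: "y = (v, w)" by fastforce
      have v: "v \<noteq> 0" "2 * v\<^sup>2 = c" "i = (cc v + col (1 - \<xi>)) mod d"
        using y iota_nonzero by (auto simp: D_def yv pairs_def power_mult_distrib iota2 c0_def)
      have "\<exists>s. s \<noteq> 0 \<and> s\<^sup>2 = c \<and> cc s = i"
      proof (cases "u = 0")
        case True
        thus ?thesis using x by (intro exI[of _ t]) (auto simp: A_def xt pairs_def c0_def)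
      next
        case False
        thus ?thesis using x iota_nonzero by (intro exI[of _ "\<iota> * u"])
          (auto simp: A_def xt pairs_def c0_def power_mult_distrib iota2 cc_iota)
      qed
      then obtain s where s: "s \<noteq> 0" "s\<^sup>2 = c" "cc s = i" by blast
      have "cc s \<noteq> (cc v + Q.dlog (1 - \<xi>)) mod d"
        using C_avoid[OF True s(1) v(1)] s(2) v(2) by (simp add: cc_def)
      thus False using s v by (simp add: col_def mod_simps)
    qed
    hence "card (orb ` {x \<in> pairs c. forced x \<and> c0 x = i}) \<le> 1"
      using card_mono[OF finAD AD] cA cD by (elim disjE) auto
    thus ?thesis using True by simp
  qed
qed

lemma pair_colouring:
  assumes "c \<noteq> 0"
  shows "\<exists>K. (\<forall>x\<in>pairs c. forced x \<longrightarrow> K x = c0 x) \<and> (\<forall>x\<in>pairs c. K (\<tau> x) = K x) \<and>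
    (\<forall>x\<in>pairs c. K x < d) \<and> (\<forall>i<d. card {x\<in>pairs c. K x = i} = 4 * lam)"
proof -
  have "\<exists>K. (\<forall>x\<in>{x\<in>pairs c. forced x}. K x = c0 x) \<and>
      (\<forall>x\<in>pairs c. \<forall>y\<in>pairs c. orb x = orb y \<longrightarrow> K x = K y) \<and> (\<forall>x\<in>pairs c. K x < d) \<and>
      (\<forall>i<d. card {x\<in>pairs c. K x = i} = 4 * lam)"
  proof (rule balanced_colouring_fibres)
    show "card (pairs c) = 4 * (d * lam)" using card_pairs[OF assms] n by simp
    show "card {y \<in> pairs c. orb y = orb x} = 4" if "x \<in> pairs c" for x by (rule card_orb_fibre[OF that])
    show "y \<in> {x \<in> pairs c. forced x} \<and> c0 x = c0 y"
      if "x \<in> {x \<in> pairs c. forced x}" "y \<in> pairs c" "orb x = orb y" for x y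
      using that forced_orb[of x c y] orb_eq_iff[of x y] by auto
    show "c0 x < d" for x using cc_less d_pos by (auto simp: c0_def split: prod.splits)
    show "card (orb ` {x \<in> {x \<in> pairs c. forced x}. c0 x = i}) \<le> lam" if "i < d" for i
      using forced_count[OF that, of c] by (simp add: conj_assoc)
  qed auto
  then obtain K where K: "\<forall>x\<in>{x\<in>pairs c. forced x}. K x = c0 x"
      "\<forall>x\<in>pairs c. \<forall>y\<in>pairs c. orb x = orb y \<longrightarrow> K x = K y" "\<forall>x\<in>pairs c. K x < d"
      "\<forall>i<d. card {x\<in>pairs c. K x = i} = 4 * lam" by blast
  have "K (\<tau> x) = K x" if "x \<in> pairs c" for x
  proof -
    have "orb x = orb (\<tau> x)" unfolding orb_eq_iff by (simp add: orb_def)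
    thus ?thesis using K(2) that tau_pairs[OF that] by metis
  qed
  thus ?thesis using K(1,3,4) by (intro exI[of _ K] conjI) blast+
qed

text \<open>Swapping a pair replaces c by -c, so a colouring is chosen freely for one of c and -c
  and carried over to the other. For c = 0 there is no freedom: the coset of \<Phi>(t) - \<Phi>(-t)
  = 2 \<Phi>(t) is determined, and the balance comes from that of \<open>C\<close>.\<close>

lemma total_colouring:
  "\<exists>Col. (\<forall>t u. t \<noteq> u \<longrightarrow> Col (u, t) = Col (t, u) \<and> Col (\<iota> * t, \<iota> * u) = Col (t, u)) \<and>
    (\<forall>t. t \<noteq> 0 \<longrightarrow> Col (t, 0) = cc t \<and> Col (t, \<iota> * t) = (cc t + col (1 - \<xi>)) mod d \<and>
      Col (t, - t) = (cc t + col 2) mod d) \<and>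
    (\<forall>t u. t \<noteq> u \<longrightarrow> Col (t, u) < d) \<and>
    (\<forall>c i. i < d \<longrightarrow> card {x\<in>pairs c. Col x = i} = 4 * lam)"
proof -
  define good where "good = (\<lambda>c K. (\<forall>x\<in>pairs c. forced x \<longrightarrow> K x = c0 x) \<and> (\<forall>x\<in>pairs c. K (\<tau> x) = K x) \<and>
    (\<forall>x\<in>pairs c. K x < d) \<and> (\<forall>i<d. card {x\<in>pairs c. K x = i} = 4 * lam))"
  have "\<forall>c. \<exists>K. c \<noteq> 0 \<longrightarrow> good c K"
  proof
    fix c
    show "\<exists>K. c \<noteq> 0 \<longrightarrow> good c K"
    proof (cases "c = 0")
      case False
      then obtain K where "good c K" using pair_colouring[OF False] unfolding good_def by (elim exE)
      thus ?thesis by blast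
    qed simp
  qed
  then obtain K where "\<forall>c. c \<noteq> 0 \<longrightarrow> good c (K c)" using choice[of "\<lambda>c K. c \<noteq> 0 \<longrightarrow> good c K"] by blast
  hence K: "(\<forall>x\<in>pairs c. forced x \<longrightarrow> K c x = c0 x) \<and> (\<forall>x\<in>pairs c. K c (\<tau> x) = K c x) \<and>
    (\<forall>x\<in>pairs c. K c x < d) \<and> (\<forall>i<d. card {x\<in>pairs c. K c x = i} = 4 * lam)" if "c \<noteq> 0" for c
    using that unfolding good_def by blast
  \<comment> \<open>An arbitrary set containing exactly one of c and -c for each nonzero c;
    comparing chosen logarithms merely selects one.\<close>
  define H where "H = {c. P.dlog c < P.dlog (- c)}"
  have H: "- c \<in> H \<longleftrightarrow> c \<notin> H" if "c \<noteq> 0" for c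
  proof -
    have "P.dlog c \<noteq> P.dlog (- c)"
      using that neg_eq_iff(1)[of c] P.g_pow_dlog[of c] P.g_pow_dlog[of "- c"] by auto
    thus ?thesis by (auto simp: H_def)
  qed
  define Col where "Col = (\<lambda>(t, u). if t\<^sup>2 - u\<^sup>2 = 0 then (cc t + col 2) mod d
    else if t\<^sup>2 - u\<^sup>2 \<in> H then K (t\<^sup>2 - u\<^sup>2) (t, u) else K (u\<^sup>2 - t\<^sup>2) (u, t))"
  have in_pairs: "(t, u) \<in> pairs (t\<^sup>2 - u\<^sup>2)" if "t \<noteq> u" for t u using that by (simp add: pairs_def)
  have swap: "Col (u, t) = Col (t, u)" if "t \<noteq> u" for t u
  proof (cases "t\<^sup>2 = u\<^sup>2")
    case True
    hence "u = - t" "t \<noteq> 0" using that sq_eq[of t u] by auto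
    thus ?thesis by (simp add: Col_def cc_neg)
  next
    case False
    hence "u\<^sup>2 - t\<^sup>2 \<in> H \<longleftrightarrow> t\<^sup>2 - u\<^sup>2 \<notin> H" using H[of "t\<^sup>2 - u\<^sup>2"] by simp
    thus ?thesis using False by (auto simp: Col_def)
  qed
  have K_tau: "K c (\<iota> * u, \<iota> * t) = K c (t, u)" if "(t, u) \<in> pairs c" "c \<noteq> 0" for c t u
    using K[OF that(2)] that(1) by (auto simp: \<tau>_def dest: bspec[of _ _ "(t, u)"])
  have rot: "Col (\<iota> * t, \<iota> * u) = Col (t, u)" if "t \<noteq> u" for t u
  proof (cases "t\<^sup>2 = u\<^sup>2")
    case True
    hence "t \<noteq> 0" using that by auto
    thus ?thesis using True by (simp add: Col_def power_mult_distrib iota2 cc_iota)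
  next
    case False
    have sq: "(\<iota> * t)\<^sup>2 - (\<iota> * u)\<^sup>2 = u\<^sup>2 - t\<^sup>2" "(\<iota> * u)\<^sup>2 - (\<iota> * t)\<^sup>2 = t\<^sup>2 - u\<^sup>2"
      by (simp_all add: power_mult_distrib iota2)
    have "(\<iota> * t)\<^sup>2 \<noteq> (\<iota> * u)\<^sup>2" using False by (simp add: power_mult_distrib iota2)
    moreover have "u\<^sup>2 - t\<^sup>2 \<in> H \<longleftrightarrow> t\<^sup>2 - u\<^sup>2 \<notin> H" using False H[of "t\<^sup>2 - u\<^sup>2"] by simp
    ultimately show ?thesis
      using False K_tau[OF in_pairs[OF that]] K_tau[OF in_pairs[OF that[symmetric]]]
      by (auto simp: Col_def sq)
  qed
  have forced_Col: "Col (t, u) = c0 (t, u)" if "t \<noteq> u" "forced (t, u)" "t\<^sup>2 \<noteq> u\<^sup>2" "forced (u, t)" "c0 (u, t) = c0 (t, u)" for t u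
    using K[of "t\<^sup>2 - u\<^sup>2"] K[of "u\<^sup>2 - t\<^sup>2"] in_pairs[of t u] in_pairs[of u t] that
    by (auto simp: Col_def)
  have spec: "Col (t, 0) = cc t" "Col (t, \<iota> * t) = (cc t + col (1 - \<xi>)) mod d"
      "Col (t, - t) = (cc t + col 2) mod d" if t: "t \<noteq> 0" for t
  proof -
    show "Col (t, 0) = cc t"
      using forced_Col[of t 0] t by (simp add: forced_def c0_def)
    have "t \<noteq> \<iota> * t" using t iota2 one_ne by (auto simp: power2_eq_square)
    moreover have "t\<^sup>2 \<noteq> (\<iota> * t)\<^sup>2" using t neg_eq_iff(1)[of "t\<^sup>2"] by (simp add: power_mult_distrib iota2)
    ultimately show "Col (t, \<iota> * t) = (cc t + col (1 - \<xi>)) mod d"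
      using forced_Col[of t "\<iota> * t"] t iota_nonzero by (simp add: forced_def c0_def iota_mult cc_iota)
    show "Col (t, - t) = (cc t + col 2) mod d" by (simp add: Col_def)
  qed
  have less: "Col (t, u) < d" if "t \<noteq> u" for t u
    using K[of "t\<^sup>2 - u\<^sup>2"] K[of "u\<^sup>2 - t\<^sup>2"] in_pairs[of t u] in_pairs[of u t] that d_pos
    by (auto simp: Col_def)
  have count: "card {x\<in>pairs c. Col x = i} = 4 * lam" if i: "i < d" for c i
  proof (cases "c = 0")
    case True
    define k where "k = col 2"
    \<comment> \<open>The solution x < d of x + k = i modulo d.\<close>
    define i' where "i' = (if k \<le> i then i - k else i + d - k)"
    have k: "k < d" by (simp add: k_def col_less)
    have i': "i' < d" using i k by (auto simp: i'_def)
    have iff: "(x + k) mod d = i \<longleftrightarrow> x = i'" if "x < d" for x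
      using that i k by (auto simp: i'_def mod_if)
    have "{x\<in>pairs c. Col x = i} = (\<lambda>t. (t, - t)) ` {t. t \<noteq> 0 \<and> cc t = i'}"
    proof (intro equalityI subsetI)
      fix x assume x: "x \<in> {x\<in>pairs c. Col x = i}"
      obtain t u where tu: "x = (t, u)" by fastforce
      have "t\<^sup>2 = u\<^sup>2" "t \<noteq> u" using x True by (auto simp: tu pairs_def)
      hence "u = - t" "t \<noteq> 0" using sq_eq[of t u] by auto
      thus "x \<in> (\<lambda>t. (t, - t)) ` {t. t \<noteq> 0 \<and> cc t = i'}"
        using x spec(3)[of t] iff[OF cc_less] by (auto simp: tu k_def)
    next
      fix x assume "x \<in> (\<lambda>t. (t, - t)) ` {t. t \<noteq> 0 \<and> cc t = i'}"
      then obtain t where t: "x = (t, - t)" "t \<noteq> 0" "cc t = i'" by blast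
      thus "x \<in> {x\<in>pairs c. Col x = i}"
        using spec(3)[of t] iff[OF cc_less, of t] neg_eq_iff(1)[of t] True by (auto simp: pairs_def k_def)
    qed
    moreover have "inj_on (\<lambda>t. (t, - t)) {t. t \<noteq> 0 \<and> cc t = i'}" by (auto simp: inj_on_def)
    ultimately show ?thesis using card_cc[OF i'] by (simp add: card_image)
  next
    case False
    have swp: "(u, t) \<in> pairs (- c) \<longleftrightarrow> (t, u) \<in> pairs c" for t u
    proof -
      have "u\<^sup>2 - t\<^sup>2 = - (t\<^sup>2 - u\<^sup>2)" by simp
      hence "u\<^sup>2 - t\<^sup>2 = - c \<longleftrightarrow> t\<^sup>2 - u\<^sup>2 = c" by (simp only: neg_equal_iff_equal)
      thus ?thesis by (auto simp only: pairs_def mem_Collect_eq prod.case)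
    qed
    have CK: "Col (t, u) = K (- c) (u, t)" if "(t, u) \<in> pairs c" "c \<notin> H" for t u
    proof -
      have "t\<^sup>2 - u\<^sup>2 = c" "u\<^sup>2 - t\<^sup>2 = - c" using that by (auto simp: pairs_def)
      moreover from this have "t\<^sup>2 \<noteq> u\<^sup>2" using False by auto
      ultimately show ?thesis using that by (simp add: Col_def)
    qed
    show ?thesis
    proof (cases "c \<in> H")
      case True
      have "{x\<in>pairs c. Col x = i} = {x\<in>pairs c. K c x = i}"
        using True False by (auto simp: Col_def pairs_def)
      thus ?thesis using K[OF False] i by simp
    next
      case nH: False
      have "bij_betw prod.swap {x\<in>pairs c. Col x = i} {x\<in>pairs (- c). K (- c) x = i}"
        by (rule bij_betwI[where g = prod.swap]) (use False nH in \<open>auto simp: CK swp\<close>)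
      thus ?thesis using K[of "- c"] False i by (simp add: bij_betw_same_card)
    qed
  qed
  show ?thesis by (intro exI[of _ Col] conjI allI impI swap rot spec less count)
qed

section \<open>Construction of the map \<Phi> orbit by orbit\<close>

lemma xi_pow_4: "\<xi> ^ 4 = 1" and iota_pow_4: "\<iota> ^ 4 = 1"
proof -
  have "\<xi> ^ 4 = (\<xi>\<^sup>2)\<^sup>2" "\<iota> ^ 4 = (\<iota>\<^sup>2)\<^sup>2" by (simp_all flip: power_mult)
  thus "\<xi> ^ 4 = 1" "\<iota> ^ 4 = 1" by (simp_all add: xi iota2)
qed

lemma xi_pow_mod: "\<xi> ^ (k mod 4) = \<xi> ^ k" and iota_pow_mod: "\<iota> ^ (k mod 4) = \<iota> ^ k"
proof -
  have "\<xi> ^ k = (\<xi> ^ 4) ^ (k div 4) * \<xi> ^ (k mod 4)" "\<iota> ^ k = (\<iota> ^ 4) ^ (k div 4) * \<iota> ^ (k mod 4)"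
    by (simp_all flip: power_mult power_add)
  thus "\<xi> ^ (k mod 4) = \<xi> ^ k" "\<iota> ^ (k mod 4) = \<iota> ^ k" by (simp_all add: xi_pow_4 iota_pow_4)
qed

lemma less_4_cases: "k < 4 \<Longrightarrow> k = 0 \<or> k = 1 \<or> k = 2 \<or> k = (3::nat)"
  by auto

lemma xi_ne: "\<xi> \<noteq> 1" "- \<xi> \<noteq> 1"
proof -
  have "x\<^sup>2 \<noteq> -1" if "x = 1" for x :: 'b using that xi(2) by simp
  thus "\<xi> \<noteq> 1" "- \<xi> \<noteq> 1" using xi(1) power2_minus[of \<xi>] by metis+
qed

lemma xi_cube: "\<xi> ^ 3 = - \<xi>" and iota_cube: "\<iota> ^ 3 = - \<iota>"
  using xi_mult(1)[of \<xi>] iota_mult(1)[of \<iota>] by (simp_all add: power3_eq_cube mult.assoc)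

lemma xi_pow_eq_1: "k < 4 \<Longrightarrow> \<xi> ^ k = 1 \<Longrightarrow> k = 0"
proof -
  assume k: "k < 4" "\<xi> ^ k = 1"
  from less_4_cases[OF k(1)] show "k = 0"
    using k(2) xi_ne xi(1) xi(2)[symmetric] xi_cube by (elim disjE) simp_all
qed

lemma xi_pow_inj:
  assumes "\<xi> ^ k = \<xi> ^ l" "k < 4" "l < 4"
  shows "k = l"
proof -
  have main: "k = l" if "\<xi> ^ k = \<xi> ^ l" "k < 4" "l < 4" "k \<le> l" for k l
  proof -
    have "\<xi> ^ k * \<xi> ^ (l - k) = \<xi> ^ l" using that(4) by (simp flip: power_add)
    hence "\<xi> ^ k * \<xi> ^ (l - k) = \<xi> ^ k * 1" using that(1) by simp
    hence "\<xi> ^ (l - k) = 1" using xi_nonzero by simp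
    thus ?thesis using xi_pow_eq_1[of "l - k"] that by (simp add: less_imp_diff_less)
  qed
  show ?thesis using main[of k l] main[of l k] assms by (metis le_cases)
qed

lemma cc_iota_pow: "t \<noteq> 0 \<Longrightarrow> cc (\<iota> ^ k * t) = cc t"
  by (induction k) (auto simp: mult.assoc cc_iota iota_nonzero)

lemma cc_g_pow: "i < n \<Longrightarrow> cc (g ^ i) = C i"
proof -
  assume i: "i < n"
  have "[P.dlog (g ^ i) = i] (mod n)"
    using P.dlog_pow[of i] by (rule cong_dvd_modulus_nat) (simp add: p)
  thus ?thesis using i by (simp add: cc_def cong_def)
qed

lemma iota_g_pow: "\<iota> ^ k * g ^ i = g ^ (n * k + i)"
  by (simp add: \<iota>_def power_add power_mult)

text \<open>The value y_i of \<Phi> at g^i is chosen after all earlier ones: it must lie in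
  prescribed cosets after translation by 0 and by the four rotations of each earlier value. All
  other differences follow by rotation.\<close>

lemma values_exist:
  assumes Q: "real CARD('b) > Q_bound d (4 * n - 3)"
    and Col: "\<And>t u. t \<noteq> u \<Longrightarrow> Col (t, u) < d"
    and N: "N \<le> n"
  shows "\<exists>y. \<forall>i<N. y i \<noteq> 0 \<and> col (y i) = C i \<and>
    (\<forall>j<i. \<forall>k<4. y i \<noteq> \<xi> ^ k * y j \<and> col (y i - \<xi> ^ k * y j) = Col (g ^ i, \<iota> ^ k * g ^ j))"
  using N
proof (induction N)
  case (Suc N)
  then obtain y where y: "\<And>i. i < N \<Longrightarrow> y i \<noteq> 0 \<and> col (y i) = C i \<and>
    (\<forall>j<i. \<forall>k<4. y i \<noteq> \<xi> ^ k * y j \<and> col (y i - \<xi> ^ k * y j) = Col (g ^ i, \<iota> ^ k * g ^ j))"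
    by (metis Suc_leD)
  define I where "I = {..<N} \<times> {..<4::nat}"
  define f where "f = (\<lambda>(j, k). \<xi> ^ k * y j)"
  \<comment> \<open>A coincidence would make the later value a rotation of the earlier one, which
    its choice excluded. The translation points are therefore distinct, and each carries a single
    prescribed coset.\<close>
  have ne: "\<xi> ^ k * y i \<noteq> \<xi> ^ l * y j" if "i < N" "j < i" "k < 4" "l < 4" for i j k l
  proof
    assume "\<xi> ^ k * y i = \<xi> ^ l * y j"
    hence "\<xi> ^ (4 - k) * (\<xi> ^ k * y i) = \<xi> ^ (4 - k) * (\<xi> ^ l * y j)" by simp
    hence "\<xi> ^ 4 * y i = \<xi> ^ (4 - k + l) * y j"
      using that(3) by (simp add: power_add[symmetric] mult.assoc[symmetric])
    hence "y i = \<xi> ^ ((4 - k + l) mod 4) * y j" by (simp add: xi_pow_4 xi_pow_mod)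
    thus False using y[OF that(1)] that(2) by auto
  qed
  have inj: "inj_on f I"
  proof (rule inj_onI)
    fix a b assume ab: "a \<in> I" "b \<in> I" "f a = f b"
    obtain i k where a: "a = (i, k)" by fastforce
    obtain j l where b: "b = (j, l)" by fastforce
    have lt: "i < N" "j < N" "k < 4" "l < 4" using ab by (auto simp: I_def a b)
    have eq: "\<xi> ^ k * y i = \<xi> ^ l * y j" using ab by (simp add: f_def a b)
    have "i = j"
      using ne[of i j k l] ne[of j i l k] eq lt by (metis linorder_neqE_nat)
    moreover have "k = l" using eq y[OF lt(1)] lt xi_pow_inj unfolding \<open>i = j\<close> by simp
    ultimately show "a = b" by (simp add: a b)
  qed
  define B where "B = insert 0 (f ` I)"
  have "card B \<le> Suc (card (f ` I))" unfolding B_def by (rule card_insert_le_m1) auto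
  also have "card (f ` I) \<le> card I" by (rule card_image_le) (simp add: I_def)
  also have "card I = 4 * N" by (simp add: I_def card_cartesian_product)
  \<comment> \<open>At most n - 1 values precede the new one, which gives 4 (n - 1) + 1 points
    including 0.\<close>
  finally have cardB: "card B \<le> 4 * n - 3" using Suc(2) by linarith
  define t where "t = (\<lambda>b. if b = 0 then C N else case the_inv_into I f b of (j, k) \<Rightarrow> Col (g ^ N, \<iota> ^ k * g ^ j))"
  obtain z where z: "\<forall>b\<in>B. z \<noteq> b \<and> [Q.dlog (z - b) = t b] (mod d)"
    using Q.coset_exists_le[OF d_dvd cardB _ Q, of t] n by auto
  have z0: "z \<noteq> 0" "col z = C N"
    using z C(2)[of N] Suc(2) by (auto simp: B_def t_def col_def cong_def)
  have zf: "z \<noteq> \<xi> ^ k * y j \<and> col (z - \<xi> ^ k * y j) = Col (g ^ N, \<iota> ^ k * g ^ j)" if "j < N" "k < 4" for j k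
  proof -
    have jk: "(j, k) \<in> I" using that by (simp add: I_def)
    hence fB: "f (j, k) \<in> B" by (auto simp: B_def)
    have "f (j, k) \<noteq> 0" using y[OF that(1)] xi_nonzero by (simp add: f_def)
    hence t: "t (f (j, k)) = Col (g ^ N, \<iota> ^ k * g ^ j)"
      by (simp add: t_def the_inv_into_f_f[OF inj jk])
    have "g ^ N \<noteq> \<iota> ^ k * g ^ j"
    proof
      assume "g ^ N = \<iota> ^ k * g ^ j"
      hence "[N = n * k + j] (mod 4 * n)" by (simp add: iota_g_pow P.g_pow_eq_iff p)
      moreover have "n * k + j < 4 * n"
      proof -
        have "n * k \<le> n * 3" using that(2) by (intro mult_le_mono2) simp
        thus ?thesis using that Suc(2) by linarith
      qed
      ultimately have "N = n * k + j" using Suc(2) by (simp add: cong_def)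
      thus False using that Suc(2) by (cases k) auto
    qed
    hence "Col (g ^ N, \<iota> ^ k * g ^ j) < d" by (rule Col)
    thus ?thesis using z[rule_format, OF fB] t by (simp add: f_def col_def cong_def)
  qed
  show ?case
  proof (intro exI[of _ "y(N := z)"] allI impI)
    fix i assume "i < Suc N"
    thus "(y(N := z)) i \<noteq> 0 \<and> col ((y(N := z)) i) = C i \<and>
      (\<forall>j<i. \<forall>k<4. (y(N := z)) i \<noteq> \<xi> ^ k * (y(N := z)) j \<and>
        col ((y(N := z)) i - \<xi> ^ k * (y(N := z)) j) = Col (g ^ i, \<iota> ^ k * g ^ j))"
      using y[of i] z0 zf by (cases "i = N") auto
  qed
qed simp

text \<open>Each nonzero t is \<iota>^k g^i with k < 4 and i < n, and \<Phi> takes the value \<xi>^k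
  y_i there. Rotation and swap reduce every pair of nonzero arguments to (g^i, \<iota>^k g^j) with j
  \<le> i; the choice of y_i handles j < i, and the forced cosets handle j = i.\<close>

lemma map_exists:
  assumes Q: "real CARD('b) > Q_bound d (4 * n - 3)"
    and swap: "\<And>t u. t \<noteq> u \<Longrightarrow> Col (u, t) = Col (t, u)"
    and rot: "\<And>t u. t \<noteq> u \<Longrightarrow> Col (\<iota> * t, \<iota> * u) = Col (t, u)"
    and spec: "\<And>t. t \<noteq> 0 \<Longrightarrow> Col (t, 0) = cc t"
      "\<And>t. t \<noteq> 0 \<Longrightarrow> Col (t, \<iota> * t) = (cc t + col (1 - \<xi>)) mod d"
      "\<And>t. t \<noteq> 0 \<Longrightarrow> Col (t, - t) = (cc t + col 2) mod d"
    and less: "\<And>t u. t \<noteq> u \<Longrightarrow> Col (t, u) < d"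
  shows "\<exists>\<Phi>. (\<forall>t. \<Phi> (\<iota> * t) = \<xi> * \<Phi> t) \<and> (\<forall>t u. t \<noteq> u \<longrightarrow> \<Phi> t \<noteq> \<Phi> u \<and> col (\<Phi> t - \<Phi> u) = Col (t, u))"
proof -
  obtain y where y: "\<And>i. i < n \<Longrightarrow> y i \<noteq> 0" "\<And>i. i < n \<Longrightarrow> col (y i) = C i"
    "\<And>i j k. i < n \<Longrightarrow> j < i \<Longrightarrow> k < 4 \<Longrightarrow> y i \<noteq> \<xi> ^ k * y j \<and> col (y i - \<xi> ^ k * y j) = Col (g ^ i, \<iota> ^ k * g ^ j)"
    using values_exist[where Col = Col and N = n, OF Q less order_refl] by blast
  define \<Phi> where "\<Phi> = (\<lambda>t. if t = 0 then 0 else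
    \<xi> ^ (P.dlog t mod (4 * n) div n) * y (P.dlog t mod n))"
  have form: "\<exists>k i. t = \<iota> ^ k * g ^ i \<and> k < 4 \<and> i < n" if "t \<noteq> 0" for t
  proof -
    define D where "D = P.dlog t mod (4 * n)"
    have "[D = P.dlog t] (mod CARD('a) - 1)" by (simp add: D_def p cong_def)
    hence "g ^ D = g ^ P.dlog t" by (simp only: P.g_pow_eq_iff)
    hence "t = g ^ (n * (D div n) + D mod n)" using that by (simp add: P.g_pow_dlog)
    moreover have "D div n < 4" using n(2) by (simp add: D_def less_mult_imp_div_less mult.commute)
    ultimately show ?thesis using n(2) unfolding iota_g_pow by (intro exI[of _ "D div n"] exI[of _ "D mod n"]) auto
  qed
  have Phi: "\<Phi> (\<iota> ^ k * g ^ i) = \<xi> ^ k * y i" if "i < n" for k i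
  proof -
    have cong: "[P.dlog (\<iota> ^ k * g ^ i) = n * k + i] (mod 4 * n)"
      unfolding iota_g_pow using P.dlog_pow[of "n * k + i"] by (simp add: p)
    hence "P.dlog (\<iota> ^ k * g ^ i) mod (4 * n) = (n * k + i) mod (n * 4)" by (simp add: cong_def mult.commute)
    also have "\<dots> = n * (k mod 4) + i"
      using that by (simp add: mod_mult2_eq div_add1_eq)
    finally have "P.dlog (\<iota> ^ k * g ^ i) mod (4 * n) div n = k mod 4" using that by simp
    moreover have "P.dlog (\<iota> ^ k * g ^ i) mod n = i"
      using cong_dvd_modulus_nat[OF cong, of n] that by (simp add: cong_def)
    moreover have "\<iota> ^ k * g ^ i \<noteq> 0" using iota_nonzero P.g_nonzero by simp
    ultimately show ?thesis unfolding \<Phi>_def by (simp only: xi_pow_mod if_False)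
  qed
  have Phi_0: "\<Phi> 0 = 0" by (simp add: \<Phi>_def)
  have equi: "\<Phi> (\<iota> * t) = \<xi> * \<Phi> t" for t
  proof (cases "t = 0")
    case False
    then obtain k i where t: "t = \<iota> ^ k * g ^ i" "i < n" using form by blast
    have "\<iota> * t = \<iota> ^ Suc k * g ^ i" by (simp add: t mult.assoc)
    hence "\<Phi> (\<iota> * t) = \<xi> ^ Suc k * y i" using Phi[OF t(2)] by metis
    thus ?thesis using Phi[OF t(2), of k] by (simp add: t(1) mult.assoc)
  qed (simp add: Phi_0)
  have rots: "Col (\<iota> ^ k * t, \<iota> ^ k * u) = Col (t, u)" if "t \<noteq> u" for k t u
  proof (induction k)
    case (Suc k)
    have "\<iota> ^ k * t \<noteq> \<iota> ^ k * u" using that iota_nonzero by simp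
    thus ?case using rot[of "\<iota> ^ k * t" "\<iota> ^ k * u"] Suc by (simp add: mult.assoc)
  qed simp
  define OK where "OK = (\<lambda>t u. \<Phi> t \<noteq> \<Phi> u \<and> col (\<Phi> t - \<Phi> u) = Col (t, u))"
  have sym: "OK u t" if "OK t u" "t \<noteq> u" for t u
    using that swap[OF that(2)] col_neg[of "\<Phi> t - \<Phi> u"] by (auto simp: OK_def)
  have axis: "OK t 0" if "t \<noteq> 0" for t
  proof -
    obtain k i where t: "t = \<iota> ^ k * g ^ i" "i < n" using form \<open>t \<noteq> 0\<close> by blast
    have "\<Phi> t = \<xi> ^ k * y i" using Phi[OF t(2)] by (simp add: t)
    moreover have "cc t = C i" using t P.g_nonzero by (simp add: cc_iota_pow cc_g_pow)
    ultimately show ?thesis using y[OF t(2)] that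
      by (simp add: OK_def Phi_0 spec col_xi_pow_mult xi_nonzero)
  qed
  have rel: "\<exists>k<4. \<iota> ^ b = \<iota> ^ a * \<iota> ^ k \<and> \<xi> ^ b = \<xi> ^ a * \<xi> ^ k \<and> (a \<noteq> b \<longrightarrow> k \<noteq> 0)" if "a < 4" "b < 4" for a b
  proof (cases "a \<le> b")
    case True
    thus ?thesis using that by (intro exI[of _ "b - a"]) (auto simp flip: power_add)
  next
    case False
    have "\<iota> ^ b = \<iota> ^ 4 * \<iota> ^ b" "\<xi> ^ b = \<xi> ^ 4 * \<xi> ^ b" by (simp_all add: iota_pow_4 xi_pow_4)
    hence "\<iota> ^ b = \<iota> ^ a * \<iota> ^ (4 + b - a)" "\<xi> ^ b = \<xi> ^ a * \<xi> ^ (4 + b - a)"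
      using that by (simp_all flip: power_add)
    thus ?thesis using that False by (intro exI[of _ "4 + b - a"]) auto
  qed
  have lower: "OK t u" if t: "t = \<iota> ^ a * g ^ i" "a < 4" "i < n" and u: "u = \<iota> ^ b * g ^ j" "b < 4" "j < n"
    and ij: "j \<le> i" and ne: "t \<noteq> u" for t u a b i j
  proof -
    obtain k where k: "k < 4" "\<iota> ^ b = \<iota> ^ a * \<iota> ^ k" "\<xi> ^ b = \<xi> ^ a * \<xi> ^ k" "a \<noteq> b \<Longrightarrow> k \<noteq> 0"
      using rel[OF t(2) u(2)] by blast
    have u': "u = \<iota> ^ a * (\<iota> ^ k * g ^ j)" by (simp add: u k(2) mult.assoc)
    hence ne': "g ^ i \<noteq> \<iota> ^ k * g ^ j" using ne by (auto simp: t)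
    have Col: "Col (t, u) = Col (g ^ i, \<iota> ^ k * g ^ j)"
      unfolding u' t by (rule rots[OF ne'])
    have diff: "\<Phi> t - \<Phi> u = \<xi> ^ a * (y i - \<xi> ^ k * y j)"
      using Phi[OF t(3), of a] Phi[OF u(3), of b] by (simp add: t u k(3) algebra_simps)
    have "y i - \<xi> ^ k * y j \<noteq> 0 \<and> col (y i - \<xi> ^ k * y j) = Col (g ^ i, \<iota> ^ k * g ^ j)"
    proof (cases "j < i")
      case True
      thus ?thesis using y(3)[OF t(3) True k(1)] by simp
    next
      case False
      hence ij: "j = i" using ij by simp
      hence "a \<noteq> b" using ne by (auto simp: t u)
      hence k0: "k \<noteq> 0" using k by simp
      have g0: "g ^ i \<noteq> 0" using P.g_nonzero by simp
      have diff': "y i - \<xi> ^ k * y j = (1 - \<xi> ^ k) * y i" by (simp add: ij algebra_simps)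
      have nz: "1 - \<xi> ^ k \<noteq> 0" using xi_pow_eq_1[OF k(1)] k0 by auto
      have "col (y i - \<xi> ^ k * y j) = (C i + col (1 - \<xi> ^ k)) mod d"
        unfolding diff' using col_mult[OF nz y(1)[OF t(3)]] y(2)[OF t(3)] by (simp add: add.commute)
      moreover have "Col (g ^ i, \<iota> ^ k * g ^ i) = (C i + col (1 - \<xi> ^ k)) mod d"
      proof -
        consider "k = 1" | "k = 2" | "k = 3" using less_4_cases[OF k(1)] k0 by blast
        thus ?thesis
        proof cases
          case 1
          thus ?thesis using spec(2)[OF g0] cc_g_pow[OF t(3)] by simp
        next
          case 2
          thus ?thesis using spec(3)[OF g0] cc_g_pow[OF t(3)] by (simp add: iota2 xi)
        next
          \<comment> \<open>Rotating and swapping reduces \<iota>^3 to \<iota>; correspondingly 1 -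
            \<xi>^3 = \<xi> (1 - \<xi>) lies in the coset of 1 - \<xi>.\<close>
          case 3
          have ne: "g ^ i \<noteq> \<iota> * g ^ i" using g0 iota2 one_ne by auto
          have "Col (g ^ i, \<iota> ^ 3 * g ^ i) = Col (\<iota> * g ^ i, \<iota> * (\<iota> ^ 3 * g ^ i))"
            using rot[of "g ^ i" "\<iota> ^ 3 * g ^ i"] ne' ij 3 by simp
          also have "\<iota> * (\<iota> ^ 3 * g ^ i) = g ^ i" using iota_pow_4 by (simp add: iota_cube iota_mult)
          also have "Col (\<iota> * g ^ i, g ^ i) = (C i + col (1 - \<xi>)) mod d"
            using swap[OF ne] spec(2)[OF g0] cc_g_pow[OF t(3)] by simp
          also have "col (1 - \<xi>) = col (\<xi> * (1 - \<xi>))" using xi_ne by (simp add: col_xi_mult)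
          also have "\<xi> * (1 - \<xi>) = 1 - \<xi> ^ 3" by (simp add: algebra_simps xi_mult xi_cube)
          finally show ?thesis using 3 by simp
        qed
      qed
      ultimately show ?thesis using nz y(1)[OF t(3)] by (simp add: ij diff')
    qed
    thus ?thesis unfolding OK_def using diff Col by (simp add: col_xi_pow_mult xi_nonzero) (metis diff eq_iff_diff_eq_0 mult_eq_0_iff power_not_zero xi_nonzero)
  qed
  have "OK t u" if ne: "t \<noteq> u" for t u
  proof (cases "t = 0 \<or> u = 0")
    case True
    thus ?thesis using axis[of t] axis[of u] sym[of u 0] ne by auto
  next
    case False
    obtain a i where t: "t = \<iota> ^ a * g ^ i" "a < 4" "i < n" using form False by blast
    obtain b j where u: "u = \<iota> ^ b * g ^ j" "b < 4" "j < n" using form False by blast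
    show ?thesis
    proof (cases "j \<le> i")
      case True
      thus ?thesis using lower[OF t u _ ne] by simp
    next
      case j: False
      hence "OK u t" using lower[OF u t] ne by simp
      thus ?thesis using sym[of u t] ne by simp
    qed
  qed
  thus ?thesis using equi unfolding OK_def by (intro exI[of _ \<Phi>]) auto
qed

section \<open>The multipliers s and the count of differences\<close>

definition w :: nat where "w = (CARD('b) - 1) div (4 * d)"

text \<open>One representative for each coset of the group generated by \<xi> in the group of
  nonzero d-th powers: the latter is cyclic of order 4 w with generator h^d, and h^(d w) generates
  the former.\<close>

definition S :: "'b set" where "S = (\<lambda>i. h ^ (d * i)) ` {..<w}"

lemma card_b: "CARD('b) - 1 = 4 * d * w"
  using q by (simp add: w_def)

lemma S_nonzero: "s \<in> S \<Longrightarrow> s \<noteq> 0"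
  using Q.g_nonzero by (auto simp: S_def)

lemma col_h_pow: "col (h ^ (d * i)) = 0"
proof -
  have "[Q.dlog (h ^ (d * i)) = d * i] (mod d)"
    using Q.dlog_pow[of "d * i"] d_dvd by (rule cong_dvd_modulus_nat)
  thus ?thesis by (simp add: col_def cong_def)
qed

text \<open>Fourth powers remove \<xi>^k and are distinct on the h^(d i) with i < w; surjectivity
  follows by counting, as there are at most 4 w nonzero d-th powers.\<close>

lemma bij_transversal: "bij_betw (\<lambda>(k, s). \<xi> ^ k * s) ({..<4} \<times> S) {z. z \<noteq> 0 \<and> col z = 0}"
proof -
  have inj: "inj_on (\<lambda>(k, s). \<xi> ^ k * s) ({..<4} \<times> S)"
  proof (rule inj_onI)
    fix a b assume ab: "a \<in> {..<4} \<times> S" "b \<in> {..<4} \<times> S"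
      "(case a of (k, s) \<Rightarrow> \<xi> ^ k * s) = (case b of (k, s) \<Rightarrow> \<xi> ^ k * s)"
    obtain k i where a: "a = (k, h ^ (d * i))" "k < 4" "i < w" using ab(1) by (auto simp: S_def)
    obtain l j where b: "b = (l, h ^ (d * j))" "l < 4" "j < w" using ab(2) by (auto simp: S_def)
    have eq: "\<xi> ^ k * h ^ (d * i) = \<xi> ^ l * h ^ (d * j)" using ab(3) by (simp add: a b)
    have p4: "(\<xi> ^ m * x) ^ 4 = x ^ 4" for m x
      by (simp add: power_mult_distrib mult.commute[of m] xi_pow_4 power_mult flip: power_mult[of \<xi> m])
    have "(h ^ (d * i)) ^ 4 = (h ^ (d * j)) ^ 4"
      using arg_cong[OF eq, of "\<lambda>x. x ^ 4"] by (simp only: p4)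
    hence "[d * i * 4 = d * j * 4] (mod CARD('b) - 1)" by (simp only: Q.g_pow_eq_iff flip: power_mult)
    moreover have "d * i * 4 < CARD('b) - 1" "d * j * 4 < CARD('b) - 1"
    proof -
      have "4 * d * i < 4 * d * w" "4 * d * j < 4 * d * w" using a(3) b(3) d_pos by simp_all
      moreover have "d * i * 4 = 4 * d * i" "d * j * 4 = 4 * d * j" by simp_all
      ultimately show "d * i * 4 < CARD('b) - 1" "d * j * 4 < CARD('b) - 1" unfolding card_b by simp_all
    qed
    ultimately have "d * i * 4 = d * j * 4" by (simp add: cong_def)
    hence ij: "i = j" using d_pos by simp
    hence "\<xi> ^ k = \<xi> ^ l" using eq Q.g_nonzero by simp
    hence "k = l" using xi_pow_inj a b by blast
    thus "a = b" using ij by (simp add: a b)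
  qed
  have sub: "(\<lambda>(k, s). \<xi> ^ k * s) ` ({..<4} \<times> S) \<subseteq> {z. z \<noteq> 0 \<and> col z = 0}"
    using xi_nonzero Q.g_nonzero by (auto simp: S_def col_xi_pow_mult col_h_pow)
  have "inj_on (\<lambda>i. h ^ (d * i)) {..<w}"
  proof (rule inj_onI)
    fix i j assume ij: "i \<in> {..<w}" "j \<in> {..<w}" "h ^ (d * i) = h ^ (d * j)"
    have "d * i < d * w" "d * j < d * w" using ij d_pos by simp_all
    hence "d * i < 4 * d * w" "d * j < 4 * d * w" by linarith+
    moreover have "[d * i = d * j] (mod 4 * d * w)" using ij(3) unfolding Q.g_pow_eq_iff card_b .
    ultimately have "d * i = d * j" unfolding cong_def by (simp only: mod_less)
    thus "i = j" using d_pos by simp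
  qed
  hence cS: "card S = w" by (simp add: S_def card_image)
  have "{z. z \<noteq> 0 \<and> col z = 0} \<subseteq> (\<lambda>j. h ^ (d * j)) ` {..<4 * w}"
  proof
    fix z assume z: "z \<in> {z. z \<noteq> 0 \<and> col z = 0}"
    define D where "D = Q.dlog z mod (CARD('b) - 1)"
    have "[D = Q.dlog z] (mod CARD('b) - 1)" by (simp add: D_def cong_def)
    hence "h ^ D = h ^ Q.dlog z" by (simp only: Q.g_pow_eq_iff)
    hence hD: "h ^ D = z" using z by (simp add: Q.g_pow_dlog)
    have "d dvd D" unfolding D_def using z d_dvd by (simp add: col_eq_0_iff dvd_mod_iff)
    then obtain j where j: "D = d * j" by blast
    have "D < 4 * d * w" using Q.card_gt_1 unfolding D_def card_b[symmetric] by (intro mod_less_divisor) simp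
    hence "j < 4 * w" using d_pos by (simp add: j)
    thus "z \<in> (\<lambda>j. h ^ (d * j)) ` {..<4 * w}" using hD j by blast
  qed
  hence "card {z. z \<noteq> 0 \<and> col z = 0} \<le> 4 * w"
    using card_mono[of "(\<lambda>j. h ^ (d * j)) ` {..<4 * w}"] card_image_le[of "{..<4 * w}" "\<lambda>j. h ^ (d * j)"]
    by (metis (no_types, lifting) card_lessThan finite_imageI finite_lessThan order_trans)
  moreover have "card ((\<lambda>(k, s). \<xi> ^ k * s) ` ({..<4} \<times> S)) = 4 * w"
    by (simp add: card_image[OF inj] card_cartesian_product cS)
  ultimately have "(\<lambda>(k, s). \<xi> ^ k * s) ` ({..<4} \<times> S) = {z. z \<noteq> 0 \<and> col z = 0}"
    using sub by (intro card_seteq) auto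
  thus ?thesis using inj by (simp add: bij_betw_def)
qed

text \<open>The number of pairs with value difference z is invariant under z -> \<xi> z, since
  \<tau> multiplies by -\<xi> and (-\<xi>)^3 = \<xi>. The sum over \<open>S\<close> is thus a
  quarter of the sum over all nonzero d-th powers, and that one counts the \<open>4 * lam\<close>
  pairs in the coset of b.\<close>

lemma difference_count:
  assumes equi: "\<And>t. \<Phi> (\<iota> * t) = \<xi> * \<Phi> t"
    and col: "\<And>t u. t \<noteq> u \<Longrightarrow> \<Phi> t \<noteq> \<Phi> u \<and> col (\<Phi> t - \<Phi> u) = Col (t, u)"
    and count: "\<And>c i. i < d \<Longrightarrow> card {x\<in>pairs c. Col x = i} = 4 * lam"
    and b: "b \<noteq> 0"
  shows "(\<Sum>s\<in>S. card {(t, u). (t, u) \<in> pairs c \<and> s * (\<Phi> t - \<Phi> u) = b}) = lam"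
proof -
  define v where "v = (\<lambda>x. \<Phi> (fst x) - \<Phi> (snd x))"
  define M where "M = (\<lambda>z. card {x\<in>pairs c. v x = z})"
  have v: "v x \<noteq> 0" "col (v x) = Col x" if "x \<in> pairs c" for x
    using col[of "fst x" "snd x"] that by (auto simp: v_def pairs_def)
  have v_tau: "v (\<tau> x) = - \<xi> * v x" for x
    by (cases x) (simp add: v_def \<tau>_def equi, simp add: algebra_simps)
  have M1: "M (- \<xi> * z) = M z" for z
  proof -
    have "bij_betw \<tau> {x\<in>pairs c. v x = z} {x\<in>pairs c. v x = - \<xi> * z}"
    proof (rule bij_betwI[where g = "\<lambda>x. \<tau> (\<tau> (\<tau> x))"])
      show "(\<lambda>x. \<tau> (\<tau> (\<tau> x))) \<in> {x\<in>pairs c. v x = - \<xi> * z} \<rightarrow> {x\<in>pairs c. v x = z}"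
        using tau_pairs by (auto simp: v_tau xi_mult)
    qed (use tau_pairs in \<open>auto simp: v_tau tau4\<close>)
    hence "card {x\<in>pairs c. v x = z} = card {x\<in>pairs c. v x = - \<xi> * z}" by (rule bij_betw_same_card)
    thus ?thesis by (simp only: M_def)
  qed
  have Mx: "M (\<xi> * z) = M z" for z
  proof -
    have "M z = M (- \<xi> * (- \<xi> * (- \<xi> * z)))" by (simp only: M1)
    also have "- \<xi> * (- \<xi> * (- \<xi> * z)) = \<xi> * z" by (simp add: xi_mult)
    finally show ?thesis by simp
  qed
  have Mk: "M (z / \<xi> ^ k) = M z" for z k
  proof (induction k)
    case (Suc k)
    have "z / \<xi> ^ k = \<xi> * (z / \<xi> ^ Suc k)" using xi_nonzero by simp
    thus ?case using Mx[of "z / \<xi> ^ Suc k"] Suc by simp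
  qed simp
  define Z where "Z = {z. z \<noteq> 0 \<and> col z = 0}"
  have "4 * lam = card {x\<in>pairs c. Col x = col b}" using count[OF col_less] by simp
  also have "{x\<in>pairs c. Col x = col b} = {x\<in>pairs c. b / v x \<in> Z}"
  proof -
    have "Col x = col b \<longleftrightarrow> b / v x \<in> Z" if x: "x \<in> pairs c" for x
    proof -
      have nz: "b / v x \<noteq> 0" using v(1)[OF x] b by simp
      have "b = b / v x * v x" using v(1)[OF x] by simp
      hence cb: "col b = (col (b / v x) + col (v x)) mod d" using col_mult[OF nz v(1)[OF x]] by metis
      have "col (v x) = (col (b / v x) + col (v x)) mod d \<longleftrightarrow> col (b / v x) = 0"
        using col_less[of "v x"] col_less[of "b / v x"] by (auto simp: mod_if)
      thus ?thesis using nz v(2)[OF x] cb by (auto simp: Z_def)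
    qed
    thus ?thesis by auto
  qed
  also have "card {x\<in>pairs c. b / v x \<in> Z} = (\<Sum>z\<in>Z. card {x\<in>pairs c. b / v x = z})"
  proof -
    have "{x\<in>pairs c. b / v x \<in> Z} = (\<Union>z\<in>Z. {x\<in>pairs c. b / v x = z})" by auto
    thus ?thesis by (simp only:) (rule card_UN_disjoint, auto)
  qed
  also have "\<dots> = (\<Sum>z\<in>Z. M (b / z))"
  proof (intro sum.cong refl)
    fix z assume "z \<in> Z"
    hence "{x\<in>pairs c. b / v x = z} = {x\<in>pairs c. v x = b / z}"
      using v(1) by (auto simp: Z_def field_simps)
    thus "card {x\<in>pairs c. b / v x = z} = M (b / z)" by (simp add: M_def)
  qed
  also have "\<dots> = (\<Sum>(k, s)\<in>{..<4} \<times> S. M (b / (\<xi> ^ k * s)))"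
    using sum.reindex_bij_betw[OF bij_transversal, of "\<lambda>z. M (b / z)"] by (simp add: Z_def split_def)
  also have "\<dots> = (\<Sum>(k, s)\<in>{..<4::nat} \<times> S. M (b / s))"
  proof (intro sum.cong refl, clarify)
    fix k s
    have "b / (\<xi> ^ k * s) = b / s / \<xi> ^ k" by (simp add: field_simps)
    thus "M (b / (\<xi> ^ k * s)) = M (b / s)" by (simp only: Mk)
  qed
  also have "\<dots> = 4 * (\<Sum>s\<in>S. M (b / s))"
    by (simp flip: sum.cartesian_product)
  finally have "lam = (\<Sum>s\<in>S. M (b / s))" by simp
  also have "\<dots> = (\<Sum>s\<in>S. card {(t, u). (t, u) \<in> pairs c \<and> s * (\<Phi> t - \<Phi> u) = b})"
  proof (intro sum.cong refl)
    fix s assume "s \<in> S"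
    hence "s \<noteq> 0" by (rule S_nonzero)
    hence "{x\<in>pairs c. v x = b / s} = {(t, u). (t, u) \<in> pairs c \<and> s * (\<Phi> t - \<Phi> u) = b}"
      by (auto simp: v_def field_simps)
    thus "M (b / s) = card {(t, u). (t, u) \<in> pairs c \<and> s * (\<Phi> t - \<Phi> u) = b}" by (simp add: M_def)
  qed
  finally show ?thesis by simp
qed

theorem difference_family_exists:
  assumes Q: "real CARD('b) > Q_bound d (4 * n - 3)"
  shows "\<exists>Bs. relative_difference_family (UNIV :: ('a \<times> 'b) set) (UNIV \<times> {0}) (4 * n + 1) lam Bs"
proof -
  obtain Col where Col: "\<forall>t u. t \<noteq> u \<longrightarrow> Col (u, t) = Col (t, u) \<and> Col (\<iota> * t, \<iota> * u) = Col (t, u)"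
    "\<forall>t. t \<noteq> 0 \<longrightarrow> Col (t, 0) = cc t \<and> Col (t, \<iota> * t) = (cc t + col (1 - \<xi>)) mod d \<and>
      Col (t, - t) = (cc t + col 2) mod d"
    "\<forall>t u. t \<noteq> u \<longrightarrow> Col (t, u) < d"
    "\<forall>c i. i < d \<longrightarrow> card {x\<in>pairs c. Col x = i} = 4 * lam"
    using total_colouring by (elim exE conjE)
  have "\<exists>\<Phi>. (\<forall>t. \<Phi> (\<iota> * t) = \<xi> * \<Phi> t) \<and> (\<forall>t u. t \<noteq> u \<longrightarrow> \<Phi> t \<noteq> \<Phi> u \<and> col (\<Phi> t - \<Phi> u) = Col (t, u))"
    by (rule map_exists[OF Q]) (use Col(1-3) in blast)+
  then obtain \<Phi> where equi: "\<And>t. \<Phi> (\<iota> * t) = \<xi> * \<Phi> t"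
    and Phi: "\<And>t u. t \<noteq> u \<Longrightarrow> \<Phi> t \<noteq> \<Phi> u \<and> col (\<Phi> t - \<Phi> u) = Col (t, u)" by blast
  define blk where "blk = (\<lambda>s t. (t\<^sup>2, s * \<Phi> t))"
  define Bs where "Bs = image_mset (\<lambda>s. range (blk s)) (mset_set S)"
  have finS: "finite S" by simp
  \<comment> \<open>Although squaring is not injective, \<Phi> is, so each block has p elements and
    its differences correspond to the pairs (t, u) with t \<noteq> u.\<close>
  have inj: "inj (blk s)" if "s \<in> S" for s
    using Phi S_nonzero[OF that] unfolding blk_def inj_def by auto
  have cnt: "count (\<Sum>B\<in>#Bs. differences B) (c, b) = (\<Sum>s\<in>S. card {(t, u). (t, u) \<in> pairs c \<and> s * (\<Phi> t - \<Phi> u) = b})" for c b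
  proof -
    have "(\<Sum>B\<in>#Bs. differences B) = (\<Sum>s\<in>S. differences (range (blk s)))"
      by (simp add: Bs_def sum_unfold_sum_mset image_mset.compositionality o_def)
    hence "count (\<Sum>B\<in>#Bs. differences B) (c, b) = (\<Sum>s\<in>S. count (differences (range (blk s))) (c, b))"
      by (simp add: count_sum)
    also have "\<dots> = (\<Sum>s\<in>S. card {(t, u). (t, u) \<in> pairs c \<and> s * (\<Phi> t - \<Phi> u) = b})"
    proof (intro sum.cong refl)
      fix s assume s: "s \<in> S"
      have "{(y, z). y \<in> range (blk s) \<and> z \<in> range (blk s) \<and> y \<noteq> z \<and> y - z = (c, b)} =
          (\<lambda>(t, u). (blk s t, blk s u)) ` {(t, u). (t, u) \<in> pairs c \<and> s * (\<Phi> t - \<Phi> u) = b}"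
      proof (intro equalityI subsetI)
        fix x assume "x \<in> {(y, z). y \<in> range (blk s) \<and> z \<in> range (blk s) \<and> y \<noteq> z \<and> y - z = (c, b)}"
        then obtain y z where yz: "x = (y, z)" "y \<in> range (blk s)" "z \<in> range (blk s)" "y \<noteq> z" "y - z = (c, b)"
          by blast
        then obtain t u where "y = blk s t" "z = blk s u" by blast
        hence x: "x = (blk s t, blk s u)" "blk s t \<noteq> blk s u" "blk s t - blk s u = (c, b)" using yz by simp_all
        hence "(t, u) \<in> pairs c" "s * (\<Phi> t - \<Phi> u) = b" by (auto simp: blk_def pairs_def right_diff_distrib)
        thus "x \<in> (\<lambda>(t, u). (blk s t, blk s u)) ` {(t, u). (t, u) \<in> pairs c \<and> s * (\<Phi> t - \<Phi> u) = b}"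
          using x(1) by auto
      next
        fix x assume "x \<in> (\<lambda>(t, u). (blk s t, blk s u)) ` {(t, u). (t, u) \<in> pairs c \<and> s * (\<Phi> t - \<Phi> u) = b}"
        then obtain t u where x: "x = (blk s t, blk s u)" "(t, u) \<in> pairs c" "s * (\<Phi> t - \<Phi> u) = b" by auto
        have "t \<noteq> u" using x(2) by (simp add: pairs_def)
        hence "blk s t \<noteq> blk s u" using inj[OF s] by (meson injD)
        moreover have "blk s t - blk s u = (c, b)"
          using x(2,3) by (simp add: blk_def pairs_def right_diff_distrib)
        ultimately show "x \<in> {(y, z). y \<in> range (blk s) \<and> z \<in> range (blk s) \<and> y \<noteq> z \<and> y - z = (c, b)}"
          using x(1) by simp
      qed
      moreover have "inj_on (\<lambda>(t, u). (blk s t, blk s u)) {(t, u). (t, u) \<in> pairs c \<and> s * (\<Phi> t - \<Phi> u) = b}"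
        using inj[OF s] by (auto simp: inj_on_def)
      ultimately show "count (differences (range (blk s))) (c, b) = card {(t, u). (t, u) \<in> pairs c \<and> s * (\<Phi> t - \<Phi> u) = b}"
        by (simp add: count_differences card_image)
    qed
    finally show ?thesis .
  qed
  have "relative_difference_family (UNIV :: ('a \<times> 'b) set) (UNIV \<times> {0}) (4 * n + 1) lam Bs"
    unfolding relative_difference_family_def
  proof (intro conjI ballI)
    show "card B = 4 * n + 1" if "B \<in># Bs" for B
    proof -
      obtain s where "s \<in> S" "B = range (blk s)" using \<open>B \<in># Bs\<close> finS by (auto simp: Bs_def)
      thus ?thesis using inj p by (simp add: card_image)
    qed
    show "count (\<Sum>B\<in>#Bs. differences B) x = lam" if x: "x \<in> UNIV - UNIV \<times> {0}" for x
    proof -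
      obtain c b where cb: "x = (c, b)" "b \<noteq> 0" using x by (cases x) auto
      show ?thesis unfolding cb(1) cnt
        by (rule difference_count[OF equi Phi _ cb(2)]) (use Col(4) in auto)
    qed
    show "count (\<Sum>B\<in>#Bs. differences B) x = 0" if x: "x \<in> UNIV \<times> {0}" for x
    proof -
      obtain c where c: "x = (c, 0)" using x by (cases x) auto
      have "{(t, u). (t, u) \<in> pairs c \<and> s * (\<Phi> t - \<Phi> u) = 0} = {}" if "s \<in> S" for s
        using Phi S_nonzero[OF that] by (auto simp: pairs_def)
      thus ?thesis unfolding c cnt by (intro sum.neutral ballI) simp
    qed
  qed (auto simp: add_subgroup_def zero_prod_def)
  thus ?thesis by blast
qed

end

section \<open>Choice of the cosets of the values and assembly of the theorem\<close>

text \<open>For \<open>lam = 1\<close> the classes are singletons, so \<open>C\<close> must be a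
  bijection. If r is a square root of 2, then t^2 = 2 u^2 makes the logarithms of t and u differ by
  that of r modulo n, the sign -1 = g^(2 n) being invisible there; this is the situation of
  \<open>bij_avoiding_translation\<close>.\<close>

lemma avoiding_colouring_exists:
  fixes g :: "'a::{field,finite}" and lam d n \<kappa> :: nat
  assumes "generated_field g" and p: "CARD('a) = 4 * n + 1" and n: "n = d * lam" "n > 0"
    and char: "lam = 1 \<Longrightarrow> CHAR('a) = 3 \<Longrightarrow> \<not> d dvd \<kappa>"
  shows "\<exists>C. (\<forall>i<d. card {j\<in>{..<n}. C j = i} = lam) \<and> (\<forall>j<n. C j < d) \<and>
    (\<forall>t u. lam = 1 \<longrightarrow> t \<noteq> 0 \<longrightarrow> u \<noteq> 0 \<longrightarrow> t\<^sup>2 = 2 * u\<^sup>2 \<longrightarrow>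
      C (generated_field.dlog g t mod n) \<noteq> (C (generated_field.dlog g u mod n) + \<kappa>) mod d)"
proof (cases "lam = 1")
  case False
  have "d > 0" using n by simp
  thus ?thesis using False n card_residue_class[of _ d lam] by (intro exI[of _ "\<lambda>j. j mod d"]) auto
next
  case lam: True
  hence nd: "n = d" using n by simp
  interpret generated_field g by fact
  have bal: "card {j\<in>{..<n}. C j = i} = 1" if "bij_betw C {..<n} {..<n}" "i < n" for C :: "nat \<Rightarrow> nat" and i
  proof -
    have inj: "inj_on C {..<n}" and "i \<in> C ` {..<n}" using that by (simp_all add: bij_betw_def)
    then obtain j where j: "j < n" "C j = i" by auto
    have "{j\<in>{..<n}. C j = i} = {j}"
    proof (intro equalityI subsetI)
      fix l assume "l \<in> {j\<in>{..<n}. C j = i}"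
      thus "l \<in> {j}" using inj_onD[OF inj, of l j] j by simp
    qed (use j in simp)
    thus ?thesis by simp
  qed
  have lt: "C j < n" if "bij_betw C {..<n} {..<n}" "j < n" for C :: "nat \<Rightarrow> nat" and j
    using that unfolding bij_betw_def by auto
  show ?thesis
  proof (cases "\<exists>r::'a. r\<^sup>2 = 2 \<and> r \<noteq> 0")
    case False
    have "t\<^sup>2 \<noteq> 2 * u\<^sup>2" if "t \<noteq> 0" "u \<noteq> 0" for t u :: 'a
    proof
      assume "t\<^sup>2 = 2 * u\<^sup>2"
      hence "(t / u)\<^sup>2 = 2" using that by (simp add: power_divide)
      thus False using False that by auto
    qed
    thus ?thesis using bal[of id] lam nd by (intro exI[of _ id]) auto
  next
    case True
    then obtain r :: 'a where r: "r\<^sup>2 = 2" "r \<noteq> 0" by blast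
    define s where "s = dlog r mod n"
    have g2n: "g ^ (2 * n) = -1" and ne1: "(1::'a) \<noteq> -1"
    proof -
      have "g ^ (4 * n) = 1" by (simp add: g_pow_eq_1_iff p)
      hence "(g ^ (2 * n))\<^sup>2 = 1" by (simp flip: power_mult)
      moreover have ne: "g ^ (2 * n) \<noteq> 1" using n(2) by (auto simp: g_pow_eq_1_iff p dest: dvd_imp_le)
      ultimately show "g ^ (2 * n) = -1" using power2_eq_1_iff by blast
      thus "(1::'a) \<noteq> -1" using ne by metis
    qed
    have dlog_r: "dlog t mod n = (dlog u mod n + s) mod n" if "t \<noteq> 0" "u \<noteq> 0" "t\<^sup>2 = 2 * u\<^sup>2" for t u
    proof -
      have "t\<^sup>2 = (r * u)\<^sup>2" using that r by (simp add: power_mult_distrib)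
      hence "t = r * u \<or> t = g ^ (2 * n) * (r * u)" by (auto simp: power2_eq_iff g2n)
      hence "\<exists>e. t = g ^ (n * e + (dlog r + dlog u))"
      proof
        assume "t = r * u"
        thus ?thesis using r that by (intro exI[of _ 0]) (simp add: power_add g_pow_dlog)
      next
        assume "t = g ^ (2 * n) * (r * u)"
        thus ?thesis using r that by (intro exI[of _ 2]) (simp add: power_add g_pow_dlog mult.commute)
      qed
      then obtain e where e: "t = g ^ (n * e + (dlog r + dlog u))" by blast
      have "[dlog t = n * e + (dlog r + dlog u)] (mod n)"
        using dlog_pow[of "n * e + (dlog r + dlog u)"] unfolding e[symmetric]
        by (rule cong_dvd_modulus_nat) (simp add: p)
      thus ?thesis by (simp add: s_def cong_def mod_simps add.commute)
    qed
    have special: "CHAR('a) = 3 \<and> s = 0" if "(2::'a) = -1"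
    proof
      have "(3::'a) = 2 + 1" by simp
      hence "of_nat 3 = (0::'a)" using that by simp
      hence "CHAR('a) dvd 3" using of_nat_eq_0_iff_char_dvd by blast
      moreover have "CHAR('a) \<noteq> 1" by simp
      moreover have "prime (3::nat)" by simp
      ultimately show "CHAR('a) = 3" using prime_nat_iff by blast
      have "g ^ (dlog r * 2) = r\<^sup>2" using r by (simp add: power_mult g_pow_dlog)
      also have "\<dots> = g ^ (2 * n)" unfolding g2n using r(1) that by (rule trans)
      finally have "g ^ (dlog r * 2) = g ^ (2 * n)" .
      hence "[dlog r * 2 = 2 * n] (mod 4 * n)" by (simp add: g_pow_eq_iff p)
      hence "[2 * dlog r = 2 * n] (mod 2 * (2 * n))" by (simp add: mult.commute mult.left_commute)
      hence "2 * (dlog r mod (2 * n)) = 2 * (n mod (2 * n))" by (simp only: cong_def mult_mod_right)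
      hence "[dlog r = n] (mod 2 * n)" unfolding cong_def by simp
      hence "[dlog r = n] (mod n)" by (rule cong_dvd_modulus_nat) simp
      thus "s = 0" by (simp add: s_def cong_def)
    qed
    \<comment> \<open>If s = 0, then r is a fourth root of unity and 2 = r^2 is 1 or -1, hence -1.
      This is characteristic 3, where the hypothesis on \<kappa> takes over.\<close>
    have s0: "(2::'a) = -1" if "s = 0"
    proof -
      have "n dvd dlog r" using that by (simp add: s_def mod_eq_0_iff_dvd)
      then obtain e where e: "dlog r = n * e" by blast
      have "2 = (g ^ (n * e))\<^sup>2" using r g_pow_dlog[OF r(2)] by (simp flip: e)
      also have "\<dots> = (g ^ (2 * n)) ^ e" by (simp add: mult_ac flip: power_mult)
      also have "\<dots> = 1 \<or> \<dots> = (-1::'a)" by (cases "even e") (simp_all add: g2n)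
      finally have "(2::'a) = 1 \<or> (2::'a) = -1" .
      moreover have "(2::'a) \<noteq> 1" by (metis add_cancel_left_left one_add_one zero_neq_one)
      ultimately show ?thesis by simp
    qed
    have cond: "if s = 0 then \<kappa> mod n \<noteq> 0 else n \<ge> 3"
    proof (cases "s = 0")
      case True
      hence "\<not> d dvd \<kappa>" using char lam special s0 by blast
      thus ?thesis using True nd by (simp add: mod_eq_0_iff_dvd)
    next
      case False
      have "n \<noteq> 1" using False by (auto simp: s_def)
      \<comment> \<open>For n = 2 the field has 9 elements, so the characteristic is 3 and s would
        be 0.\<close>
      moreover have "n \<noteq> 2"
      proof
        assume n2: "n = 2"
        have "CHAR('a) dvd 3 ^ 2" using CHAR_dvd_CARD[where ?'a = 'a] p n2 by simp
        moreover have "prime CHAR('a)"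
          using prime_CHAR_semidom[where ?'a = 'a] finite_imp_CHAR_pos[where ?'a = 'a] by simp
        ultimately have "CHAR('a) dvd 3" using prime_dvd_power_nat by blast
        hence "of_nat 3 = (0::'a)" using of_nat_eq_0_iff_char_dvd by blast
        hence "(2::'a) + 1 = 0" by simp
        hence "(2::'a) = -1" by (simp only: eq_neg_iff_add_eq_0)
        thus False using special False by blast
      qed
      ultimately show ?thesis using False n(2) by simp
    qed
    obtain C where C: "bij_betw C {..<n} {..<n}" "\<forall>i<n. C ((i + s) mod n) \<noteq> (C i + \<kappa> mod n) mod n"
      using bij_avoiding_translation[OF n(2) _ _ cond] n(2) by (auto simp: s_def)
    have "C (dlog t mod n) \<noteq> (C (dlog u mod n) + \<kappa>) mod d" if "t \<noteq> 0" "u \<noteq> 0" "t\<^sup>2 = 2 * u\<^sup>2" for t u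
      using C(2)[rule_format, of "dlog u mod n"] n(2) unfolding dlog_r[OF that] nd[symmetric]
      by (simp add: mod_simps)
    thus ?thesis using C(1) bal[OF C(1)] lt[OF C(1)] lam nd by (intro exI[of _ C]) auto
  qed
qed

text \<open>Both parts of the result are instances of this form; they differ in where \<xi> comes
  from and in how the condition on 1 - \<xi> is met.\<close>

lemma difference_family_from_fourth_root:
  fixes lam d n :: nat and \<xi> :: "'b::{field,finite}"
  assumes p: "CARD('a::{field,finite}) = 4 * n + 1" and n: "n = d * lam" "n > 0"
    and q: "4 * d dvd CARD('b) - 1" and Q: "real CARD('b) > Q_bound d (4 * n - 3)"
    and xi: "\<xi>\<^sup>2 = -1" "(1::'b) \<noteq> -1"
    and char: "lam = 1 \<Longrightarrow> CHAR('a) = 3 \<Longrightarrow> 1 - \<xi> \<notin> nonzero_powers d"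
  shows "\<exists>Bs. relative_difference_family (UNIV :: ('a \<times> 'b) set) (UNIV \<times> {0}) (4 * n + 1) lam Bs"
proof -
  obtain g :: 'a where g: "generated_field g"
    using finite_field_generator[where ?'k = 'a] unfolding generated_field_def by blast
  obtain h :: 'b where h: "generated_field h"
    using finite_field_generator[where ?'k = 'b] unfolding generated_field_def by blast
  interpret P: generated_field g by (rule g)
  interpret Q: generated_field h by (rule h)
  have "1 - \<xi> \<noteq> 0" using xi by auto
  have ndvd: "\<not> d dvd Q.dlog (1 - \<xi>)" if "lam = 1" "CHAR('a) = 3"
  proof
    assume "d dvd Q.dlog (1 - \<xi>)"
    then obtain m where "Q.dlog (1 - \<xi>) = d * m" by blast
    hence "1 - \<xi> = (h ^ m) ^ d" using Q.g_pow_dlog[OF \<open>1 - \<xi> \<noteq> 0\<close>] by (metis mult.commute power_mult)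
    moreover have "h ^ m \<noteq> 0" using Q.g_nonzero by simp
    ultimately have "1 - \<xi> \<in> nonzero_powers d" unfolding nonzero_powers_def by blast
    thus False using char that by blast
  qed
  obtain C where C: "\<forall>i<d. card {j\<in>{..<n}. C j = i} = lam" "\<forall>j<n. C j < d"
    "\<forall>t u. lam = 1 \<longrightarrow> t \<noteq> 0 \<longrightarrow> u \<noteq> 0 \<longrightarrow> t\<^sup>2 = 2 * u\<^sup>2 \<longrightarrow>
      C (P.dlog t mod n) \<noteq> (C (P.dlog u mod n) + Q.dlog (1 - \<xi>)) mod d"
    using avoiding_colouring_exists[OF g p n ndvd] by blast
  interpret block_construction g h lam d n \<xi> C
    by unfold_locales (use p n q xi C in auto)
  show ?thesis by (rule difference_family_exists[OF Q])
qed

theorem theorem3p10: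
  fixes p q lam d :: nat
  assumes "CARD('a::{field,finite}) = p"
    and "CARD('b::{field,finite}) = q"
    and "[p = 1] (mod 4)"
    and "lam > 0"
    and "lam dvd (p - 1) div 4"
    and "d = (p - 1) div (4 * lam)"
  shows
    "(([p = 1] (mod 12) \<or> [p = 5] (mod 12)) \<longrightarrow>
        [lam * (q - 1) = 0] (mod (p - 1)) \<longrightarrow> real q > Q_bound d (p - 4) \<longrightarrow>
        (\<exists>Bs. relative_difference_family
               (UNIV :: ('a \<times> 'b) set) (UNIV \<times> {0}) p lam Bs))
     \<and>
     ((\<exists>e\<ge>1. p = 9 ^ e) \<longrightarrow>
        [lam * (q - 1) = 0] (mod (p - 1)) \<longrightarrow> real q > Q_bound d (p - 4) \<longrightarrow>
        (\<forall>\<xi> :: 'b. primitive_root_of_unity 4 \<xi> \<longrightarrow>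
           (lam > 1 \<or> 1 - \<xi> \<notin> nonzero_powers d) \<longrightarrow>
           (\<exists>Bs. relative_difference_family
                  (UNIV :: ('a \<times> 'b) set) (UNIV \<times> {0}) p lam Bs)))"
proof -
  define n where "n = (p - 1) div 4"
  have p1: "p > 1" using card_mono[of UNIV "{0, 1 :: 'a}"] assms(1) by simp
  have "4 dvd p - 1" using assms(3) p1 by (simp add: cong_altdef_nat)
  hence pn: "p = 4 * n + 1" using p1 by (simp add: n_def)
  have n0: "n > 0" using pn p1 by (intro Nat.gr0I) simp
  have dn: "d = n div lam" using assms(6) by (simp add: n_def div_mult2_eq)
  have nd: "n = d * lam" using assms(5) unfolding dn n_def[symmetric] by simp
  have dvd: "4 * d dvd q - 1" if "[lam * (q - 1) = 0] (mod (p - 1))"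
  proof -
    have "p - 1 = lam * (4 * d)" by (simp add: pn nd)
    hence "lam * (4 * d) dvd lam * (q - 1)" using that by (simp add: cong_0_iff)
    thus ?thesis using assms(4) by simp
  qed
  have m: "p - 4 = 4 * n - 3" by (simp add: pn)
  have main: "\<exists>Bs. relative_difference_family (UNIV :: ('a \<times> 'b) set) (UNIV \<times> {0}) p lam Bs"
    if "[lam * (q - 1) = 0] (mod (p - 1))" "real q > Q_bound d (p - 4)" "\<xi>\<^sup>2 = -1" "(1::'b) \<noteq> -1"
      "lam = 1 \<Longrightarrow> CHAR('a) = 3 \<Longrightarrow> 1 - \<xi> \<notin> nonzero_powers d" for \<xi> :: 'b
    using difference_family_from_fourth_root[where ?'a = 'a, of n d lam \<xi>] that dvd[OF that(1)] nd n0
      assms(1,2) pn unfolding m by simp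
  have "\<exists>Bs. relative_difference_family (UNIV :: ('a \<times> 'b) set) (UNIV \<times> {0}) p lam Bs"
    if p12: "[p = 1] (mod 12) \<or> [p = 5] (mod 12)" and q: "[lam * (q - 1) = 0] (mod (p - 1))"
      and Q: "real q > Q_bound d (p - 4)"
  proof -
    obtain h :: 'b where h: "generated_field h"
      using finite_field_generator[where ?'k = 'b] unfolding generated_field_def by blast
    interpret generated_field h by (rule h)
    have "4 dvd q - 1" using dvd[OF q] by (metis dvd_mult_left)
    then obtain v where v: "q - 1 = 4 * v" by blast
    have v0: "v > 0" using v card_gt_1 assms(2) by (intro Nat.gr0I) simp
    have cb: "CARD('b) - 1 = 4 * v" by (simp only: assms(2) v)
    \<comment> \<open>Since 4 divides q - 1, a generator raised to (q - 1) / 4 is a primitive fourth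
      root of unity.\<close>
    define \<xi> where "\<xi> = h ^ v"
    have "h ^ (4 * v) = 1" unfolding g_pow_eq_1_iff cb by simp
    hence "(\<xi>\<^sup>2)\<^sup>2 = 1" by (simp add: \<xi>_def mult.commute flip: power_mult)
    moreover have ne: "\<xi>\<^sup>2 \<noteq> 1"
    proof
      assume "\<xi>\<^sup>2 = 1"
      hence "h ^ (2 * v) = 1" by (simp add: \<xi>_def mult.commute flip: power_mult)
      hence "4 * v dvd 2 * v" by (simp only: g_pow_eq_1_iff cb)
      thus False using v0 by (auto dest: dvd_imp_le)
    qed
    ultimately have xi: "\<xi>\<^sup>2 = -1" using power2_eq_1_iff by blast
    \<comment> \<open>The residues 1 and 5 modulo 12 are prime to 3, so characteristic 3 is excluded
      and the condition on 1 - \<xi> is vacuous.\<close>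
    have "CHAR('a) \<noteq> 3"
    proof
      assume "CHAR('a) = 3"
      hence "3 dvd p" using CHAR_dvd_CARD[where ?'a = 'a] assms(1) by simp
      moreover have "p mod 3 = p mod 12 mod 3" by (simp add: mod_mod_cancel)
      ultimately show False using p12 by (auto simp: cong_def dvd_eq_mod_eq_0)
    qed
    thus ?thesis using main[OF q Q xi] ne xi by metis
  qed
  moreover have "\<exists>Bs. relative_difference_family (UNIV :: ('a \<times> 'b) set) (UNIV \<times> {0}) p lam Bs"
    if q: "[lam * (q - 1) = 0] (mod (p - 1))" and Q: "real q > Q_bound d (p - 4)"
      and xi: "primitive_root_of_unity 4 \<xi>" and or: "lam > 1 \<or> 1 - \<xi> \<notin> nonzero_powers d" for \<xi> :: 'b
  proof -
    have "\<xi> ^ 4 = 1" and ne: "\<xi>\<^sup>2 \<noteq> 1" using xi by (auto simp: primitive_root_of_unity_def)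
    hence "(\<xi>\<^sup>2)\<^sup>2 = 1" by (simp add: power4_eq_xxxx power2_eq_square mult.assoc)
    hence eq: "\<xi>\<^sup>2 = -1" using ne power2_eq_1_iff by blast
    have "(1::'b) \<noteq> -1" using ne unfolding eq by metis
    thus ?thesis using main[OF q Q eq] or by (metis less_irrefl)
  qed
  ultimately show ?thesis by blast
qed

end
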